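(* Let $d\ge1$, $\alpha\in(-\tfrac12,\infty)^d$ and $0<\lambda<\beta<1$. Then the Laguerre fractional derivative $D_\lambda^\alpha$ of order $\lambda$ is bounded from $Lip_\beta(\mu_\alpha)$ to $Lip_{\beta-\lambda}(\mu_\alpha)$; that is, there is a constant $C$ such that for every $f\in Lip_\beta(\mu_\alpha)$ one has $D_\lambda^\alpha f\in Lip_{\beta-\lambda}(\mu_\alpha)$ and $\|D_\lambda^\alpha f\|_{Lip_{\beta-\lambda}(\mu_\alpha)}\le C\|f\|_{Lip_\beta(\mu_\alpha)}$.
   Context: Let $\mathbb{R}_+^d=(0,\infty)^d$ and, for $\alpha=(\alpha_1,\dots,\alpha_d)\in(-1,\infty)^d$, let $\mathrm{d}\mu_\alpha(x)=\prod_{i=1}^d\frac{x_i^{\alpha_i}e^{-x_i}}{\Gamma(\alpha_i+1)}\,\mathrm{d}x$ be the Laguerre measure on $\mathbb{R}_+^d$. The Laguerre operator $\mathcal{L}^\alpha=-\sum_{i=1}^d\big[x_i\partial_{x_i}^2+(\alpha_i+1-x_i)\partial_{x_i}\big]$ is positive and self-adjoint (after closure) in $L^2(\mathbb{R}_+^d,\mathrm{d}\mu_\alpha)$. Laguerre semigroup: $T_t^\alpha=e^{-t\mathcal{L}^\alpha}$, given for $t>0$ by $T_t^\alpha f(x)=\int_{\mathbb{R}_+^d}G_t^\alpha(x,y)f(y)\,\mathrm{d}\mu_\alpha(y)$ with $$G_t^\alpha(x,y)=\prod_{j=1}^d\frac{\Gamma(\alpha_j+1)}{1-e^{-t}}\,e^{-\frac{e^{-t}}{1-e^{-t}}(x_j+y_j)}\big(\sqrt{e^{-t}x_jy_j}\big)^{-\alpha_j}I_{\alpha_j}\Big(\frac{2\sqrt{e^{-t}x_jy_j}}{1-e^{-t}}\Big),$$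 where $I_\nu$ is the modified Bessel function of the first kind of order $\nu$. Poisson-Laguerre semigroup: $P_t^\alpha=e^{-t\sqrt{\mathcal{L}^\alpha}}$, given for $t>0$ by $$P_t^\alpha f(x)=\int_0^\infty T_s^\alpha f(x)\,\frac{t}{2\sqrt\pi}\,\frac{e^{-t^2/(4s)}}{s^{3/2}}\,\mathrm{d}s .$$ Laguerre Lipschitz space: for $\beta>0$ let $n$ be the smallest integer greater than $\beta$. A function $f\in L^\infty(\mathbb{R}_+^d)$ belongs to $Lip_\beta(\mu_\alpha)$ if there is a constant $A_\beta(f)$ with $\big\|\frac{\partial^nP_t^\alpha f}{\partial t^n}\big\|_\infty\le A_\beta(f)t^{-n+\beta}$ for all $t>0$. The norm is $\|f\|_{Lip_\beta(\mu_\alpha)}=\|f\|_\infty+A_\beta(f)$, with $A_\beta(f)$ the smallest such constant. Laguerre fractional derivative of order $\lambda>0$: formally $D_\lambda^\alpha=(\mathcal{L}^\alpha)^{\lambda/2}$. For $0<\lambda<\beta<1$ and $f\in Lip_\beta(\mu_\alpha)$ it is given by $$D_\lambda^\alpha f=\frac1{c_\lambda}\int_0^\infty s^{-\lambda-1}(P_s^\alpha-I)f\,\mathrm{d}s,\qquad c_\lambda=\int_0^\infty u^{-\lambda-1}(e^{-u}-1)\,\mathrm{d}u .$$ *)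

theory Defs
  imports "HOL-Analysis.Analysis" "HOL-Probability.Essential_Supremum"
begin

definition bessel_I :: "real \<Rightarrow> real \<Rightarrow> real" where
  "bessel_I \<nu> z = (\<Sum>k. (z / 2) powr (2 * real k + \<nu>) / (fact k * Gamma (real k + \<nu> + 1)))"

definition pos_orthant :: "(real ^ 'd) set" where
  "pos_orthant = {x. \<forall>i. 0 < x $ i}"

(* The underlying space of the measure is the orthant itself, so measurability, integrals
   and essential suprema below never see the values of a function outside the orthant. *)
definition laguerre_measure :: "real ^ 'd \<Rightarrow> (real ^ 'd) measure" where
  "laguerre_measure \<alpha> =
     density (restrict_space lborel pos_orthant)
       (\<lambda>x. ennreal (\<Prod>i\<in>UNIV. (x $ i) powr (\<alpha> $ i) * exp (- (x $ i)) / Gamma (\<alpha> $ i + 1)))"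

definition laguerre_kernel :: "real ^ 'd \<Rightarrow> real \<Rightarrow> real ^ 'd \<Rightarrow> real ^ 'd \<Rightarrow> real" where
  "laguerre_kernel \<alpha> t x y =
     (\<Prod>j\<in>UNIV. Gamma (\<alpha> $ j + 1) / (1 - exp (- t))
        * exp (- (exp (- t) / (1 - exp (- t))) * (x $ j + y $ j))
        * sqrt (exp (- t) * x $ j * y $ j) powr (- \<alpha> $ j)
        * bessel_I (\<alpha> $ j) (2 * sqrt (exp (- t) * x $ j * y $ j) / (1 - exp (- t))))"

(* Functions are real-valued; the two semigroups are meaningful for t > 0 and x in the
   orthant only. *)
definition laguerre_semigroup ::
    "real ^ 'd \<Rightarrow> real \<Rightarrow> (real ^ 'd \<Rightarrow> real) \<Rightarrow> real ^ 'd \<Rightarrow> real" where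
  "laguerre_semigroup \<alpha> t f x = (\<integral>y. laguerre_kernel \<alpha> t x y * f y \<partial>laguerre_measure \<alpha>)"

definition poisson_laguerre ::
    "real ^ 'd \<Rightarrow> real \<Rightarrow> (real ^ 'd \<Rightarrow> real) \<Rightarrow> real ^ 'd \<Rightarrow> real" where
  "poisson_laguerre \<alpha> t f x =
     (LBINT s:{0<..}. laguerre_semigroup \<alpha> s f x
        * (t / (2 * sqrt pi)) * (exp (- t\<^sup>2 / (4 * s)) / s powr (3 / 2)))"

definition Linf_norm :: "'a measure \<Rightarrow> ('a \<Rightarrow> real) \<Rightarrow> ereal" where
  "Linf_norm M f = esssup M (\<lambda>x. ereal \<bar>f x\<bar>)"

definition lip_order :: "real \<Rightarrow> nat" where
  "lip_order \<beta> = (LEAST n. \<beta> < real n)"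

definition laguerre_lip_bound ::
    "real ^ 'd \<Rightarrow> real \<Rightarrow> (real ^ 'd \<Rightarrow> real) \<Rightarrow> real \<Rightarrow> bool" where
  "laguerre_lip_bound \<alpha> \<beta> f A \<longleftrightarrow>
     (\<forall>t>0. Linf_norm (laguerre_measure \<alpha>)
              (\<lambda>x. (deriv ^^ lip_order \<beta>) (\<lambda>s. poisson_laguerre \<alpha> s f x) t)
            \<le> ereal (A * t powr (- real (lip_order \<beta>) + \<beta>)))"

(* Elements of the space are representatives rather than almost-everywhere classes; every
   notion below depends only on the class, the fractional derivative up to a null set. *)
definition laguerre_Lip :: "real ^ 'd \<Rightarrow> real \<Rightarrow> (real ^ 'd \<Rightarrow> real) set" where
  "laguerre_Lip \<alpha> \<beta> =
     {f \<in> borel_measurable (laguerre_measure \<alpha>).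
        Linf_norm (laguerre_measure \<alpha>) f < \<infinity> \<and> (\<exists>A. laguerre_lip_bound \<alpha> \<beta> f A)}"

(* The admissible constants form a closed set of nonnegative reals, so for f in the space
   the infimum is the smallest admissible constant. *)
definition laguerre_lip_const :: "real ^ 'd \<Rightarrow> real \<Rightarrow> (real ^ 'd \<Rightarrow> real) \<Rightarrow> real" where
  "laguerre_lip_const \<alpha> \<beta> f = Inf {A. laguerre_lip_bound \<alpha> \<beta> f A}"

definition laguerre_lip_norm :: "real ^ 'd \<Rightarrow> real \<Rightarrow> (real ^ 'd \<Rightarrow> real) \<Rightarrow> real" where
  "laguerre_lip_norm \<alpha> \<beta> f =
     real_of_ereal (Linf_norm (laguerre_measure \<alpha>) f) + laguerre_lip_const \<alpha> \<beta> f"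

definition frac_const :: "real \<Rightarrow> real" where
  "frac_const \<kappa> = (LBINT u:{0<..}. u powr (- \<kappa> - 1) * (exp (- u) - 1))"

definition laguerre_frac_integrand ::
    "real ^ 'd \<Rightarrow> real \<Rightarrow> (real ^ 'd \<Rightarrow> real) \<Rightarrow> real ^ 'd \<Rightarrow> real \<Rightarrow> real" where
  "laguerre_frac_integrand \<alpha> \<kappa> f x s = s powr (- \<kappa> - 1) * (poisson_laguerre \<alpha> s f x - f x)"

(* For f in a Lipschitz space of order greater than \<kappa> the integral converges for almost every
   x; at the remaining points the Lebesgue integral takes the default value 0. *)
definition laguerre_frac_deriv ::
    "real ^ 'd \<Rightarrow> real \<Rightarrow> (real ^ 'd \<Rightarrow> real) \<Rightarrow> real ^ 'd \<Rightarrow> real" where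
  "laguerre_frac_deriv \<alpha> \<kappa> f x =
     1 / frac_const \<kappa> * (LBINT s:{0<..}. laguerre_frac_integrand \<alpha> \<kappa> f x s)"

end

(* The Laguerre semigroup acts by transition probabilities: expanding the Bessel function shows that
   G_t(x, y) dmu(y) is a Poisson mixture of Gamma distributions, so its Laplace transform is explicit
   and visibly compatible with composition in t.  The subordinating densities of the Poisson semigroup
   have Laplace transform exp(-t sqrt l) in s.  Since a finite measure on the positive orthant is
   determined by its Laplace transform (Stone-Weierstrass after the substitution u = exp(-x)), both
   families, and hence P_t, form Markov semigroups.  Symmetry of the kernel, tested against
   exponentials, shows that P_t f can only converge to f as t tends to 0.

   Write v_t for the time derivative of P_t f.  Subordination gives |v_t| <= 8 |f| / t, and
   v_(t+s) = P_s v_t turns the Lipschitz hypothesis into bounds at every point: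
   |v_t| <= A (t/2)^(beta-1) and |v_(t+s) - v_t| <= 8 A s (t/2)^(beta-2).  Integrating the first yields
   |P_t f - f| <= (2 A / beta) t^beta, hence the boundedness of D f; inserting both into
   d/dt P_t D f = (1/c) int_0^oo s^(-kappa-1) (v_(t+s) - v_t) ds and splitting at s = t
   yields the Lipschitz bound of order beta - kappa. *)

theory Submission
  imports Defs "HOL-Probability.Probability"
begin

section \<open>Uniqueness of the Laplace transform\<close>

text \<open>Two gaps separate the Lipschitz hypothesis from the estimates. It bounds v_t only almost
  everywhere, with a null set that depends on t. Running the semigroup for half of the time repairs
  this: v_t = P_(t/2) v_(t/2) holds at each x, and the measure behind P_(t/2) at x is absolutely
  continuous; the price is t/2 in place of t. The bound on v_t is integrable at 0 and yields some
  limit g at every point by itself. That g = f almost everywhere is then a question about weak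
  limits: symmetry moves the semigroup from f onto exp(-l x), where it is explicit. The constant 8
  comes from |d/dt rho_t| <= (4/a) rho_a for t >= 2a, with rho the density of the subordinator,
  taken at a = t/2. Domination inside the same family means that the total mass 1 is the only
  integral that has to be known. All estimates are made for an arbitrary admissible A; the smallest
  one enters only at the end, through an infimum.\<close>

inductive_set monomial_span :: "('a::euclidean_space \<Rightarrow> real) set" where
  monomial: "(\<lambda>u. c * (\<Prod>b\<in>Basis. (u \<bullet> b) ^ n b)) \<in> monomial_span"
| add: "f \<in> monomial_span \<Longrightarrow> g \<in> monomial_span \<Longrightarrow> (\<lambda>u. f u + g u) \<in> monomial_span"

text \<open>A product of monomials is a monomial, so closure under sums suffices in the definition;
  inductions over the span then have only a monomial case and a sum case.\<close>

lemma monomial_span_mult: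
  assumes "f \<in> monomial_span" "g \<in> monomial_span"
  shows "(\<lambda>u. f u * g u) \<in> monomial_span"
  using assms(1)
proof induction
  case (monomial c n)
  from assms(2) show ?case
  proof induction
    case (monomial c' n')
    have "(\<lambda>u. (c * c') * (\<Prod>b\<in>Basis. (u \<bullet> b) ^ (n b + n' b))) \<in> (monomial_span :: ('a \<Rightarrow> real) set)"
      by (rule monomial_span.monomial)
    then show ?case
      by (simp add: power_add prod.distrib mult_ac)
  next
    case (add f g)
    then show ?case
      by (simp add: distrib_left monomial_span.add)
  qed
next
  case (add f g)
  then show ?case
    by (simp add: distrib_right monomial_span.add)
qed

lemma monomial_span_const: "(\<lambda>_. c) \<in> monomial_span"
  using monomial_span.monomial[of c "\<lambda>_. 0"] by simp

lemma monomial_span_component: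
  assumes "b \<in> Basis"
  shows "(\<lambda>u. u \<bullet> b) \<in> monomial_span"
proof -
  have "(\<Prod>i\<in>Basis. (u \<bullet> i) ^ (if i = b then 1 else 0)) = u \<bullet> b" for u :: 'a
    using assms by (subst prod.remove[of _ b]) auto
  then show ?thesis
    using monomial_span.monomial[of 1 "\<lambda>i. if i = b then 1 else 0"] by simp
qed

lemma monomial_span_continuous: "f \<in> monomial_span \<Longrightarrow> continuous_on S f"
  by (induction rule: monomial_span.induct) (auto intro!: continuous_intros)

lemma monomial_span_dense:
  fixes f :: "'a::euclidean_space \<Rightarrow> real"
  assumes "compact S" "continuous_on S f" "0 < e"
  shows "\<exists>g\<in>monomial_span. \<forall>x\<in>S. \<bar>f x - g x\<bar> < e"
proof -
  interpret function_ring_on monomial_span S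
  proof
    fix x y :: 'a assume "x \<noteq> y"
    then obtain b where "b \<in> Basis" "x \<bullet> b \<noteq> y \<bullet> b"
      using euclidean_eq_iff by blast
    then show "\<exists>f\<in>monomial_span. f x \<noteq> f y"
      by (intro bexI[of _ "\<lambda>u. u \<bullet> b"]) (auto intro: monomial_span_component)
  next
    show "compact S" by fact
    show "continuous_on S f" if "f \<in> monomial_span" for f
      using that by (rule monomial_span_continuous)
    show "(\<lambda>x. f x + g x) \<in> monomial_span" if "f \<in> monomial_span" "g \<in> monomial_span" for f g :: "'a \<Rightarrow> real"
      using that by (rule monomial_span.add)
    show "(\<lambda>x. f x * g x) \<in> monomial_span" if "f \<in> monomial_span" "g \<in> monomial_span" for f g :: "'a \<Rightarrow> real"
      using that by (rule monomial_span_mult)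
    show "(\<lambda>_. c) \<in> monomial_span" for c
      by (rule monomial_span_const)
  qed
  show ?thesis
    using Stone_Weierstrass_basic[OF assms(2,3)] .
qed

section \<open>Equality of measures from equality of Laplace transforms\<close>

definition exp_coord :: "'a::euclidean_space \<Rightarrow> 'a" where
  "exp_coord x = (\<Sum>b\<in>Basis. exp (- (x \<bullet> b)) *\<^sub>R b)"

lemma inner_exp_coord [simp]: "b \<in> Basis \<Longrightarrow> exp_coord x \<bullet> b = exp (- (x \<bullet> b))"
  by (simp add: exp_coord_def)

lemma borel_measurable_exp_coord [measurable]: "exp_coord \<in> borel_measurable borel"
  unfolding exp_coord_def by measurable

context
  fixes S and N1 N2 :: "'a::euclidean_space measure"
  assumes nonneg: "\<And>x b. x \<in> S \<Longrightarrow> b \<in> Basis \<Longrightarrow> 0 \<le> x \<bullet> b"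
    and sets: "sets N1 = sets (restrict_space borel S)" "sets N2 = sets (restrict_space borel S)"
    and fin: "finite_measure N1" "finite_measure N2"
    and eq: "\<And>l. (\<And>b. b \<in> Basis \<Longrightarrow> 0 \<le> l \<bullet> b) \<Longrightarrow>
      (\<integral>\<^sup>+x. ennreal (exp (- (l \<bullet> x))) \<partial>N1) = (\<integral>\<^sup>+x. ennreal (exp (- (l \<bullet> x))) \<partial>N2)"
begin

text \<open>With u = \<open>exp_coord x\<close>, the monomial with exponents n is exp(-(l . x)) for
  the vector l of exponents. The hypothesis at lattice points l therefore settles monomials, and
  sums follow by linearity, which is why integrability is carried along.\<close>

lemma integral_monomial_exp_coord_eq:
  assumes g: "g \<in> monomial_span"
  shows "integrable N1 (\<lambda>x. g (exp_coord x)) \<and> integrable N2 (\<lambda>x. g (exp_coord x)) \<and>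
    (\<integral>x. g (exp_coord x) \<partial>N1) = (\<integral>x. g (exp_coord x) \<partial>N2)"
  using g
proof induction
  case (monomial c n)
  define l :: 'a where "l = (\<Sum>b\<in>Basis. real (n b) *\<^sub>R b)"
  have lb: "l \<bullet> b = real (n b)" if "b \<in> Basis" for b
    using that by (simp add: l_def)
  have *: "(\<Prod>b\<in>Basis. (exp_coord x \<bullet> b) ^ n b) = exp (- (l \<bullet> x))" for x
  proof -
    have "(\<Prod>b\<in>Basis. (exp_coord x \<bullet> b) ^ n b) = (\<Prod>b\<in>Basis. exp (- (real (n b) * (x \<bullet> b))))"
      by (intro prod.cong refl) (simp add: exp_of_nat_mult[symmetric])
    also have "\<dots> = exp (\<Sum>b\<in>Basis. - (real (n b) * (x \<bullet> b)))"
      by (simp add: exp_sum)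
    also have "(\<Sum>b\<in>Basis. - (real (n b) * (x \<bullet> b))) = - (l \<bullet> x)"
      by (subst euclidean_inner) (simp add: sum_negf lb)
    finally show ?thesis .
  qed
  have meas: "(\<lambda>x. exp (- (l \<bullet> x))) \<in> borel_measurable N" 
    if "sets N = sets (restrict_space borel S)" for N
    unfolding measurable_cong_sets[OF that refl]
    by (intro measurable_restrict_space1) simp
  have le: "exp (- (l \<bullet> x)) \<le> 1" if "x \<in> S" for x
    using that nonneg by (subst euclidean_inner) (auto intro!: sum_nonneg simp: lb)
  have int: "integrable N (\<lambda>x. exp (- (l \<bullet> x)))"
    if "sets N = sets (restrict_space borel S)" "finite_measure N" for N
  proof -
    interpret finite_measure N by fact
    show ?thesis
      using le sets_eq_imp_space_eq[OF that(1)]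
      by (intro integrable_const_bound[of _ 1] AE_I2 meas that) (auto simp: space_restrict_space)
  qed
  have "(\<integral>x. exp (- (l \<bullet> x)) \<partial>N1) = (\<integral>x. exp (- (l \<bullet> x)) \<partial>N2)"
    by (subst (1 2) integral_eq_nn_integral) (auto intro!: meas sets simp: eq lb)
  then show ?case
    unfolding * using int[OF sets(1) fin(1)] int[OF sets(2) fin(2)] by simp
next
  case (add f g)
  then show ?case by simp
qed

text \<open>\<open>exp_coord\<close> sends the unbounded set S into the compact unit cube. There h
  is uniformly close to a polynomial, and finite total mass turns a uniform error into an error of
  the integrals.\<close>

lemma integral_continuous_exp_coord_eq:
  assumes h: "continuous_on UNIV h" "\<And>u. \<bar>h u\<bar> \<le> (1::real)"
  shows "(\<integral>x. h (exp_coord x) \<partial>N1) = (\<integral>x. h (exp_coord x) \<partial>N2)"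
proof -
  define K where "K = cbox 0 (One :: 'a)"
  have E: "exp_coord x \<in> K" if "x \<in> S" for x
    using nonneg[OF that] by (auto simp: K_def mem_box)
  have meas [measurable]: "(\<lambda>x. h (exp_coord x)) \<in> borel_measurable N" 
    if "sets N = sets (restrict_space borel S)" for N
    unfolding measurable_cong_sets[OF that refl]
    using borel_measurable_continuous_onI[OF h(1)]
    by (intro measurable_restrict_space1) simp
  have int: "integrable N (\<lambda>x. h (exp_coord x))"
    if "sets N = sets (restrict_space borel S)" "finite_measure N" for N
  proof -
    interpret finite_measure N by fact
    show ?thesis
      using h(2) by (intro integrable_const_bound[of _ 1] AE_I2 meas that) auto
  qed
  have close: "\<bar>(\<integral>x. h (exp_coord x) \<partial>N) - (\<integral>x. g (exp_coord x) \<partial>N)\<bar> \<le> e * measure N (space N)"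
    if "sets N = sets (restrict_space borel S)" "finite_measure N"
      "integrable N (\<lambda>x. g (exp_coord x))" "\<forall>x\<in>K. \<bar>h x - g x\<bar> < e" for N g e
  proof -
    interpret finite_measure N by fact
    have "\<bar>(\<integral>x. h (exp_coord x) \<partial>N) - (\<integral>x. g (exp_coord x) \<partial>N)\<bar>
        = \<bar>(\<integral>x. h (exp_coord x) - g (exp_coord x) \<partial>N)\<bar>"
      using int that by simp
    also have "\<dots> \<le> (\<integral>x. \<bar>h (exp_coord x) - g (exp_coord x)\<bar> \<partial>N)"
      by (rule integral_abs_bound)
    also have "\<dots> \<le> (\<integral>x. e \<partial>N)"
    proof (rule integral_mono)
      show "integrable N (\<lambda>x. \<bar>h (exp_coord x) - g (exp_coord x)\<bar>)"
        using int that by (intro integrable_abs Bochner_Integration.integrable_diff) auto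
      fix x assume "x \<in> space N"
      then have "x \<in> S" using sets_eq_imp_space_eq[OF that(1)] by (auto simp: space_restrict_space)
      then show "\<bar>h (exp_coord x) - g (exp_coord x)\<bar> \<le> e"
        using E that(4) by (meson less_imp_le)
    qed simp
    finally show ?thesis by (simp add: mult.commute)
  qed
  let ?m = "measure N1 (space N1) + measure N2 (space N2)"
  have bound: "\<bar>(\<integral>x. h (exp_coord x) \<partial>N1) - (\<integral>x. h (exp_coord x) \<partial>N2)\<bar> \<le> e * ?m" if "0 < e" for e
  proof -
    have "compact K" "continuous_on K h"
      using h(1) by (auto simp: K_def intro: continuous_on_subset)
    then obtain g where g: "g \<in> monomial_span" "\<forall>x\<in>K. \<bar>h x - g x\<bar> < e"
      using monomial_span_dense \<open>0 < e\<close> by blast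
    have i: "integrable N1 (\<lambda>x. g (exp_coord x)) \<and> integrable N2 (\<lambda>x. g (exp_coord x)) \<and>
        (\<integral>x. g (exp_coord x) \<partial>N1) = (\<integral>x. g (exp_coord x) \<partial>N2)"
      by (rule integral_monomial_exp_coord_eq[OF g(1)])
    have "\<bar>(\<integral>x. h (exp_coord x) \<partial>N1) - (\<integral>x. g (exp_coord x) \<partial>N1)\<bar> \<le> e * measure N1 (space N1)"
      using i by (intro close sets fin g(2)) auto
    moreover have "\<bar>(\<integral>x. h (exp_coord x) \<partial>N2) - (\<integral>x. g (exp_coord x) \<partial>N2)\<bar> \<le> e * measure N2 (space N2)"
      using i by (intro close sets fin g(2)) auto
    ultimately show ?thesis
      using i unfolding distrib_left by linarith
  qed
  \<comment> \<open>The denominator m + 1 instead of m covers the case that both measures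
    vanish.\<close>
  have shrink: "e / (m + 1) * m \<le> e" if "0 \<le> m" "0 < e" for e m :: real
    using that by (simp add: field_simps)
  have "\<bar>(\<integral>x. h (exp_coord x) \<partial>N1) - (\<integral>x. h (exp_coord x) \<partial>N2)\<bar> \<le> 0"
  proof (rule field_le_epsilon)
    fix e :: real assume "0 < e"
    have "0 \<le> ?m" by simp
    then have "\<bar>(\<integral>x. h (exp_coord x) \<partial>N1) - (\<integral>x. h (exp_coord x) \<partial>N2)\<bar> \<le> e / (?m + 1) * ?m"
      using \<open>0 < e\<close> by (intro bound divide_pos_pos add_nonneg_pos) simp_all
    also have "\<dots> \<le> 0 + e"
      using \<open>0 < e\<close> \<open>0 \<le> ?m\<close> shrink by simp
    finally show "\<bar>(\<integral>x. h (exp_coord x) \<partial>N1) - (\<integral>x. h (exp_coord x) \<partial>N2)\<bar> \<le> 0 + e" .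
  qed
  then show ?thesis by simp
qed

text \<open>Closedness makes the distance positive off C, so the cutoff is eventually 0 there. C has
  to be nonempty because \<open>infdist\<close> to the empty set is 0, which would make every cutoff
  1.\<close>

lemma infdist_cutoff_tendsto_indicator:
  assumes "closed C" "C \<noteq> {}"
  shows "(\<lambda>k. max 0 (1 - real k * infdist u C)) \<longlonglongrightarrow> indicator C u"
proof (cases "u \<in> C")
  case False
  then have d: "0 < infdist u C"
    using assms by (meson infdist_pos_not_in_closed)
  then have "eventually (\<lambda>k. 1 / infdist u C < real k) sequentially"
    using filterlim_at_top_dense filterlim_real_sequentially by blast
  then have "eventually (\<lambda>k. max 0 (1 - real k * infdist u C) = 0) sequentially"
    by (rule eventually_mono) (use d in \<open>simp add: field_simps\<close>)
  then show ?thesis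
    using False by (simp add: tendsto_eventually)
qed (use assms in simp)

text \<open>The images under \<open>exp_coord\<close> agree on closed sets by dominated convergence
  of the cutoffs, and closed sets form a generator stable under intersection. A measurable left
  inverse of \<open>exp_coord\<close> carries the equality back to the measures themselves.\<close>

lemma laplace_transform_unique:
  assumes S: "S \<in> sets borel"
  shows "N1 = N2"
proof -
  have meas: "exp_coord \<in> N \<rightarrow>\<^sub>M borel" if "sets N = sets (restrict_space borel S)" for N
    unfolding measurable_cong_sets[OF that refl]
    by (intro measurable_restrict_space1) simp
  have space: "space N1 = S" "space N2 = S"
    using sets[THEN sets_eq_imp_space_eq] by (auto simp: space_restrict_space)
  have lim: "(\<lambda>k. \<integral>x. max 0 (1 - real k * infdist (exp_coord x) C) \<partial>N) \<longlonglongrightarrow>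
      measure (distr N borel exp_coord) C"
    if "sets N = sets (restrict_space borel S)" "finite_measure N" "closed C" "C \<noteq> {}" for N and C :: "'a set"
  proof -
    interpret finite_measure N by fact
    note meas[OF that(1), measurable]
    have [measurable]: "C \<in> sets borel" using that by simp
    have [measurable]: "(\<lambda>u. infdist u C) \<in> borel_measurable borel"
      by (intro borel_measurable_continuous_onI continuous_on_infdist continuous_on_id)
    have "(\<lambda>k. \<integral>x. max 0 (1 - real k * infdist (exp_coord x) C) \<partial>N) \<longlonglongrightarrow>
        (\<integral>x. indicator C (exp_coord x) \<partial>N)"
      by (intro integral_dominated_convergence[where w="\<lambda>_. 1"] AE_I2
          infdist_cutoff_tendsto_indicator that) (auto simp: infdist_nonneg)
    also have "(\<integral>x. indicator C (exp_coord x) \<partial>N) = (\<integral>x. indicat_real C x \<partial>distr N borel exp_coord)"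
      by (rule integral_distr[symmetric]) auto
    finally show ?thesis by simp
  qed
  have closed_eq: "measure (distr N1 borel exp_coord) C = measure (distr N2 borel exp_coord) C"
    if "closed C" for C :: "'a set"
  proof (cases "C = {}")
    case False
    have "(\<integral>x. max 0 (1 - real k * infdist (exp_coord x) C) \<partial>N1) =
        (\<integral>x. max 0 (1 - real k * infdist (exp_coord x) C) \<partial>N2)" for k
      by (rule integral_continuous_exp_coord_eq[where h="\<lambda>u. max 0 (1 - real k * infdist u C)"])
         (auto intro!: continuous_intros simp: infdist_nonneg)
    then show ?thesis
      using lim[OF sets(1) fin(1) that False] lim[OF sets(2) fin(2) that False]
      by (simp add: LIMSEQ_unique)
  qed simp
  interpret N1: finite_measure N1 by fact
  interpret N2: finite_measure N2 by fact
  interpret D1: finite_measure "distr N1 borel exp_coord"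
    by (intro N1.finite_measure_distr meas sets)
  interpret D2: finite_measure "distr N2 borel exp_coord"
    by (intro N2.finite_measure_distr meas sets)
  have distr_eq: "distr N1 borel exp_coord = distr N2 borel exp_coord"
  proof (rule measure_eqI_generator_eq[where E="Collect closed" and \<Omega>=UNIV and A="\<lambda>_. UNIV"])
    show "Int_stable (Collect (closed :: 'a set \<Rightarrow> bool))" by (auto simp: Int_stable_def)
    show "sets (distr N1 borel exp_coord) = sigma_sets UNIV (Collect closed)"
      "sets (distr N2 borel exp_coord) = sigma_sets UNIV (Collect closed)"
      by (simp_all add: borel_eq_closed)
    show "emeasure (distr N1 borel exp_coord) X = emeasure (distr N2 borel exp_coord) X"
      if "X \<in> Collect closed" for X
      using that closed_eq[of X]
      by (simp add: D1.emeasure_eq_measure D2.emeasure_eq_measure)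
  qed (auto simp: D1.emeasure_eq_measure)
  \<comment> \<open>A logarithm in each coordinate undoes \<open>exp_coord\<close>; only its values
    on the range of \<open>exp_coord\<close> matter.\<close>
  define L :: "'a \<Rightarrow> 'a" where "L u = (\<Sum>b\<in>Basis. (- ln (u \<bullet> b)) *\<^sub>R b)" for u
  have [measurable]: "L \<in> borel_measurable borel"
    unfolding L_def by measurable
  have L: "L (exp_coord x) = x" for x
    by (simp add: L_def euclidean_representation)
  show ?thesis
  proof (rule measure_eqI)
    fix A assume A: "A \<in> sets N1"
    then have "A \<in> sets borel" "A \<subseteq> S"
      using S by (auto simp: sets sets_restrict_space_iff)
    then have "A = exp_coord -` (L -` A) \<inter> S" "L -` A \<in> sets borel"
      using L measurable_sets[of L borel borel A] by auto
    then show "emeasure N1 A = emeasure N2 A"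
      using distr_eq meas[OF sets(1)] meas[OF sets(2)] space
      by (metis emeasure_distr)
  qed (simp add: sets)
qed

end

section \<open>The one-sided stable subordinator of index 1/2\<close>

lemma has_real_derivative_integral:
  fixes f f' :: "real \<Rightarrow> 'a \<Rightarrow> real"
  assumes t: "a < t" "t < b"
    and int: "\<And>u. a < u \<Longrightarrow> u < b \<Longrightarrow> integrable M (f u)"
    and deriv: "\<And>u x. a < u \<Longrightarrow> u < b \<Longrightarrow> x \<in> space M \<Longrightarrow>
      ((\<lambda>u. f u x) has_real_derivative f' u x) (at u)"
    and bound: "\<And>u x. a < u \<Longrightarrow> u < b \<Longrightarrow> x \<in> space M \<Longrightarrow> \<bar>f' u x\<bar> \<le> g x"
    and g: "integrable M g"
  shows "integrable M (f' t)"
    and "((\<lambda>u. \<integral>x. f u x \<partial>M) has_real_derivative (\<integral>x. f' t x \<partial>M)) (at t)"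
proof -
  have lim: "integrable M (f' t) \<and>
      (\<lambda>i. ((\<integral>x. f (X i) x \<partial>M) - (\<integral>x. f t x \<partial>M)) / (X i - t)) \<longlonglongrightarrow> (\<integral>x. f' t x \<partial>M)"
    if X: "X \<longlonglongrightarrow> t" "\<And>i. X i \<noteq> t" "\<And>i. a < X i" "\<And>i. X i < b" for X
  proof -
    let ?q = "\<lambda>i x. (f (X i) x - f t x) / (X i - t)"
    have q: "(\<lambda>i. ?q i x) \<longlonglongrightarrow> f' t x" if "x \<in> space M" for x
    proof -
      have "((\<lambda>y. (f y x - f t x) / (y - t)) \<longlongrightarrow> f' t x) (at t)"
        using deriv[OF t that] by (simp add: has_field_derivative_iff)
      then show ?thesis
        using X(1,2) by (auto simp: tendsto_at_iff_sequentially comp_def)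
    qed
    have q_bound: "norm (?q i x) \<le> g x" if "x \<in> space M" for i x
    proof -
      have "norm (f (X i) x - f t x) \<le> g x * norm (X i - t)"
        using X t that
        by (intro field_differentiable_bound[where S="{a<..<b}" and f'="\<lambda>u. f' u x"])
           (auto intro!: bound has_field_derivative_at_within[OF deriv])
      then show ?thesis
        using X(2)[of i] by (simp add: abs_divide divide_simps)
    qed
    have q_meas: "?q i \<in> borel_measurable M" for i
      using int[OF X(3,4)[of i]] int[OF t] by measurable
    have f'_meas: "f' t \<in> borel_measurable M"
      by (rule borel_measurable_LIMSEQ_real[OF q q_meas])
    have "integrable M (f' t)"
      using bound[OF t] by (intro Bochner_Integration.integrable_bound[OF g f'_meas]) (auto intro!: AE_I2 intro: order_trans abs_ge_self)
    moreover have "(\<lambda>i. \<integral>x. ?q i x \<partial>M) \<longlonglongrightarrow> (\<integral>x. f' t x \<partial>M)"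
      by (rule integral_dominated_convergence[OF f'_meas q_meas g AE_I2[OF q] AE_I2[OF q_bound]])
    moreover have eq: "(\<integral>x. ?q i x \<partial>M) = ((\<integral>x. f (X i) x \<partial>M) - (\<integral>x. f t x \<partial>M)) / (X i - t)" for i
      using int[OF X(3,4)[of i]] int[OF t] by simp
    ultimately show ?thesis unfolding eq by blast
  qed
  \<comment> \<open>One concrete sequence in (t, b) tending to t: applying \<open>lim\<close> to it
    extracts the integrability of f' t.\<close>
  define X where "X = (\<lambda>n. t + (b - t) * inverse (real (Suc (Suc n))))"
  have "X \<longlonglongrightarrow> t + (b - t) * 0"
    unfolding X_def by (intro tendsto_intros LIMSEQ_Suc[OF LIMSEQ_inverse_real_of_nat])
  then have X: "X \<longlonglongrightarrow> t" by simp
  have "(b - t) * inverse (real (Suc (Suc n))) < b - t" "0 < (b - t) * inverse (real (Suc (Suc n)))" for n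
    using t mult_strict_left_mono[of "inverse (real (Suc (Suc n)))" 1 "b - t"]
    by (simp_all add: inverse_less_1_iff)
  then have "X i \<noteq> t" "a < X i" "X i < b" for i
    using t unfolding X_def by (smt (verit))+
  with lim[OF X] show "integrable M (f' t)" by blast
  show "((\<lambda>u. \<integral>x. f u x \<partial>M) has_real_derivative (\<integral>x. f' t x \<partial>M)) (at t)"
    unfolding has_field_derivative_iff tendsto_at_iff_sequentially comp_def
  proof (intro allI impI)
    fix X assume X: "\<forall>i. X i \<in> UNIV - {t}" "X \<longlonglongrightarrow> t"
    \<comment> \<open>An arbitrary sequence may start outside (a, b), where nothing is assumed; a
      shift by N discards those terms.\<close>
    then have "eventually (\<lambda>i. X i \<in> {a<..<b}) sequentially"
      using t by (intro topological_tendstoD) auto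
    then obtain N where N: "\<And>i. N \<le> i \<Longrightarrow> X i \<in> {a<..<b}"
      by (auto simp: eventually_sequentially)
    have "(\<lambda>i. X (i + N)) \<longlonglongrightarrow> t"
      using X(2) by (rule LIMSEQ_ignore_initial_segment)
    then have "(\<lambda>i. ((\<integral>x. f (X (i + N)) x \<partial>M) - (\<integral>x. f t x \<partial>M)) / (X (i + N) - t)) \<longlonglongrightarrow> (\<integral>x. f' t x \<partial>M)"
      using N X(1) by (intro lim[THEN conjunct2]) auto
    then show "(\<lambda>i. ((\<integral>x. f (X i) x \<partial>M) - (\<integral>x. f t x \<partial>M)) / (X i - t)) \<longlonglongrightarrow> (\<integral>x. f' t x \<partial>M)"
      by (rule LIMSEQ_offset)
  qed
qed

section \<open>The Levy distribution and its Laplace transform\<close>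

abbreviation time_space :: "real measure" where
  "time_space \<equiv> restrict_space borel {0<..}"

text \<open>The distribution function of the normal law has the required limits, and an
  antiderivative F exists because the density is continuous. Both have the same increments, so they
  differ by a constant and the distribution function inherits the derivative.\<close>

lemma std_normal_antiderivative:
  obtains \<Phi> where "\<And>x. (\<Phi> has_real_derivative std_normal_density x) (at x)"
    "(\<Phi> \<longlongrightarrow> 0) at_bot" "(\<Phi> \<longlongrightarrow> 1) at_top"
proof -
  let ?N = "density lborel std_normal_density"
  interpret prob_space ?N
    by (rule prob_space_normal_density) simp
  interpret real_distribution ?N
    by unfold_locales simp_all
  have cont: "isCont std_normal_density x" for x
    unfolding std_normal_density_def by (intro continuous_intros) auto
  obtain F where F: "\<And>x. (F has_vector_derivative std_normal_density x) (at x)"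
    using einterval_antiderivative[of "-\<infinity>" "\<infinity>" std_normal_density] cont by auto
  have diff: "cdf ?N y - cdf ?N x = F y - F x" if "x \<le> y" for x y
  proof -
    \<comment> \<open>The distribution function measures half-open intervals and the fundamental
      theorem closed ones; they differ by a null point.\<close>
    have "emeasure ?N {x} = 0" for x
      by (simp add: emeasure_density nn_integral_0_iff_AE AE_lborel_singleton[of x])
    then have null: "{x} \<in> null_sets ?N" by auto
    have "emeasure ?N {x..y} = F y - F x"
      using that F
      by (simp add: emeasure_density)
         (subst nn_integral_FTC_Icc, auto simp: has_real_derivative_iff_has_vector_derivative
            intro: has_vector_derivative_at_within)
    moreover have "{x..y} = {x<..y} \<union> {x}" using that by auto
    moreover have "emeasure ?N ({x<..y} \<union> {x}) = emeasure ?N {x<..y}"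
      using null by (intro emeasure_Un_null_set) auto
    moreover have "F x \<le> F y"
      using that F by (intro DERIV_nonneg_imp_nondecreasing[of x y F])
        (auto simp: has_real_derivative_iff_has_vector_derivative intro!: exI[of _ "std_normal_density _"])
    ultimately have "emeasure ?N {x<..y} = ennreal (F y - F x)" "0 \<le> F y - F x"
      by simp_all
    then have "measure ?N {x<..y} = F y - F x"
      unfolding measure_def by simp
    then show ?thesis
      using that by (cases "x = y") (auto simp: cdf_diff_eq)
  qed
  define c where "c = cdf ?N 0 - F 0"
  have cdf_eq: "cdf ?N = (\<lambda>x. F x + c)"
  proof
    show "cdf ?N x = F x + c" for x
      using diff[of 0 x] diff[of x 0] unfolding c_def by (cases "0 \<le> x") auto
  qed
  have "(cdf ?N has_real_derivative std_normal_density x) (at x)" for x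
    unfolding cdf_eq using DERIV_add[OF F[of x, folded has_real_derivative_iff_has_vector_derivative] DERIV_const]
    by simp
  then show ?thesis
    using that cdf_lim_at_top_prob cdf_lim_at_bot by blast
qed

text \<open>The Levy density: the law of the first time at which standard Brownian motion reaches t
  / sqrt 2. It is factored like the weight in \<open>poisson_laguerre\<close>.\<close>

definition stable_density :: "real \<Rightarrow> real \<Rightarrow> real" where
  "stable_density t s = t / (2 * sqrt pi) * (exp (- t\<^sup>2 / (4 * s)) / s powr (3 / 2))"

definition stable_half :: "real \<Rightarrow> real measure" where
  "stable_half t = density (restrict_space lborel {0<..}) (\<lambda>s. ennreal (stable_density t s))"

lemma borel_measurable_stable_density [measurable]: "stable_density t \<in> borel_measurable borel"
  unfolding stable_density_def by measurable

lemma sets_stable_half [simp, measurable_cong]: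
  "sets (stable_half t) = sets time_space"
  by (simp add: stable_half_def sets_restrict_space)

lemma space_stable_half [simp]: "space (stable_half t) = {0<..}"
  by (simp add: stable_half_def space_restrict_space)

lemma borel_measurable_stable_half: "f \<in> borel_measurable borel \<Longrightarrow> f \<in> borel_measurable (stable_half t)"
  unfolding measurable_cong_sets[OF sets_stable_half refl] by (rule measurable_restrict_space1)

lemma stable_density_nonneg: "0 \<le> t \<Longrightarrow> 0 \<le> stable_density t s"
  by (simp add: stable_density_def)

lemma nn_integral_stable_half:
  assumes [measurable]: "f \<in> borel_measurable borel"
  shows "(\<integral>\<^sup>+s. f s \<partial>stable_half t) = (\<integral>\<^sup>+s. ennreal (stable_density t s) * f s * indicator {0<..} s \<partial>lborel)"
  unfolding stable_half_def
  by (subst nn_integral_density)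
     (auto intro!: measurable_restrict_space1 simp: nn_integral_restrict_space)

text \<open>\<open>H\<close> is an explicit antiderivative of the integrand. Up to the factor exp(-t
  sqrt l) it is the distribution function of the time at which Brownian motion with drift sqrt(2 l)
  reaches t / sqrt 2, so it rises from 0 to exp(-t sqrt l). Positive drift, that is l > 0, sends the
  second summand to 0 at infinity.\<close>

lemma laplace_stable_half_pos:
  assumes t: "0 < t" and l: "0 < l"
  shows "(\<integral>\<^sup>+s. ennreal (exp (- (l * s))) \<partial>stable_half t) = ennreal (exp (- (t * sqrt l)))"
proof -
  obtain \<Phi> where \<Phi>: "\<And>x. (\<Phi> has_real_derivative std_normal_density x) (at x)"
    "(\<Phi> \<longlongrightarrow> 0) at_bot" "(\<Phi> \<longlongrightarrow> 1) at_top"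
    by (rule std_normal_antiderivative) blast
  define H where "H s = exp (- (t * sqrt l)) * \<Phi> (sqrt (2 * l) * sqrt s - t / sqrt 2 / sqrt s) +
      exp (t * sqrt l) * \<Phi> (- sqrt (2 * l) * sqrt s - t / sqrt 2 / sqrt s)" for s
  let ?f = "\<lambda>s. stable_density t s * exp (- (l * s))"
  have deriv: "(H has_real_derivative ?f s) (at s)" if s: "0 < s" for s
  proof -
    \<comment> \<open>Completing the square: the mixed terms t sqrt l in the two exponents are
      cancelled by the weights, and both summands carry the same exponential factor.\<close>
    have dens: "exp (- (t * sqrt l)) * std_normal_density (sqrt (2 * l) * sqrt s - t / sqrt 2 / sqrt s)
        = exp (- t\<^sup>2 / (4 * s) - l * s) / sqrt (2 * pi)"
      "exp (t * sqrt l) * std_normal_density (- sqrt (2 * l) * sqrt s - t / sqrt 2 / sqrt s)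
        = exp (- t\<^sup>2 / (4 * s) - l * s) / sqrt (2 * pi)"
      using s t l unfolding std_normal_density_def
      by (simp_all add: exp_add[symmetric] power2_diff power_divide power_mult_distrib
          real_sqrt_mult field_simps power2_sum)
    have "((\<lambda>s. sqrt (2 * l) * sqrt s - t / sqrt 2 / sqrt s) has_real_derivative
        sqrt (2 * l) / (2 * sqrt s) + t / sqrt 2 / (2 * s * sqrt s)) (at s)"
      using s by (auto intro!: derivative_eq_intros simp: field_simps)
    from DERIV_chain2[OF \<Phi>(1) this]
    have 1: "((\<lambda>s. \<Phi> (sqrt (2 * l) * sqrt s - t / sqrt 2 / sqrt s)) has_real_derivative
        std_normal_density (sqrt (2 * l) * sqrt s - t / sqrt 2 / sqrt s) *
        (sqrt (2 * l) / (2 * sqrt s) + t / sqrt 2 / (2 * s * sqrt s))) (at s)" .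
    have "((\<lambda>s. - sqrt (2 * l) * sqrt s - t / sqrt 2 / sqrt s) has_real_derivative
        - sqrt (2 * l) / (2 * sqrt s) + t / sqrt 2 / (2 * s * sqrt s)) (at s)"
      using s by (auto intro!: derivative_eq_intros simp: field_simps)
    from DERIV_chain2[OF \<Phi>(1) this]
    have 2: "((\<lambda>s. \<Phi> (- sqrt (2 * l) * sqrt s - t / sqrt 2 / sqrt s)) has_real_derivative
        std_normal_density (- sqrt (2 * l) * sqrt s - t / sqrt 2 / sqrt s) *
        (- sqrt (2 * l) / (2 * sqrt s) + t / sqrt 2 / (2 * s * sqrt s))) (at s)" .
    have powr: "s powr (3 / 2) = s * sqrt s"
      using s powr_add[of s 1 "1/2"] by (simp add: powr_half_sqrt)
    \<comment> \<open>With the factor in common, the two terms in sqrt(2 l) cancel and the two terms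
      in t add up.\<close>
    have "exp (- (t * sqrt l)) * (std_normal_density (sqrt (2 * l) * sqrt s - t / sqrt 2 / sqrt s) *
        (sqrt (2 * l) / (2 * sqrt s) + t / sqrt 2 / (2 * s * sqrt s))) +
      exp (t * sqrt l) * (std_normal_density (- sqrt (2 * l) * sqrt s - t / sqrt 2 / sqrt s) *
        (- sqrt (2 * l) / (2 * sqrt s) + t / sqrt 2 / (2 * s * sqrt s)))
      = exp (- t\<^sup>2 / (4 * s) - l * s) / sqrt (2 * pi) * (2 * (t / sqrt 2 / (2 * s * sqrt s)))"
      unfolding mult.assoc[symmetric] dens by (simp add: algebra_simps)
    also have "\<dots> = ?f s"
      unfolding stable_density_def powr
      by (simp add: exp_diff exp_minus real_sqrt_mult field_simps)
    finally show ?thesis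
      unfolding H_def by (rule DERIV_cong[OF DERIV_add[OF DERIV_cmult[OF 1] DERIV_cmult[OF 2]]])
  qed
  have "filterlim (\<lambda>s. sqrt (2 * l) * sqrt s - t / sqrt 2 / sqrt s) at_top at_top"
    using l t by real_asymp
  then have top1: "((\<lambda>s. \<Phi> (sqrt (2 * l) * sqrt s - t / sqrt 2 / sqrt s)) \<longlongrightarrow> 1) at_top"
    by (rule filterlim_compose[OF \<Phi>(3)])
  have "filterlim (\<lambda>s. - sqrt (2 * l) * sqrt s - t / sqrt 2 / sqrt s) at_bot at_top"
    using l t by real_asymp
  then have top2: "((\<lambda>s. \<Phi> (- sqrt (2 * l) * sqrt s - t / sqrt 2 / sqrt s)) \<longlongrightarrow> 0) at_top"
    by (rule filterlim_compose[OF \<Phi>(2)])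
  have "filterlim (\<lambda>s. sqrt (2 * l) * sqrt s - t / sqrt 2 / sqrt s) at_bot (at_right 0)"
    using l t by real_asymp
  then have bot1: "((\<lambda>s. \<Phi> (sqrt (2 * l) * sqrt s - t / sqrt 2 / sqrt s)) \<longlongrightarrow> 0) (at_right 0)"
    by (rule filterlim_compose[OF \<Phi>(2)])
  have "filterlim (\<lambda>s. - sqrt (2 * l) * sqrt s - t / sqrt 2 / sqrt s) at_bot (at_right 0)"
    using l t by real_asymp
  then have bot2: "((\<lambda>s. \<Phi> (- sqrt (2 * l) * sqrt s - t / sqrt 2 / sqrt s)) \<longlongrightarrow> 0) (at_right 0)"
    by (rule filterlim_compose[OF \<Phi>(2)])
  have lim_top: "(H \<longlongrightarrow> exp (- (t * sqrt l))) at_top"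
    unfolding H_def using tendsto_add[OF tendsto_mult_left[OF top1] tendsto_mult_left[OF top2]] by simp
  have lim_0: "(H \<longlongrightarrow> 0) (at_right 0)"
    unfolding H_def using tendsto_add[OF tendsto_mult_left[OF bot1] tendsto_mult_left[OF bot2]] by simp
  have cont: "isCont ?f s" if "0 < s" for s
    using that unfolding stable_density_def by (intro continuous_intros) auto
  have nonneg: "0 \<le> ?f s" for s
    using t by (simp add: stable_density_nonneg)
  have *: "einterval 0 \<infinity> = {0<..}"
    by (auto simp: einterval_def zero_ereal_def)
  note FTC = interval_integral_FTC_nonneg[of 0 \<infinity> H ?f 0 "exp (- (t * sqrt l))"]
  have A: "((H \<circ> real_of_ereal) \<longlongrightarrow> 0) (at_right 0)"
    using lim_0 by (simp add: zero_ereal_def ereal_tendsto_simps1)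
  have B: "((H \<circ> real_of_ereal) \<longlongrightarrow> exp (- (t * sqrt l))) (at_left \<infinity>)"
    using lim_top by (simp add: ereal_tendsto_simps1)
  have "set_integrable lborel {0<..} ?f" "(LBINT s:{0<..}. ?f s) = exp (- (t * sqrt l))"
    using FTC A B deriv cont nonneg
    by (simp_all add: * interval_lebesgue_integral_def zero_ereal_def)
  then have "(\<integral>\<^sup>+s. ennreal (indicator {0<..} s *\<^sub>R ?f s) \<partial>lborel) = ennreal (exp (- (t * sqrt l)))"
    unfolding set_integrable_def set_lebesgue_integral_def
    using nonneg by (subst nn_integral_eq_integral) auto
  also have "(\<integral>\<^sup>+s. ennreal (indicator {0<..} s *\<^sub>R ?f s) \<partial>lborel) =
      (\<integral>\<^sup>+s. ennreal (exp (- (l * s))) \<partial>stable_half t)"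
    using t by (subst nn_integral_stable_half)
      (auto intro!: nn_integral_cong simp: indicator_def ennreal_mult'' stable_density_nonneg)
  finally show ?thesis .
qed

text \<open>The case l = 0, which is the total mass, follows by monotone convergence along rates
  decreasing to l.\<close>

lemma laplace_stable_half:
  assumes t: "0 < t" and l: "0 \<le> l"
  shows "(\<integral>\<^sup>+s. ennreal (exp (- (l * s))) \<partial>stable_half t) = ennreal (exp (- (t * sqrt l)))"
proof -
  define k where "k n = l + inverse (real (Suc n))" for n
  have k: "0 < k n" for n
    using l by (simp add: k_def add_nonneg_pos)
  have "(\<lambda>n. k n) \<longlonglongrightarrow> l + 0"
    unfolding k_def by (intro tendsto_intros LIMSEQ_inverse_real_of_nat)
  then have k_lim: "k \<longlonglongrightarrow> l" by simp
  have k_mono: "k n \<le> k m" if "m \<le> n" for m n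
    using that by (simp add: k_def le_imp_inverse_le)
  \<comment> \<open>\<open>max 0 s\<close> makes the sequence increasing at every real s; on the
    positive half-line, which carries the measure, it equals s.\<close>
  have "(\<lambda>n. \<integral>\<^sup>+s. ennreal (exp (- (k n * max 0 s))) \<partial>stable_half t) \<longlonglongrightarrow>
      (\<integral>\<^sup>+s. ennreal (exp (- (l * max 0 s))) \<partial>stable_half t)"
  proof (rule nn_integral_LIMSEQ)
    show "(\<lambda>n. ennreal (exp (- (k n * max 0 s)))) \<longlonglongrightarrow> ennreal (exp (- (l * max 0 s)))" for s
      by (intro tendsto_intros k_lim tendsto_ennrealI)
    show "incseq (\<lambda>n s. ennreal (exp (- (k n * max 0 s))))"
      by (auto intro!: incseq_SucI le_funI ennreal_leI mult_right_mono k_mono)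
  qed (auto intro!: borel_measurable_stable_half)
  also have "(\<integral>\<^sup>+s. ennreal (exp (- (l * max 0 s))) \<partial>stable_half t) = (\<integral>\<^sup>+s. ennreal (exp (- (l * s))) \<partial>stable_half t)"
    by (intro nn_integral_cong) (simp add: max_def)
  also have "(\<lambda>n. \<integral>\<^sup>+s. ennreal (exp (- (k n * max 0 s))) \<partial>stable_half t) =
      (\<lambda>n. \<integral>\<^sup>+s. ennreal (exp (- (k n * s))) \<partial>stable_half t)"
    by (intro ext nn_integral_cong) (simp add: max_def)
  also have "\<dots> = (\<lambda>n. ennreal (exp (- (t * sqrt (k n)))))"
    using laplace_stable_half_pos[OF t k] by simp
  finally have "(\<lambda>n. ennreal (exp (- (t * sqrt (k n))))) \<longlonglongrightarrow>
      (\<integral>\<^sup>+s. ennreal (exp (- (l * s))) \<partial>stable_half t)" .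
  moreover have "(\<lambda>n. ennreal (exp (- (t * sqrt (k n))))) \<longlonglongrightarrow> ennreal (exp (- (t * sqrt l)))"
    by (intro tendsto_intros k_lim tendsto_ennrealI)
  ultimately show ?thesis
    by (rule LIMSEQ_unique)
qed

lemma prob_space_stable_half: "0 < t \<Longrightarrow> prob_space (stable_half t)"
  using laplace_stable_half[of t 0] by (intro prob_spaceI) simp

lemma stable_half_eqI:
  assumes "sets N = sets time_space" "finite_measure N" "0 < t"
    and "\<And>l. 0 \<le> l \<Longrightarrow> (\<integral>\<^sup>+s. ennreal (exp (- (l * s))) \<partial>N) = ennreal (exp (- (t * sqrt l)))"
  shows "N = stable_half t"
  by (rule laplace_transform_unique[where S="{0<..}"])
     (use assms prob_space_stable_half[OF \<open>0 < t\<close>] laplace_stable_half[OF \<open>0 < t\<close>]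
       in \<open>auto simp: prob_space_def\<close>)

text \<open>Brownian scaling, read off from sqrt(l t^2) = t sqrt l. It moves the dependence on t
  from the measure into the integrand, so that t can tend to 0 under one fixed probability
  measure.\<close>

lemma stable_half_scale:
  assumes t: "0 < t"
  shows "distr (stable_half 1) time_space (\<lambda>s. t\<^sup>2 * s) = stable_half t"
proof (rule stable_half_eqI)
  let ?D = "distr (stable_half 1) time_space (\<lambda>s. t\<^sup>2 * s)"
  interpret prob_space "stable_half 1" by (rule prob_space_stable_half) simp
  have [measurable]: "(\<lambda>s. t\<^sup>2 * s) \<in> stable_half 1 \<rightarrow>\<^sub>M time_space"
    using t by (intro measurable_restrict_space2 borel_measurable_stable_half) auto
  show "finite_measure ?D"
    by (rule finite_measure_distr) measurable
  fix l :: real assume l: "0 \<le> l"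
  have "(\<integral>\<^sup>+s. ennreal (exp (- (l * s))) \<partial>?D)
      = (\<integral>\<^sup>+s. ennreal (exp (- ((l * t\<^sup>2) * s))) \<partial>stable_half 1)"
    by (subst nn_integral_distr) (auto intro!: measurable_restrict_space1 simp: mult_ac)
  also have "\<dots> = ennreal (exp (- (t * sqrt l)))"
    using l t by (subst laplace_stable_half) (auto simp: real_sqrt_mult mult_ac)
  finally show "(\<integral>\<^sup>+s. ennreal (exp (- (l * s))) \<partial>?D)
      = ennreal (exp (- (t * sqrt l)))" .
qed (use t in auto)

text \<open>Independent random times add because exp(-t sqrt l) is multiplicative in t; this becomes
  the composition law of the Poisson semigroup.\<close>

lemma stable_half_convolution:
  assumes t: "0 < t" and u: "0 < u"
  shows "distr (stable_half t \<Otimes>\<^sub>M stable_half u) time_space (\<lambda>(a, b). a + b) = stable_half (t + u)"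
proof (rule stable_half_eqI)
  let ?D = "distr (stable_half t \<Otimes>\<^sub>M stable_half u) time_space (\<lambda>(a, b). a + b)"
  interpret T: prob_space "stable_half t" by (rule prob_space_stable_half) fact
  interpret U: prob_space "stable_half u" by (rule prob_space_stable_half) fact
  interpret pair_prob_space "stable_half t" "stable_half u" ..
  have [measurable]: "(\<lambda>s. s) \<in> stable_half v \<rightarrow>\<^sub>M borel" for v
    by (intro borel_measurable_stable_half) simp
  have add [measurable]: "(\<lambda>(a, b). a + b) \<in> stable_half t \<Otimes>\<^sub>M stable_half u \<rightarrow>\<^sub>M time_space"
    by (intro measurable_restrict_space2) (auto simp: space_pair_measure add_pos_pos)
  show "finite_measure ?D"
    by (rule P.finite_measure_distr) measurable
  fix l :: real assume l: "0 \<le> l"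
  have "(\<integral>\<^sup>+s. ennreal (exp (- (l * s))) \<partial>?D)
      = (\<integral>\<^sup>+p. ennreal (exp (- (l * fst p))) * ennreal (exp (- (l * snd p))) \<partial>(stable_half t \<Otimes>\<^sub>M stable_half u))"
    by (subst nn_integral_distr)
       (auto intro!: measurable_restrict_space1 simp: exp_add[symmetric] ennreal_mult''[symmetric] algebra_simps split_beta')
  also have "\<dots> = (\<integral>\<^sup>+a. \<integral>\<^sup>+b. ennreal (exp (- (l * a))) * ennreal (exp (- (l * b))) \<partial>stable_half u \<partial>stable_half t)"
    by (subst U.nn_integral_fst[symmetric]) auto
  also have "\<dots> = ennreal (exp (- (t * sqrt l))) * ennreal (exp (- (u * sqrt l)))"
    using l t u by (simp add: nn_integral_cmult nn_integral_multc laplace_stable_half)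
  also have "\<dots> = ennreal (exp (- ((t + u) * sqrt l)))"
    by (simp add: ennreal_mult''[symmetric] exp_add[symmetric] algebra_simps)
  finally show "(\<integral>\<^sup>+s. ennreal (exp (- (l * s))) \<partial>?D)
      = ennreal (exp (- ((t + u) * sqrt l)))" .
qed (use t u in auto)

section \<open>Time regularity of integrals against the Levy distribution\<close>

definition stable_density_deriv :: "real \<Rightarrow> real \<Rightarrow> real" where
  "stable_density_deriv t s =
     (1 - t\<^sup>2 / (2 * s)) / (2 * sqrt pi) * (exp (- t\<^sup>2 / (4 * s)) / s powr (3 / 2))"

lemma has_real_derivative_stable_density:
  "((\<lambda>t. stable_density t s) has_real_derivative stable_density_deriv t s) (at t)"
proof (cases "s = 0")
  case False
  have "((\<lambda>t. exp (- t\<^sup>2 / (4 * s))) has_real_derivative exp (- t\<^sup>2 / (4 * s)) * (- (2 * t) / (4 * s))) (at t)"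
    using False by (auto intro!: derivative_eq_intros)
  note D = DERIV_mult[OF DERIV_cdivide[OF DERIV_ident] DERIV_cdivide[OF this]]
  have "1 / (2 * p) * (e / w) + e * (- (2 * t) / (4 * s)) / w * (t / (2 * p))
      = (1 - t\<^sup>2 / (2 * s)) / (2 * p) * (e / w)" for e w p :: real
    using False by (cases "w = 0"; cases "p = 0") (simp_all add: field_simps power2_eq_square)
  from DERIV_cong[OF D this] show ?thesis
    unfolding stable_density_def stable_density_deriv_def .
qed (simp add: stable_density_def stable_density_deriv_def)

text \<open>In y = t^2 / (4 s) the derivative carries |1 - 2 y| exp(-y). The polynomial is absorbed
  by giving up three quarters of the exponent, and the remaining exp(-y / 4) is at most the
  exponential in the density at a, since t >= 2 a. The factor 1 / a compensates the a in front of
  that density.\<close>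

lemma stable_density_deriv_bound:
  assumes a: "0 < a" "2 * a \<le> t" and s: "0 < s"
  shows "\<bar>stable_density_deriv t s\<bar> \<le> 4 / a * stable_density a s"
proof -
  define y where "y = t\<^sup>2 / (4 * s)"
  have y: "0 \<le> y" using s by (simp add: y_def)
  have ay: "a\<^sup>2 / (4 * s) \<le> y / 4"
    using power_mono[OF a(2), of 2] a s by (simp add: y_def field_simps power_mult_distrib)
  have "\<bar>1 - 2 * y\<bar> \<le> 4 * (1 + 3 * y / 4)"
    unfolding abs_if using y by auto
  also have "\<dots> \<le> 4 * exp (3 * y / 4)"
    using exp_ge_add_one_self[of "3 * y / 4"] by (intro mult_left_mono) simp_all
  finally have "\<bar>1 - 2 * y\<bar> * exp (- y) \<le> 4 * exp (3 * y / 4) * exp (- y)"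
    by (intro mult_right_mono) auto
  also have "\<dots> = 4 * exp (- (y / 4))"
    by (simp add: exp_add[symmetric])
  also have "\<dots> \<le> 4 * exp (- (a\<^sup>2 / (4 * s)))"
    using ay by simp
  finally have *: "\<bar>1 - 2 * y\<bar> * exp (- y) \<le> 4 * exp (- (a\<^sup>2 / (4 * s)))" .
  have "\<bar>stable_density_deriv t s\<bar> = \<bar>1 - 2 * y\<bar> * exp (- y) / (2 * sqrt pi * s powr (3 / 2))"
    using s by (simp add: stable_density_deriv_def y_def abs_mult)
  also have "\<dots> \<le> 4 * exp (- (a\<^sup>2 / (4 * s))) / (2 * sqrt pi * s powr (3 / 2))"
    using * s by (intro divide_right_mono) auto
  also have "\<dots> = 4 / a * stable_density a s"
    using a by (simp add: stable_density_def)
  finally show ?thesis .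
qed

lemma integral_stable_half:
  assumes [measurable]: "h \<in> borel_measurable time_space" and t: "0 \<le> t"
  shows "(\<integral>s. h s \<partial>stable_half t) = (\<integral>s. stable_density t s * h s \<partial>restrict_space lborel {0<..})"
    and "integrable (stable_half t) h \<longleftrightarrow> integrable (restrict_space lborel {0<..}) (\<lambda>s. stable_density t s * h s)"
proof -
  have [measurable]: "stable_density t \<in> borel_measurable (restrict_space lborel {0<..})"
    "h \<in> borel_measurable (restrict_space lborel {0<..})"
    using assms(1) by (auto intro!: measurable_restrict_space1 cong: measurable_cong_sets sets_restrict_space_cong)
  show "(\<integral>s. h s \<partial>stable_half t) = (\<integral>s. stable_density t s * h s \<partial>restrict_space lborel {0<..})"
    unfolding stable_half_def using t
    by (subst integral_density) (auto simp: stable_density_nonneg)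
  show "integrable (stable_half t) h \<longleftrightarrow> integrable (restrict_space lborel {0<..}) (\<lambda>s. stable_density t s * h s)"
    unfolding stable_half_def using t
    by (subst integrable_density) (auto simp: stable_density_nonneg)
qed

lemma integral_stable_half_differentiable:
  assumes h: "h \<in> borel_measurable time_space" and B: "\<And>s. 0 < s \<Longrightarrow> \<bar>h s\<bar> \<le> B"
    and t: "0 < t"
  shows "\<exists>D. ((\<lambda>t. \<integral>s. h s \<partial>stable_half t) has_real_derivative D) (at t) \<and> \<bar>D\<bar> \<le> 8 * B / t"
proof -
  let ?R = "restrict_space lborel {0<..} :: real measure"
  have int: "integrable (stable_half u) h" if "0 < u" for u
  proof -
    interpret prob_space "stable_half u" by (rule prob_space_stable_half) fact
    show ?thesis
      using h B by (intro integrable_const_bound[of _ B] AE_I2) (auto cong: measurable_cong_sets)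
  qed
  have int_dens: "integrable ?R (\<lambda>s. stable_density u s)" "(\<integral>s. stable_density u s \<partial>?R) = 1" if "0 < u" for u
  proof -
    interpret prob_space "stable_half u" by (rule prob_space_stable_half) fact
    show "integrable ?R (\<lambda>s. stable_density u s)" "(\<integral>s. stable_density u s \<partial>?R) = 1"
      using integral_stable_half[of "\<lambda>_. 1" u] that prob_space by simp_all
  qed
  have dom: "\<bar>stable_density_deriv u s * h s\<bar> \<le> 4 / a * stable_density a s * B"
    if "0 < a" "2 * a \<le> u" "0 < s" for a u s
    unfolding abs_mult using that B stable_density_deriv_bound[OF that]
    by (intro mult_mono) (auto simp: stable_density_nonneg)
  \<comment> \<open>The time a = t / 4 satisfies 2 a <= u for all u in (t / 2, 2 t), so one multiple
    of a density dominates on the whole interval.\<close>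
  note D = has_real_derivative_integral[of "t/2" t "2*t" ?R "\<lambda>u s. stable_density u s * h s"
    "\<lambda>u s. stable_density_deriv u s * h s" "\<lambda>s. 4 / (t / 4) * stable_density (t/4) s * B"]
  have D: "integrable ?R (\<lambda>s. stable_density_deriv t s * h s)"
    "((\<lambda>u. \<integral>s. stable_density u s * h s \<partial>?R) has_real_derivative (\<integral>s. stable_density_deriv t s * h s \<partial>?R)) (at t)"
    using t int int_dens(1)[of "t/4"] dom[of "t/4"]
    by (intro D; force simp: integral_stable_half(2)[OF h, symmetric] space_restrict_space
        intro!: derivative_eq_intros has_real_derivative_stable_density)+
  have "((\<lambda>t. \<integral>s. h s \<partial>stable_half t) has_real_derivative (\<integral>s. stable_density_deriv t s * h s \<partial>?R)) (at t)"
    using t by (intro has_field_derivative_transform_within_open[OF D(2), of "{0<..}"])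
      (auto simp: integral_stable_half(1)[OF h])
  moreover have "\<bar>\<integral>s. stable_density_deriv t s * h s \<partial>?R\<bar> \<le> 8 * B / t"
  proof -
    have "\<bar>\<integral>s. stable_density_deriv t s * h s \<partial>?R\<bar> \<le> (\<integral>s. \<bar>stable_density_deriv t s * h s\<bar> \<partial>?R)"
      by (rule integral_abs_bound)
    \<comment> \<open>At the single time t the larger choice a = t / 2 is admissible; the density
      has mass 1, and 4 / a is 8 / t.\<close>
    also have "\<dots> \<le> (\<integral>s. 4 / (t / 2) * stable_density (t/2) s * B \<partial>?R)"
      using t dom[of "t/2" t] int_dens(1)[of "t/2"] D(1)
      by (intro integral_mono integrable_abs) (auto simp: space_restrict_space)
    also have "\<dots> = 8 * B / t"
      using t int_dens(2)[of "t/2"] by simp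
    finally show ?thesis .
  qed
  ultimately show ?thesis by blast
qed

section \<open>Fractional powers of subordinated Markov semigroups\<close>

abbreviation lborel_pos :: "real measure" where
  "lborel_pos \<equiv> restrict_space lborel {0<..}"

lemma sets_lborel_pos: "sets lborel_pos = sets time_space"
  by (simp add: sets_restrict_space)

lemma sigma_finite_lborel_pos: "sigma_finite_measure lborel_pos"
  by (rule sigma_finite_measure_restrict_space) (simp_all add: lborel.sigma_finite_measure_axioms)

lemma borel_measurable_lborel_pos: "f \<in> borel_measurable borel \<Longrightarrow> f \<in> borel_measurable lborel_pos"
  by (rule measurable_restrict_space1) simp

text \<open>Cutting at s = t and keeping one term of the minimum on each side leaves s^(\<gamma> -
  \<kappa> - 1) near 0 and s^(-\<kappa> - 1) near infinity, both integrable as 0 < \<kappa> <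
  \<gamma>. The exponent \<gamma> = \<beta> serves the sup norm, \<gamma> = 1 the time
  derivative.\<close>

lemma integral_powr_min_bound:
  fixes p q t \<kappa> \<gamma> :: real
  assumes "0 \<le> p" "0 \<le> q" "0 < \<kappa>" "\<kappa> < \<gamma>" "0 < t"
  shows "integrable lborel_pos (\<lambda>s. s powr (- \<kappa> - 1) * min q (p * s powr \<gamma>))"
    and "(\<integral>s. s powr (- \<kappa> - 1) * min q (p * s powr \<gamma>) \<partial>lborel_pos)
      \<le> p * t powr (\<gamma> - \<kappa>) / (\<gamma> - \<kappa>) + q * t powr (- \<kappa>) / \<kappa>"
proof -
  let ?f = "\<lambda>s. s powr (- \<kappa> - 1) * min q (p * s powr \<gamma>)"
  let ?I = "p * (t powr (\<gamma> - \<kappa>) / (\<gamma> - \<kappa>)) + q * (t powr (- \<kappa>) / \<kappa>)"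
  have 1: "(\<integral>\<^sup>+s. ennreal (indicator {0..t} s * s powr (\<gamma> - \<kappa> - 1)) \<partial>lborel) = ennreal (t powr (\<gamma> - \<kappa>) / (\<gamma> - \<kappa>))"
    using assms has_integral_powr_from_0[of "\<gamma> - \<kappa> - 1" t]
    by (intro nn_integral_has_integral_lebesgue) auto
  have 2: "(\<integral>\<^sup>+s. ennreal (indicator {t..} s * s powr (- \<kappa> - 1)) \<partial>lborel) = ennreal (t powr (- \<kappa>) / \<kappa>)"
    using assms has_integral_powr_to_inf[of "- \<kappa> - 1" t]
    by (intro nn_integral_has_integral_lebesgue) auto
  have meas: "?f \<in> borel_measurable lborel_pos"
    by (intro borel_measurable_lborel_pos) measurable
  have nonneg: "0 \<le> ?f s" for s
    using assms by simp
  have le: "ennreal (?f s) * indicator {0<..} s \<le>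
      ennreal p * ennreal (indicator {0..t} s * s powr (\<gamma> - \<kappa> - 1)) +
      ennreal q * ennreal (indicator {t..} s * s powr (- \<kappa> - 1))" for s
  proof (cases "0 < s")
    case s: True
    show ?thesis
    proof (cases "s \<le> t")
      case True
      have "?f s \<le> s powr (- \<kappa> - 1) * (p * s powr \<gamma>)"
        by (intro mult_left_mono) auto
      also have "\<dots> = p * s powr (\<gamma> - \<kappa> - 1)"
        by (simp add: powr_add[symmetric] algebra_simps)
      finally have "ennreal (?f s) \<le> ennreal p * ennreal (s powr (\<gamma> - \<kappa> - 1))"
        using assms by (simp add: ennreal_mult''[symmetric] ennreal_leI)
      then show ?thesis
        using s True by (simp add: add_increasing2)
    next
      case False
      have "?f s \<le> q * s powr (- \<kappa> - 1)"
        by (subst mult.commute, intro mult_right_mono) auto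
      then have "ennreal (?f s) \<le> ennreal q * ennreal (s powr (- \<kappa> - 1))"
        using assms by (simp add: ennreal_mult''[symmetric] ennreal_leI)
      then show ?thesis
        using s False by simp
    qed
  qed simp
  have "(\<integral>\<^sup>+s. ennreal (?f s) \<partial>lborel_pos) = (\<integral>\<^sup>+s. ennreal (?f s) * indicator {0<..} s \<partial>lborel)"
    by (subst nn_integral_restrict_space) auto
  also have "\<dots> \<le> (\<integral>\<^sup>+s. ennreal p * ennreal (indicator {0..t} s * s powr (\<gamma> - \<kappa> - 1)) +
      ennreal q * ennreal (indicator {t..} s * s powr (- \<kappa> - 1)) \<partial>lborel)"
    by (intro nn_integral_mono le)
  also have "\<dots> = ennreal p * ennreal (t powr (\<gamma> - \<kappa>) / (\<gamma> - \<kappa>)) + ennreal q * ennreal (t powr (- \<kappa>) / \<kappa>)"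
    by (subst nn_integral_add) (simp_all add: nn_integral_cmult 1 2)
  also have "\<dots> = ennreal ?I"
    using assms by (simp add: ennreal_mult''[symmetric] ennreal_plus[symmetric] del: ennreal_plus)
  finally have nn: "(\<integral>\<^sup>+s. ennreal (?f s) \<partial>lborel_pos) \<le> ennreal ?I" .
  show int: "integrable lborel_pos ?f"
    using nn nonneg by (intro integrableI_nonneg meas AE_I2) (auto intro: le_less_trans simp del: ennreal_plus)
  have "ennreal (\<integral>s. ?f s \<partial>lborel_pos) \<le> ennreal ?I"
    using nn nonneg int by (subst nn_integral_eq_integral[symmetric]) auto
  then show "(\<integral>s. ?f s \<partial>lborel_pos) \<le> p * t powr (\<gamma> - \<kappa>) / (\<gamma> - \<kappa>) + q * t powr (- \<kappa>) / \<kappa>"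
    using assms by (subst (asm) ennreal_le_iff) auto
qed

text \<open>The bound of \<open>integral_powr_min_bound\<close> for min(2 B, (2 A / \<beta>)
  s^\<beta>), cut at s = 1.\<close>

definition frac_bound :: "real \<Rightarrow> real \<Rightarrow> real \<Rightarrow> real \<Rightarrow> real" where
  "frac_bound A B \<beta> \<kappa> = 2 * A / \<beta> / (\<beta> - \<kappa>) + 2 * B / \<kappa>"

text \<open>The same bound for increments of the time derivative, with slope 8 A (t / 2)^(\<beta> -
  2) and height 2 A (t / 2)^(\<beta> - 1), cut at s = t, after A and the power of t have been taken
  out.\<close>

definition frac_lip_factor :: "real \<Rightarrow> real \<Rightarrow> real" where
  "frac_lip_factor \<beta> \<kappa> = 8 * (1 / 2) powr (\<beta> - 2) / (1 - \<kappa>) + 2 * (1 / 2) powr (\<beta> - 1) / \<kappa>"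

text \<open>What the estimates use, on a general state space. \<open>abs_cont\<close> carries almost
  everywhere bounds over to each transition measure, \<open>time_differentiable\<close> is the
  smoothing rate, and \<open>initial_value_unique\<close> stands in for strong continuity at 0: it
  only identifies a limit already known to exist.\<close>

locale markov_operator_semigroup =
  fixes M :: "'a measure" and P :: "real \<Rightarrow> 'a \<Rightarrow> 'a measure"
  assumes prob: "\<And>t x. 0 < t \<Longrightarrow> x \<in> space M \<Longrightarrow> prob_space (P t x)"
    and sets_P: "\<And>t x. 0 < t \<Longrightarrow> x \<in> space M \<Longrightarrow> sets (P t x) = sets M"
    and abs_cont: "\<And>t x. 0 < t \<Longrightarrow> x \<in> space M \<Longrightarrow> absolutely_continuous M (P t x)"
    and joint_measurable: "\<And>f :: 'a \<Rightarrow> real. f \<in> borel_measurable M \<Longrightarrow>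
      (\<lambda>(t, x). \<integral>y. f y \<partial>P t x) \<in> borel_measurable (time_space \<Otimes>\<^sub>M M)"
    and semigroup: "\<And>(f :: 'a \<Rightarrow> real) B s t x. f \<in> borel_measurable M \<Longrightarrow> AE y in M. \<bar>f y\<bar> \<le> B \<Longrightarrow>
      0 < s \<Longrightarrow> 0 < t \<Longrightarrow> x \<in> space M \<Longrightarrow> (\<integral>y. (\<integral>z. f z \<partial>P s y) \<partial>P t x) = (\<integral>z. f z \<partial>P (s + t) x)"
    and time_differentiable: "\<And>(f :: 'a \<Rightarrow> real) B t x. f \<in> borel_measurable M \<Longrightarrow> AE y in M. \<bar>f y\<bar> \<le> B \<Longrightarrow>
      0 < t \<Longrightarrow> x \<in> space M \<Longrightarrow>
      \<exists>D. ((\<lambda>t. \<integral>y. f y \<partial>P t x) has_real_derivative D) (at t) \<and> \<bar>D\<bar> \<le> 8 * B / t"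
    and initial_value_unique: "\<And>(f :: 'a \<Rightarrow> real) g B. f \<in> borel_measurable M \<Longrightarrow> g \<in> borel_measurable M \<Longrightarrow>
      AE x in M. \<bar>f x\<bar> \<le> B \<Longrightarrow> AE x in M. \<bar>g x\<bar> \<le> B \<Longrightarrow>
      AE x in M. ((\<lambda>t. \<integral>y. f y \<partial>P t x) \<longlongrightarrow> g x) (at_right 0) \<Longrightarrow> AE x in M. f x = g x"
begin

definition Q :: "real \<Rightarrow> ('a \<Rightarrow> real) \<Rightarrow> 'a \<Rightarrow> real" where
  "Q t f x = (\<integral>y. f y \<partial>P t x)"

definition V :: "real \<Rightarrow> ('a \<Rightarrow> real) \<Rightarrow> 'a \<Rightarrow> real" where
  "V t f x = deriv (\<lambda>t. Q t f x) t"

lemma AE_P: "0 < t \<Longrightarrow> x \<in> space M \<Longrightarrow> AE y in M. R y \<Longrightarrow> AE y in P t x. R y"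
  by (rule absolutely_continuous_AE[OF sets_P abs_cont])

lemma space_P: "0 < t \<Longrightarrow> x \<in> space M \<Longrightarrow> space (P t x) = space M"
  by (rule sets_eq_imp_space_eq[OF sets_P])

lemma measurable_P: "f \<in> borel_measurable M \<Longrightarrow> 0 < t \<Longrightarrow> x \<in> space M \<Longrightarrow> f \<in> borel_measurable (P t x)"
  using measurable_cong_sets[OF sets_P refl] by blast

lemma integrable_P:
  fixes f :: "'a \<Rightarrow> real"
  assumes "f \<in> borel_measurable M" "AE y in M. \<bar>f y\<bar> \<le> B" "0 < t" "x \<in> space M"
  shows "integrable (P t x) f"
proof -
  interpret prob_space "P t x" using assms by (intro prob)
  show ?thesis
    using assms AE_P[OF assms(3,4,2)] by (intro integrable_const_bound[of _ B] measurable_P) auto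
qed

lemma Q_bound:
  assumes "f \<in> borel_measurable M" "AE y in M. \<bar>f y\<bar> \<le> B" "0 < t" "x \<in> space M"
  shows "\<bar>Q t f x\<bar> \<le> B"
proof -
  interpret prob_space "P t x" using assms by (intro prob)
  have "\<bar>Q t f x\<bar> \<le> (\<integral>y. \<bar>f y\<bar> \<partial>P t x)"
    unfolding Q_def by (rule integral_abs_bound)
  also have "\<dots> \<le> (\<integral>y. B \<partial>P t x)"
    using AE_P[OF assms(3,4,2)] integrable_P[OF assms]
    by (intro integral_mono_AE integrable_abs) auto
  finally show ?thesis by (simp add: prob_space)
qed

lemma Q_measurable [measurable (raw)]:
  assumes "f \<in> borel_measurable M" "0 < t"
  shows "Q t f \<in> borel_measurable M"
proof -
  have "(\<lambda>x. case (t, x) of (t, x) \<Rightarrow> \<integral>y. f y \<partial>P t x) \<in> borel_measurable M"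
    by (rule measurable_compose[OF measurable_Pair1' joint_measurable[OF assms(1)]])
       (use assms in \<open>simp add: space_restrict_space\<close>)
  then show ?thesis by (simp add: Q_def[abs_def])
qed

lemma V_DERIV:
  assumes "f \<in> borel_measurable M" "AE y in M. \<bar>f y\<bar> \<le> B" "0 < t" "x \<in> space M"
  shows "((\<lambda>t. Q t f x) has_real_derivative V t f x) (at t)" "\<bar>V t f x\<bar> \<le> 8 * B / t"
proof -
  obtain D where D: "((\<lambda>t. Q t f x) has_real_derivative D) (at t)" "\<bar>D\<bar> \<le> 8 * B / t"
    using time_differentiable[OF assms] unfolding Q_def by blast
  then have "V t f x = D" unfolding V_def by (intro DERIV_imp_deriv)
  with D show "((\<lambda>t. Q t f x) has_real_derivative V t f x) (at t)" "\<bar>V t f x\<bar> \<le> 8 * B / t"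
    by auto
qed

text \<open>A limit of difference quotients in t along the times t + 1 / (n + 1).\<close>

lemma V_measurable:
  assumes "f \<in> borel_measurable M" "AE y in M. \<bar>f y\<bar> \<le> B" "0 < t"
  shows "V t f \<in> borel_measurable M"
proof (rule borel_measurable_LIMSEQ_real)
  let ?h = "\<lambda>n. inverse (real (Suc n))"
  show "(\<lambda>n. (Q (t + ?h n) f x - Q t f x) / ?h n) \<longlonglongrightarrow> V t f x" if "x \<in> space M" for x
  proof -
    have "((\<lambda>h. (Q (t + h) f x - Q t f x) / h) \<longlongrightarrow> V t f x) (at 0)"
      using V_DERIV(1)[OF assms that] by (simp add: DERIV_def)
    then show ?thesis
      using LIMSEQ_inverse_real_of_nat unfolding tendsto_at_iff_sequentially comp_def
      by (elim allE impE) auto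
  qed
  show "(\<lambda>x. (Q (t + ?h n) f x - Q t f x) / ?h n) \<in> borel_measurable M" for n
  proof -
    have "Q (t + ?h n) f \<in> borel_measurable M" "Q t f \<in> borel_measurable M"
      using assms by (auto intro!: Q_measurable add_pos_pos)
    then show ?thesis by measurable
  qed
qed

text \<open>The smoothing rate 8 B / u only improves with u, so its value at the left end serves as
  Lipschitz constant on the half-line from a on.\<close>

lemma Q_lipschitz:
  assumes "f \<in> borel_measurable M" "AE y in M. \<bar>f y\<bar> \<le> B" "0 < a" "0 \<le> s" "x \<in> space M"
  shows "\<bar>Q (a + s) f x - Q a f x\<bar> \<le> 8 * B / a * s"
proof -
  have B: "0 \<le> B" using Q_bound[OF assms(1,2,3,5)] by linarith
  have "norm (Q (a + s) f x - Q a f x) \<le> 8 * B / a * norm ((a + s) - a)"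
  proof (rule field_differentiable_bound[where S="{a..}" and f'="\<lambda>t. V t f x"])
    fix z assume "z \<in> {a..}"
    then have z: "0 < z" "a \<le> z" using assms by auto
    show "((\<lambda>t. Q t f x) has_real_derivative V z f x) (at z within {a..})"
      using V_DERIV(1)[OF assms(1,2) z(1) assms(5)] by (rule has_field_derivative_at_within)
    have "\<bar>V z f x\<bar> \<le> 8 * B / z" by (rule V_DERIV(2)[OF assms(1,2) z(1) assms(5)])
    also have "\<dots> \<le> 8 * B / a" using z B assms by (intro divide_left_mono) auto
    finally show "norm (V z f x) \<le> 8 * B / a" by simp
  qed (use assms in auto)
  then show ?thesis using assms by simp
qed

text \<open>Differentiate Q (u + s) f = Q s (Q u f) in u at t. On (t / 2, 2 t) the derivative is
  bounded by a constant, which is integrable against the probability measure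
  \<open>P s x\<close>.\<close>

lemma V_semigroup:
  assumes f: "f \<in> borel_measurable M" "AE y in M. \<bar>f y\<bar> \<le> B" and t: "0 < t" and s: "0 < s" and x: "x \<in> space M"
  shows "V (t + s) f x = Q s (V t f) x"
proof -
  interpret prob_space "P s x" using s x by (rule prob)
  have B: "0 \<le> B" using Q_bound[OF f t x] by linarith
  have bdd: "AE y in M. \<bar>Q u f y\<bar> \<le> B" if "0 < u" for u
    using Q_bound[OF f that] by (intro AE_I2)
  have "((\<lambda>u. \<integral>y. Q u f y \<partial>P s x) has_real_derivative (\<integral>y. V t f y \<partial>P s x)) (at t)"
  proof (rule has_real_derivative_integral(2)[where a="t/2" and b="2*t" and g="\<lambda>_. 8 * B / (t / 2)" and f="\<lambda>u y. Q u f y" and f'="\<lambda>u y. V u f y"])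
    fix u assume "t / 2 < u" "u < 2 * t"
    then have u: "0 < u" using t by simp
    show "integrable (P s x) (Q u f)"
      by (rule integrable_P[OF Q_measurable[OF f(1) u] bdd[OF u] s x])
    fix y assume "y \<in> space (P s x)"
    then have y: "y \<in> space M" using space_P[OF s x] by simp
    show "((\<lambda>u. Q u f y) has_real_derivative V u f y) (at u)"
      by (rule V_DERIV(1)[OF f u y])
    have "\<bar>V u f y\<bar> \<le> 8 * B / u" by (rule V_DERIV(2)[OF f u y])
    also have "\<dots> \<le> 8 * B / (t / 2)"
      using \<open>t / 2 < u\<close> t B by (intro divide_left_mono) auto
    finally show "\<bar>V u f y\<bar> \<le> 8 * B / (t / 2)" .
  qed (use t in auto)
  then have D: "((\<lambda>u. \<integral>y. Q u f y \<partial>P s x) has_real_derivative Q s (V t f) x) (at t)"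
    by (simp add: Q_def)
  have eq: "(\<integral>y. Q u f y \<partial>P s x) = Q (u + s) f x" if "u \<in> {0<..}" for u
    using semigroup[OF f _ s x, of u] that by (simp add: Q_def)
  have "((\<lambda>u. Q (u + s) f x) has_real_derivative Q s (V t f) x) (at t)"
    by (rule has_field_derivative_transform_within_open[where S="{0<..}", OF D _ _ eq]) (use t in auto)
  moreover have "((\<lambda>u. Q (u + s) f x) has_real_derivative V (t + s) f x) (at t)"
    using V_DERIV(1)[OF f _ x, of "t + s"] t s by (simp add: DERIV_shift)
  ultimately show ?thesis
    by (rule DERIV_unique[symmetric])
qed

text \<open>Half of the time is spent on smoothing: V (t + s) f is Q (t / 2 + s) applied to V (t /
  2) f, whose almost everywhere bound A (t / 2)^(\<beta> - 1) becomes a bound at each x under an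
  absolutely continuous transition measure. The second estimate is \<open>Q_lipschitz\<close> from
  time t / 2 on for the bounded function V (t / 2) f.\<close>

lemma time_derivative_bound:
  assumes f: "f \<in> borel_measurable M" "AE y in M. \<bar>f y\<bar> \<le> B"
    and lip: "\<And>t. 0 < t \<Longrightarrow> AE y in M. \<bar>V t f y\<bar> \<le> A * t powr (\<beta> - 1)"
    and t: "0 < t" and x: "x \<in> space M"
  shows "\<bar>V t f x\<bar> \<le> A * (t / 2) powr (\<beta> - 1)"
    and "0 \<le> s \<Longrightarrow> \<bar>V (t + s) f x - V t f x\<bar> \<le> 8 * A * (t / 2) powr (\<beta> - 2) * s"
proof -
  have h: "0 < t / 2" using t by simp
  note V = V_measurable[OF f h] lip[OF h]
  have eq: "V (t + s) f x = Q (t / 2 + s) (V (t / 2) f) x" if "0 \<le> s" for s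
    using V_semigroup[OF f h _ x, of "t / 2 + s"] h that by (simp add: add_pos_nonneg)
  show "\<bar>V t f x\<bar> \<le> A * (t / 2) powr (\<beta> - 1)"
    using Q_bound[OF V h x] eq[of 0] by simp
  show "\<bar>V (t + s) f x - V t f x\<bar> \<le> 8 * A * (t / 2) powr (\<beta> - 2) * s" if s: "0 \<le> s"
  proof -
    have "\<bar>V (t + s) f x - V t f x\<bar> \<le> 8 * (A * (t / 2) powr (\<beta> - 1)) / (t / 2) * s"
      using Q_lipschitz[OF V h s x] eq[OF s] eq[of 0] by simp
    also have "8 * (A * (t / 2) powr (\<beta> - 1)) / (t / 2) = 8 * A * ((t / 2) powr (\<beta> - 1) / (t / 2) powr 1)"
      using h by simp
    also have "(t / 2) powr (\<beta> - 1) / (t / 2) powr 1 = (t / 2) powr (\<beta> - 2)"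
      by (subst powr_diff[symmetric]) simp
    finally show ?thesis .
  qed
qed

text \<open>Since \<beta> > 0, the derivative bound is integrable at 0, so Q t f x converges at each
  x to some g x with rate t^\<beta>. Then \<open>initial_value_unique\<close> replaces g by f off
  one null set, the same for all t.\<close>

lemma approximation_rate:
  assumes f: "f \<in> borel_measurable M" "AE y in M. \<bar>f y\<bar> \<le> B"
    and lip: "\<And>t. 0 < t \<Longrightarrow> AE y in M. \<bar>V t f y\<bar> \<le> A * t powr (\<beta> - 1)"
    and A: "0 \<le> A" and \<beta>: "0 < \<beta>" "\<beta> < 1"
  shows "AE x in M. \<forall>t>0. \<bar>Q t f x - f x\<bar> \<le> 2 * A / \<beta> * t powr \<beta>"
proof -
  let ?K = "2 * A / \<beta>"
  have Vb: "\<bar>V t f x\<bar> \<le> 2 * A * t powr (\<beta> - 1)" if "0 < t" "x \<in> space M" for t x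
  proof -
    \<comment> \<open>From \<beta> > 0, the halved time costs at most a factor 2; this is the 2 in 2
      A / \<beta>.\<close>
    have "(1 / 2) powr (\<beta> - 1) \<le> (1 / 2) powr (- 1 :: real)"
      using \<beta> by (intro powr_mono') auto
    then have half: "(1 / 2) powr (\<beta> - 1) \<le> (2 :: real)"
      by (simp add: powr_minus)
    have "\<bar>V t f x\<bar> \<le> A * (t / 2) powr (\<beta> - 1)"
      by (rule time_derivative_bound(1)[OF f lip that])
    also have "(t / 2) powr (\<beta> - 1) = t powr (\<beta> - 1) * (1 / 2) powr (\<beta> - 1)"
      using that powr_mult[of t "1 / 2" "\<beta> - 1"] by simp
    also have "A * \<dots> \<le> A * (t powr (\<beta> - 1) * 2)"
      using A half by (intro mult_left_mono) auto
    finally show ?thesis by simp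
  qed
  have diff: "\<bar>Q t f x - Q u f x\<bar> \<le> ?K * (t powr \<beta> - u powr \<beta>)" if "0 < u" "u \<le> t" and x: "x \<in> space M" for t u x
  proof -
    have D: "((\<lambda>t. ?K * t powr \<beta>) has_real_derivative 2 * A * v powr (\<beta> - 1)) (at v)" if "0 < v" for v
      using that \<beta> by (auto intro!: derivative_eq_intros)
    \<comment> \<open>The derivative of K v^\<beta> is at least |V v f x|, so adding or subtracting
      Q leaves a nondecreasing function. The two monotonicities are the two-sided estimate, without
      integrating V.\<close>
    have "?K * u powr \<beta> - Q u f x \<le> ?K * t powr \<beta> - Q t f x"
    proof (rule DERIV_nonneg_imp_nondecreasing[OF \<open>u \<le> t\<close>])
      fix v assume "u \<le> v" "v \<le> t"
      then have v: "0 < v" using that by simp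
      show "\<exists>y. ((\<lambda>v. ?K * v powr \<beta> - Q v f x) has_real_derivative y) (at v) \<and> 0 \<le> y"
        using DERIV_diff[OF D[OF v] V_DERIV(1)[OF f v x]] Vb[OF v x] by (intro exI conjI) (assumption, linarith)
    qed
    moreover have "?K * u powr \<beta> + Q u f x \<le> ?K * t powr \<beta> + Q t f x"
    proof (rule DERIV_nonneg_imp_nondecreasing[OF \<open>u \<le> t\<close>])
      fix v assume "u \<le> v" "v \<le> t"
      then have v: "0 < v" using that by simp
      show "\<exists>y. ((\<lambda>v. ?K * v powr \<beta> + Q v f x) has_real_derivative y) (at v) \<and> 0 \<le> y"
        using DERIV_add[OF D[OF v] V_DERIV(1)[OF f v x]] Vb[OF v x] by (intro exI conjI) (assumption, linarith)
    qed
    ultimately show ?thesis unfolding right_diff_distrib by linarith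
  qed
  define a where "a n = inverse (real (Suc n))" for n
  have a: "0 < a n" "a \<longlonglongrightarrow> 0" for n
    unfolding a_def by (simp, rule LIMSEQ_inverse_real_of_nat)
  have a_dec: "a (Suc n) \<le> a n" for n
    by (simp add: a_def le_imp_inverse_le)
  have a_lim: "(\<lambda>n. ?K * a n powr \<beta>) \<longlonglongrightarrow> 0"
  proof -
    have "(\<lambda>n. a n powr \<beta>) \<longlonglongrightarrow> 0 powr \<beta>"
      using \<beta> a(1) by (intro tendsto_powr'[OF a(2) tendsto_const]) (auto simp: less_imp_le)
    then show ?thesis
      by (intro tendsto_mult_right_zero) simp
  qed
  define g where "g x = lim (\<lambda>n. Q (a n) f x)" for x
  have conv: "(\<lambda>n. Q (a n) f x) \<longlonglongrightarrow> g x" if x: "x \<in> space M" for x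
  proof -
    \<comment> \<open>The correction K (a n)^\<beta> decreases by at least as much as Q can grow
      from one term to the next. The sum is thus monotone, it is bounded below by -B, and the
      correction itself tends to 0.\<close>
    have dec: "decseq (\<lambda>n. ?K * a n powr \<beta> + Q (a n) f x)"
      using diff[OF a(1) a_dec x] by (intro decseq_SucI) (smt (verit) right_diff_distrib)
    have "- B \<le> ?K * a n powr \<beta> + Q (a n) f x" for n
      using Q_bound[OF f a(1) x, of n] A \<beta> by (smt (verit) divide_nonneg_pos mult_nonneg_nonneg powr_ge_zero)
    then obtain L where "(\<lambda>n. ?K * a n powr \<beta> + Q (a n) f x) \<longlonglongrightarrow> L"
      using decseq_convergent[OF dec] by blast
    from tendsto_diff[OF this a_lim] have "(\<lambda>n. Q (a n) f x) \<longlonglongrightarrow> L" by simp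
    then show ?thesis unfolding g_def by (simp add: limI)
  qed
  have rate: "\<bar>Q t f x - g x\<bar> \<le> ?K * t powr \<beta>" if t: "0 < t" and x: "x \<in> space M" for t x
  proof (rule LIMSEQ_le_const2)
    show "(\<lambda>n. \<bar>Q t f x - Q (a n) f x\<bar>) \<longlonglongrightarrow> \<bar>Q t f x - g x\<bar>"
      by (intro tendsto_intros conv x)
    have "eventually (\<lambda>n. a n < t) sequentially"
      using a(2) t by (rule order_tendstoD)
    then obtain N where N: "\<And>n. N \<le> n \<Longrightarrow> a n < t"
      by (auto simp: eventually_sequentially)
    have "\<bar>Q t f x - Q (a n) f x\<bar> \<le> ?K * t powr \<beta>" if "N \<le> n" for n
    proof -
      have "0 \<le> ?K * a n powr \<beta>" using A \<beta> by simp
      then show ?thesis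
        using diff[OF a(1)[of n] less_imp_le[OF N[OF that]] x] unfolding right_diff_distrib by linarith
    qed
    then show "\<exists>N. \<forall>n\<ge>N. \<bar>Q t f x - Q (a n) f x\<bar> \<le> ?K * t powr \<beta>" by blast
  qed
  have g_meas: "g \<in> borel_measurable M"
    by (rule borel_measurable_LIMSEQ_real[OF conv Q_measurable[OF f(1) a(1)]])
  have g_bound: "AE x in M. \<bar>g x\<bar> \<le> B"
  proof (rule AE_I2)
    fix x assume x: "x \<in> space M"
    show "\<bar>g x\<bar> \<le> B"
      by (rule LIMSEQ_le_const2[OF tendsto_rabs[OF conv[OF x]]]) (use Q_bound[OF f a(1) x] in auto)
  qed
  have "AE x in M. ((\<lambda>t. \<integral>y. f y \<partial>P t x) \<longlongrightarrow> g x) (at_right 0)"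
  proof (rule AE_I2)
    fix x assume x: "x \<in> space M"
    have "((\<lambda>t. ?K * t powr \<beta>) \<longlongrightarrow> ?K * 0) (at_right 0)"
      using \<beta> by (intro tendsto_intros) real_asymp
    then have "((\<lambda>t. ?K * t powr \<beta>) \<longlongrightarrow> 0) (at_right 0)"
      by simp
    then have "((\<lambda>t. Q t f x - g x) \<longlongrightarrow> 0) (at_right 0)"
      by (rule Lim_null_comparison[rotated])
         (use rate[OF _ x] in \<open>auto simp: eventually_at_right_field intro!: exI[of _ 1]\<close>)
    then show "((\<lambda>t. \<integral>y. f y \<partial>P t x) \<longlongrightarrow> g x) (at_right 0)"
      unfolding Q_def[symmetric] by (simp add: LIM_zero_iff)
  qed
  from initial_value_unique[OF f(1) g_meas f(2) g_bound this]
  show ?thesis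
    using AE_space by eventually_elim (use rate in auto)
qed

section \<open>The fractional operator of the abstract semigroup\<close>

lemma measurable_increment:
  assumes "f \<in> borel_measurable M"
  shows "(\<lambda>(x, s). s powr (- \<kappa> - 1) * (Q s f x - f x)) \<in> borel_measurable (M \<Otimes>\<^sub>M lborel_pos)"
proof -
  have "(\<lambda>(s, x). Q s f x) \<in> borel_measurable (lborel_pos \<Otimes>\<^sub>M M)"
    using joint_measurable[OF assms] unfolding Q_def
    by (subst measurable_cong_sets[OF sets_pair_measure_cong[OF sets_lborel_pos refl] refl])
  from measurable_compose[OF measurable_pair_swap' this]
  have [measurable]: "(\<lambda>p. Q (snd p) f (fst p)) \<in> borel_measurable (M \<Otimes>\<^sub>M lborel_pos)"
    by (simp add: split_beta')
  have [measurable]: "(\<lambda>s. s) \<in> borel_measurable lborel_pos"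
    by (rule borel_measurable_lborel_pos) simp
  note assms[measurable]
  show ?thesis unfolding split_beta' by measurable
qed

text \<open>From a positive time t on, increments are at most 2 B and at most 8 B s / t. The linear
  bound beats s^(-\<kappa> - 1) at 0 because \<kappa> < 1, so boundedness of f is enough.\<close>

lemma integrable_increment:
  assumes f: "f \<in> borel_measurable M" "AE y in M. \<bar>f y\<bar> \<le> B"
    and \<kappa>: "0 < \<kappa>" "\<kappa> < 1" and t: "0 < t" and x: "x \<in> space M"
  shows "integrable lborel_pos (\<lambda>s. s powr (- \<kappa> - 1) * (Q (t + s) f x - Q t f x))"
proof (rule Bochner_Integration.integrable_bound)
  have B: "0 \<le> B" using Q_bound[OF f t x] by linarith
  show "integrable lborel_pos (\<lambda>s. s powr (- \<kappa> - 1) * min (2 * B) (8 * B / t * s powr 1))"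
    using B t \<kappa> by (intro integral_powr_min_bound(1)[where t=1]) auto
  have "(\<lambda>s. case (s, x) of (s, x) \<Rightarrow> \<integral>y. f y \<partial>P s x) \<in> borel_measurable time_space"
    by (rule measurable_compose[OF measurable_Pair2' joint_measurable[OF f(1)]]) (use x in simp)
  then have *: "(\<lambda>s. Q s f x) \<in> borel_measurable time_space"
    by (simp add: Q_def)
  have "(\<lambda>s. t + s) \<in> lborel_pos \<rightarrow>\<^sub>M time_space"
    using t by (intro measurable_restrict_space2 borel_measurable_lborel_pos) (auto simp: space_restrict_space)
  from measurable_compose[OF this *]
  have [measurable]: "(\<lambda>s. Q (t + s) f x) \<in> borel_measurable lborel_pos" .
  have [measurable]: "(\<lambda>s. s) \<in> borel_measurable lborel_pos"
    by (rule borel_measurable_lborel_pos) simp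
  show "(\<lambda>s. s powr (- \<kappa> - 1) * (Q (t + s) f x - Q t f x)) \<in> borel_measurable lborel_pos"
    by measurable
  show "AE s in lborel_pos. norm (s powr (- \<kappa> - 1) * (Q (t + s) f x - Q t f x))
      \<le> norm (s powr (- \<kappa> - 1) * min (2 * B) (8 * B / t * s powr 1))"
  proof (rule AE_I2)
    fix s assume "s \<in> space lborel_pos"
    then have s: "0 < s" by (simp add: space_restrict_space)
    have "\<bar>Q (t + s) f x - Q t f x\<bar> \<le> min (2 * B) (8 * B / t * s powr 1)"
      using Q_lipschitz[OF f t less_imp_le[OF s] x] Q_bound[OF f t x] Q_bound[OF f add_pos_pos[OF t s] x] s
      by auto
    then show "norm (s powr (- \<kappa> - 1) * (Q (t + s) f x - Q t f x))
      \<le> norm (s powr (- \<kappa> - 1) * min (2 * B) (8 * B / t * s powr 1))"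
      using B t s by (simp add: abs_mult mult_left_mono)
  qed
qed

definition frac_op :: "('a \<Rightarrow> real) \<Rightarrow> real \<Rightarrow> real \<Rightarrow> 'a \<Rightarrow> real" where
  "frac_op f \<kappa> c x = c * (\<integral>s. s powr (- \<kappa> - 1) * (Q s f x - f x) \<partial>lborel_pos)"

context
  fixes f :: "'a \<Rightarrow> real" and A B \<beta> \<kappa> c :: real
  assumes f: "f \<in> borel_measurable M" "AE y in M. \<bar>f y\<bar> \<le> B"
    and lip: "\<forall>t>0. AE y in M. \<bar>V t f y\<bar> \<le> A * t powr (\<beta> - 1)"
    and A: "0 \<le> A" and B: "0 \<le> B" and \<kappa>: "0 < \<kappa>" "\<kappa> < \<beta>" and \<beta>: "\<beta> < 1"
begin

text \<open>The approximation rate with \<beta> > \<kappa> controls small s, the sup norm controls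
  large s. The absolute integral is bounded by one constant for almost all x, which is the form that
  Fubini asks for in \<open>Q_frac_op\<close>.\<close>

lemma frac_op_integrand_AE:
  "AE x in M. integrable lborel_pos (\<lambda>s. s powr (- \<kappa> - 1) * (Q s f x - f x)) \<and>
     (\<integral>s. \<bar>s powr (- \<kappa> - 1) * (Q s f x - f x)\<bar> \<partial>lborel_pos) \<le> frac_bound A B \<beta> \<kappa>"
proof -
  have \<beta>0: "0 < \<beta>" using \<kappa> by simp
  note m = integral_powr_min_bound[of "2 * A / \<beta>" "2 * B" \<kappa> \<beta> 1]
  have rate: "AE x in M. \<forall>t>0. \<bar>Q t f x - f x\<bar> \<le> 2 * A / \<beta> * t powr \<beta>"
    by (rule approximation_rate[OF f lip[rule_format] A \<beta>0 \<beta>])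
  show ?thesis
    using rate f(2) AE_space
  proof eventually_elim
    case (elim x)
    have x: "x \<in> space M" by fact
    have le: "\<bar>s powr (- \<kappa> - 1) * (Q s f x - f x)\<bar> \<le> s powr (- \<kappa> - 1) * min (2 * B) (2 * A / \<beta> * s powr \<beta>)"
      if "s \<in> space lborel_pos" for s
    proof -
      have s: "0 < s" using that by (simp add: space_restrict_space)
      have "\<bar>Q s f x - f x\<bar> \<le> min (2 * B) (2 * A / \<beta> * s powr \<beta>)"
        using elim Q_bound[OF f s x] s by auto
      then show ?thesis by (simp add: abs_mult mult_left_mono)
    qed
    have "(\<lambda>s. case (x, s) of (x, s) \<Rightarrow> s powr (- \<kappa> - 1) * (Q s f x - f x)) \<in> borel_measurable lborel_pos"
      by (rule measurable_compose[OF measurable_Pair1'[OF x] measurable_increment[OF f(1)]])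
    then have meas: "(\<lambda>s. s powr (- \<kappa> - 1) * (Q s f x - f x)) \<in> borel_measurable lborel_pos" by simp
    have int: "integrable lborel_pos (\<lambda>s. s powr (- \<kappa> - 1) * (Q s f x - f x))"
      using le by (intro Bochner_Integration.integrable_bound[OF m(1) meas] AE_I2)
        (use A B \<kappa> \<beta>0 in \<open>auto intro: order_trans[OF _ abs_ge_self]\<close>)
    moreover have "(\<integral>s. \<bar>s powr (- \<kappa> - 1) * (Q s f x - f x)\<bar> \<partial>lborel_pos)
        \<le> (\<integral>s. s powr (- \<kappa> - 1) * min (2 * B) (2 * A / \<beta> * s powr \<beta>) \<partial>lborel_pos)"
      using A B \<kappa> \<beta>0 by (intro integral_mono integrable_abs int m(1) le) auto
    moreover have "\<dots> \<le> frac_bound A B \<beta> \<kappa>"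
      using A B \<kappa> \<beta>0 m(2) by (simp add: frac_bound_def)
    ultimately show ?case by auto
  qed
qed

lemma frac_op_measurable: "frac_op f \<kappa> c \<in> borel_measurable M"
proof -
  interpret R: sigma_finite_measure lborel_pos by (rule sigma_finite_lborel_pos)
  have "(\<lambda>x. \<integral>s. s powr (- \<kappa> - 1) * (Q s f x - f x) \<partial>lborel_pos) \<in> borel_measurable M"
    by (rule R.borel_measurable_lebesgue_integral[OF measurable_increment[OF f(1)]])
  then show ?thesis unfolding frac_op_def[abs_def] by simp
qed

lemma frac_op_AE_bound: "AE x in M. \<bar>frac_op f \<kappa> c x\<bar> \<le> \<bar>c\<bar> * frac_bound A B \<beta> \<kappa>"
  using frac_op_integrand_AE
proof eventually_elim
  case (elim x)
  then show ?case
    using order_trans[OF integral_abs_bound[of lborel_pos "\<lambda>s. s powr (- \<kappa> - 1) * (Q s f x - f x)"]]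
    by (simp add: frac_op_def abs_mult mult_left_mono)
qed

text \<open>Fubini for \<open>P t x\<close> and ds: the absolute inner integral is at most a
  constant almost everywhere, hence almost surely under \<open>P t x\<close>. Inside, the semigroup
  law turns Q s f - f into an increment that starts at time t.\<close>

lemma Q_frac_op:
  assumes t: "0 < t" and x: "x \<in> space M"
  shows "Q t (frac_op f \<kappa> c) x = c * (\<integral>s. s powr (- \<kappa> - 1) * (Q (t + s) f x - Q t f x) \<partial>lborel_pos)"
proof -
  interpret R: sigma_finite_measure lborel_pos by (rule sigma_finite_lborel_pos)
  interpret prob_space "P t x" by (rule prob[OF t x])
  interpret pair_sigma_finite "P t x" lborel_pos ..
  let ?h = "\<lambda>(y, s). s powr (- \<kappa> - 1) * (Q s f y - f y)"
  have meas: "?h \<in> borel_measurable (P t x \<Otimes>\<^sub>M lborel_pos)"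
    using measurable_increment[OF f(1)]
    by (subst measurable_cong_sets[OF sets_pair_measure_cong[OF sets_P[OF t x] refl] refl])
  note ae = AE_P[OF t x frac_op_integrand_AE]
  have "integrable (P t x) (\<lambda>y. \<integral>s. norm (?h (y, s)) \<partial>lborel_pos)"
  proof (rule integrable_const_bound[of _ "frac_bound A B \<beta> \<kappa>"])
    show "AE y in P t x. norm (\<integral>s. norm (?h (y, s)) \<partial>lborel_pos) \<le> frac_bound A B \<beta> \<kappa>"
      using ae by eventually_elim (simp add: abs_of_nonneg)
    have "(\<lambda>(y, s). norm (?h (y, s))) \<in> borel_measurable (P t x \<Otimes>\<^sub>M lborel_pos)"
      using measurable_compose[OF meas borel_measurable_norm] by (simp add: split_beta')
    then show "(\<lambda>y. \<integral>s. norm (?h (y, s)) \<partial>lborel_pos) \<in> borel_measurable (P t x)"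
      by (rule R.borel_measurable_lebesgue_integral)
  qed
  moreover have "AE y in P t x. integrable lborel_pos (\<lambda>s. ?h (y, s))"
    using ae by eventually_elim simp
  ultimately have int: "integrable (P t x \<Otimes>\<^sub>M lborel_pos) ?h"
    by (rule Fubini_integrable[OF meas])
  have "Q t (frac_op f \<kappa> c) x = (\<integral>y. frac_op f \<kappa> c y \<partial>P t x)"
    by (simp add: Q_def)
  also have "\<dots> = c * (\<integral>y. (\<integral>s. s powr (- \<kappa> - 1) * (Q s f y - f y) \<partial>lborel_pos) \<partial>P t x)"
    by (simp add: frac_op_def)
  also have "(\<integral>y. (\<integral>s. s powr (- \<kappa> - 1) * (Q s f y - f y) \<partial>lborel_pos) \<partial>P t x) =
      (\<integral>s. (\<integral>y. s powr (- \<kappa> - 1) * (Q s f y - f y) \<partial>P t x) \<partial>lborel_pos)"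
    using Fubini_integral[of "\<lambda>y s. s powr (- \<kappa> - 1) * (Q s f y - f y)"] int by simp
  also have "\<dots> = (\<integral>s. s powr (- \<kappa> - 1) * (Q (t + s) f x - Q t f x) \<partial>lborel_pos)"
  proof (rule Bochner_Integration.integral_cong[OF refl])
    fix s assume "s \<in> space lborel_pos"
    then have s: "0 < s" by (simp add: space_restrict_space)
    have "integrable (P t x) (Q s f)"
      using Q_bound[OF f s] by (intro integrable_P[OF Q_measurable[OF f(1) s] _ t x] AE_I2)
    moreover have "integrable (P t x) f"
      by (rule integrable_P[OF f t x])
    moreover have "(\<integral>y. Q s f y \<partial>P t x) = Q (t + s) f x"
      using semigroup[OF f s t x] by (simp add: Q_def add.commute)
    ultimately show "(\<integral>y. s powr (- \<kappa> - 1) * (Q s f y - f y) \<partial>P t x) = s powr (- \<kappa> - 1) * (Q (t + s) f x - Q t f x)"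
      by (simp add: Q_def[of t])
  qed
  finally show ?thesis .
qed

text \<open>By \<open>Q_frac_op\<close> the increments start at a positive time, so the derivative
  in t passes under the integral and produces increments of V, which are linearly small for small s
  and bounded for large s.\<close>

lemma V_frac_op_bound:
  assumes t: "0 < t" and x: "x \<in> space M"
  shows "\<bar>V t (frac_op f \<kappa> c) x\<bar> \<le> \<bar>c\<bar> * frac_lip_factor \<beta> \<kappa> * A * t powr (\<beta> - \<kappa> - 1)"
proof -
  let ?m = "\<lambda>u s. s powr (- \<kappa> - 1) * min (2 * A * (u / 2) powr (\<beta> - 1)) (8 * A * (u / 2) powr (\<beta> - 2) * s powr 1)"
  let ?d = "\<lambda>u s. s powr (- \<kappa> - 1) * (V (u + s) f x - V u f x)"
  have \<kappa>1: "\<kappa> < 1" using \<kappa> \<beta> by simp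
  \<comment> \<open>Both bounds decrease in time, so the bound at v covers every later u. The choice
    v = t / 2 dominates on (t / 2, 2 t), the choice v = u = t gives the final estimate.\<close>
  have d_bound: "\<bar>?d u s\<bar> \<le> ?m v s" if u: "0 < v" "v \<le> u" and s: "0 < s" for u v s
  proof -
    have u0: "0 < u" using u by simp
    have us: "0 < u + s" using u0 s by simp
    have tb1: "\<bar>V w f x\<bar> \<le> A * (w / 2) powr (\<beta> - 1)" if "0 < w" for w
      by (rule time_derivative_bound(1)[OF f lip[rule_format]]) (use that x in auto)
    have tb2: "\<bar>V (u + s) f x - V u f x\<bar> \<le> 8 * A * (u / 2) powr (\<beta> - 2) * s"
      by (rule time_derivative_bound(2)[OF f lip[rule_format]]) (use u0 s x in auto)
    have mono: "A * (w / 2) powr (\<beta> - 1) \<le> A * (v / 2) powr (\<beta> - 1)" "A * (w / 2) powr (\<beta> - 2) \<le> A * (v / 2) powr (\<beta> - 2)"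
      if "v \<le> w" for w
      using that u(1) A \<beta> by (auto intro!: mult_left_mono powr_mono2')
    have "\<bar>V u f x\<bar> \<le> A * (v / 2) powr (\<beta> - 1)" "\<bar>V (u + s) f x\<bar> \<le> A * (v / 2) powr (\<beta> - 1)"
      using order_trans[OF tb1[OF u0] mono(1)] order_trans[OF tb1[OF us] mono(1)] u s by auto
    then have 1: "\<bar>V (u + s) f x - V u f x\<bar> \<le> 2 * A * (v / 2) powr (\<beta> - 1)"
      by linarith
    have "\<bar>V (u + s) f x - V u f x\<bar> \<le> 8 * (A * (u / 2) powr (\<beta> - 2)) * s"
      using tb2 by (simp add: mult.assoc)
    also have "\<dots> \<le> 8 * (A * (v / 2) powr (\<beta> - 2)) * s"
      using mult_left_mono[OF mono(2)[OF u(2)], of 8] s by (intro mult_right_mono) auto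
    finally have "\<bar>V (u + s) f x - V u f x\<bar> \<le> 8 * A * (v / 2) powr (\<beta> - 2) * s powr 1"
      using s by (simp add: mult.assoc)
    with 1 show ?thesis
      by (simp add: abs_mult mult_left_mono)
  qed
  have m_int: "integrable lborel_pos (?m u)" if "0 < u" for u
    using A \<kappa> \<kappa>1 by (intro integral_powr_min_bound(1)[where t=1]) auto
  have space: "s \<in> space lborel_pos \<longleftrightarrow> 0 < s" for s
    by (simp add: space_restrict_space)
  have D1: "integrable lborel_pos (\<lambda>s. s powr (- \<kappa> - 1) * (Q (u + s) f x - Q u f x))" if "t / 2 < u" "u < 2 * t" for u
    using that t by (intro integrable_increment[OF f \<kappa>(1) \<kappa>1 _ x]) simp
  have D2: "((\<lambda>u. s powr (- \<kappa> - 1) * (Q (u + s) f x - Q u f x)) has_real_derivative ?d u s) (at u)"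
    if "t / 2 < u" "u < 2 * t" "s \<in> space lborel_pos" for u s
  proof -
    have "0 < u" "0 < u + s" using that t by (auto simp: space)
    then show ?thesis
      using V_DERIV(1)[OF f _ x, of u] V_DERIV(1)[OF f _ x, of "u + s"]
      by (intro DERIV_cmult DERIV_diff) (simp_all add: DERIV_shift)
  qed
  have D3: "\<bar>?d u s\<bar> \<le> ?m (t / 2) s" if "t / 2 < u" "u < 2 * t" "s \<in> space lborel_pos" for u s
    using that t by (intro d_bound) (auto simp: space)
  have "t / 2 < t" "t < 2 * t" "0 < t / 2" using t by simp_all
  then have D: "integrable lborel_pos (?d t)"
    "((\<lambda>u. \<integral>s. s powr (- \<kappa> - 1) * (Q (u + s) f x - Q u f x) \<partial>lborel_pos) has_real_derivative
      (\<integral>s. ?d t s \<partial>lborel_pos)) (at t)"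
    using has_real_derivative_integral[of "t / 2" t "2 * t", OF _ _ D1 D2 D3 m_int] by blast+
  have "((\<lambda>u. Q u (frac_op f \<kappa> c) x) has_real_derivative c * (\<integral>s. ?d t s \<partial>lborel_pos)) (at t)"
    by (rule has_field_derivative_transform_within_open[OF DERIV_cmult[OF D(2)], of "{0<..}"])
       (use t Q_frac_op[OF _ x] in auto)
  then have "V t (frac_op f \<kappa> c) x = c * (\<integral>s. ?d t s \<partial>lborel_pos)"
    unfolding V_def by (rule DERIV_imp_deriv)
  then have V_eq: "\<bar>V t (frac_op f \<kappa> c) x\<bar> = \<bar>c\<bar> * \<bar>\<integral>s. ?d t s \<partial>lborel_pos\<bar>"
    by (simp add: abs_mult)
  have "\<bar>\<integral>s. ?d t s \<partial>lborel_pos\<bar> \<le> (\<integral>s. \<bar>?d t s\<bar> \<partial>lborel_pos)"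
    by (rule integral_abs_bound)
  also have "\<dots> \<le> (\<integral>s. ?m t s \<partial>lborel_pos)"
  proof (rule integral_mono)
    show "\<bar>?d t s\<bar> \<le> ?m t s" if "s \<in> space lborel_pos" for s
      using that t by (intro d_bound) (auto simp: space)
  qed (rule integrable_abs[OF D(1)], rule m_int[OF t])
  \<comment> \<open>The cut s = t balances the two terms: each is a constant times t^(\<beta> -
    \<kappa> - 1).\<close>
  also have "\<dots> \<le> 8 * A * (t / 2) powr (\<beta> - 2) * t powr (1 - \<kappa>) / (1 - \<kappa>) + 2 * A * (t / 2) powr (\<beta> - 1) * t powr (- \<kappa>) / \<kappa>"
    using A \<kappa> \<kappa>1 t by (intro integral_powr_min_bound(2)) auto
  also have "\<dots> = frac_lip_factor \<beta> \<kappa> * A * t powr (\<beta> - \<kappa> - 1)"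
  proof -
    have "(t / 2) powr r = (1 / 2) powr r * t powr r" for r
      using t powr_mult[of t "1 / 2" r] by simp
    moreover have "t powr (\<beta> - 2) * t powr (1 - \<kappa>) = t powr (\<beta> - \<kappa> - 1)"
      "t powr (\<beta> - 1) * t powr (- \<kappa>) = t powr (\<beta> - \<kappa> - 1)"
      by (simp_all add: powr_add[symmetric] algebra_simps)
    ultimately have e: "8 * A * (t / 2) powr (\<beta> - 2) * t powr (1 - \<kappa>) = 8 * A * (1 / 2) powr (\<beta> - 2) * t powr (\<beta> - \<kappa> - 1)"
      "2 * A * (t / 2) powr (\<beta> - 1) * t powr (- \<kappa>) = 2 * A * (1 / 2) powr (\<beta> - 1) * t powr (\<beta> - \<kappa> - 1)"
      by (simp_all only: mult.assoc)
    show ?thesis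
      unfolding e frac_lip_factor_def by (simp add: algebra_simps)
  qed
  finally have "\<bar>\<integral>s. ?d t s \<partial>lborel_pos\<bar> \<le> frac_lip_factor \<beta> \<kappa> * A * t powr (\<beta> - \<kappa> - 1)" .
  then show ?thesis
    unfolding V_eq mult.assoc by (intro mult_left_mono) (simp_all add: mult.assoc)
qed

end

end

section \<open>The Laguerre kernel as a transition density\<close>

lemma nn_integral_gamma_kernel:
  assumes p: "0 < p" and b: "0 < b"
  shows "(\<integral>\<^sup>+y. ennreal (indicator {0<..} y * (y powr (p - 1) * exp (- (b * y)))) \<partial>lborel) = ennreal (Gamma p / b powr p)"
proof -
  have "ennreal (Gamma p) = (\<integral>\<^sup>+t. ennreal (indicator {0..} t * t powr (p - 1) / exp t) \<partial>lborel)"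
    using Gamma_conv_nn_integral_real[OF p] by simp
  also have "\<dots> = ennreal b * (\<integral>\<^sup>+y. ennreal (indicator {0..} (0 + b * y) * (0 + b * y) powr (p - 1) / exp (0 + b * y)) \<partial>lborel)"
    using b by (subst nn_integral_real_affine[where c=b and t=0]) auto
  also have "(\<integral>\<^sup>+y. ennreal (indicator {0..} (0 + b * y) * (0 + b * y) powr (p - 1) / exp (0 + b * y)) \<partial>lborel) =
      (\<integral>\<^sup>+y. ennreal (b powr (p - 1)) * ennreal (indicator {0<..} y * (y powr (p - 1) * exp (- (b * y)))) \<partial>lborel)"
    using b by (intro nn_integral_cong)
      (auto simp: indicator_def zero_le_mult_iff powr_mult exp_minus ennreal_mult''[symmetric] field_simps)
  also have "\<dots> = ennreal (b powr (p - 1)) * (\<integral>\<^sup>+y. ennreal (indicator {0<..} y * (y powr (p - 1) * exp (- (b * y)))) \<partial>lborel)"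
    by (rule nn_integral_cmult) measurable
  finally have "ennreal (Gamma p) = ennreal (b powr p) * (\<integral>\<^sup>+y. ennreal (indicator {0<..} y * (y powr (p - 1) * exp (- (b * y)))) \<partial>lborel)"
    using b by (simp add: mult.assoc[symmetric] ennreal_mult''[symmetric] powr_mult_base)
  then have "ennreal (1 / b powr p) * ennreal (Gamma p) =
      (ennreal (1 / b powr p) * ennreal (b powr p)) * (\<integral>\<^sup>+y. ennreal (indicator {0<..} y * (y powr (p - 1) * exp (- (b * y)))) \<partial>lborel)"
    by (simp only: mult.assoc)
  also have "ennreal (1 / b powr p) * ennreal (b powr p) = 1"
    using b by (simp add: ennreal_mult''[symmetric])
  finally show ?thesis
    using p by (simp add: ennreal_mult''[symmetric] Gamma_real_nonneg)
qed

text \<open>\<open>bessel_I\<close> is a \<open>suminf\<close>, so convergence has to be known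
  before the series can be used; the quotients (z / 2)^2 / ((k + 1) (k + \<nu> + 1)) of successive
  terms tend to 0.\<close>

lemma summable_bessel_I:
  assumes \<nu>: "- 1 < \<nu>" and z: "0 < z"
  shows "summable (\<lambda>k. (z / 2) powr (2 * real k + \<nu>) / (fact k * Gamma (real k + \<nu> + 1)))"
proof -
  define a where "a k = (z / 2) powr (2 * real k + \<nu>) / (fact k * Gamma (real k + \<nu> + 1))" for k
  have pos: "0 < Gamma (real k + \<nu> + 1)" for k
    using \<nu> by (intro Gamma_real_pos) (simp add: add_nonneg_pos)
  have a_pos: "0 < a k" for k
    using pos[of k] z by (simp add: a_def)
  have step: "a (Suc k) = a k * ((z / 2)\<^sup>2 / ((real k + 1) * (real k + \<nu> + 1)))" for k
  proof -
    have G: "Gamma (real (Suc k) + \<nu> + 1) = (real k + \<nu> + 1) * Gamma (real k + \<nu> + 1)"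
    proof -
      have "0 < real k + \<nu> + 1" using \<nu> by (simp add: add_nonneg_pos)
      then have "real k + \<nu> + 1 \<notin> \<int>\<^sub>\<le>\<^sub>0"
        using nonpos_Ints_nonpos by fastforce
      then show ?thesis
        using Gamma_plus1[of "real k + \<nu> + 1"] by (simp add: add_ac)
    qed
    have Z: "(z / 2) powr (2 * real (Suc k) + \<nu>) = (z / 2) powr (2 * real k + \<nu>) * (z / 2)\<^sup>2"
    proof -
      have "(z / 2) powr (2 * real (Suc k) + \<nu>) = (z / 2) powr ((2 * real k + \<nu>) + 2)"
        by (simp add: algebra_simps)
      then show ?thesis using z by (simp only: powr_add) simp
    qed
    have F: "fact (Suc k) = (real k + 1) * fact k" by simp
    show ?thesis unfolding a_def G Z F by (simp only: times_divide_times_eq mult_ac)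
  qed
  have "(\<lambda>k. (z / 2)\<^sup>2 / ((real k + 1) * (real k + \<nu> + 1))) \<longlonglongrightarrow> 0"
    by real_asymp
  then have "eventually (\<lambda>k. (z / 2)\<^sup>2 / ((real k + 1) * (real k + \<nu> + 1)) < 1 / 2) sequentially"
    by (rule order_tendstoD) simp
  then obtain N where N: "\<And>k. N \<le> k \<Longrightarrow> (z / 2)\<^sup>2 / ((real k + 1) * (real k + \<nu> + 1)) < 1 / 2"
    by (auto simp: eventually_sequentially)
  have "summable a"
  proof (rule summable_ratio_test[where c="1/2" and N=N])
    show "norm (a (Suc k)) \<le> 1 / 2 * norm (a k)" if "N \<le> k" for k
    proof -
      have nn: "norm (a j) = a j" for j using a_pos[of j] by simp
      have "a (Suc k) \<le> 1 / 2 * a k"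
        using mult_left_mono[OF less_imp_le[OF N[OF that]] less_imp_le[OF a_pos[of k]]]
        unfolding step by (simp only: mult.commute)
      then show ?thesis unfolding nn .
    qed
  qed simp
  then show ?thesis by (simp add: a_def[abs_def])
qed

definition kernel_factor :: "real \<Rightarrow> real \<Rightarrow> real \<Rightarrow> real \<Rightarrow> real" where
  "kernel_factor a t x y = Gamma (a + 1) / (1 - exp (- t))
     * exp (- (exp (- t) / (1 - exp (- t))) * (x + y))
     * sqrt (exp (- t) * x * y) powr (- a)
     * bessel_I a (2 * sqrt (exp (- t) * x * y) / (1 - exp (- t)))"

definition gamma_weight :: "real \<Rightarrow> real \<Rightarrow> real" where
  "gamma_weight a y = y powr a * exp (- y) / Gamma (a + 1)"

lemma laguerre_kernel_eq: "laguerre_kernel \<alpha> t x y = (\<Prod>j\<in>UNIV. kernel_factor (\<alpha> $ j) t (x $ j) (y $ j))"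
  by (simp add: laguerre_kernel_def kernel_factor_def)

text \<open>The summands are Poisson weights in \<open>k\<close> times Gamma densities in \<open>y\<close>.\<close>

lemma kernel_factor_sums:
  fixes a t x y :: real
  defines "r \<equiv> exp (- t)"
  assumes a: "- 1 < a" and t: "0 < t" and x: "0 < x" and y: "0 < y"
  shows "(\<lambda>k. exp (- (r / (1 - r) * x)) * (r / (1 - r) * x) ^ k / fact k *
      ((1 / (1 - r)) powr (real k + a + 1) * (y powr (real k + a) * exp (- (1 / (1 - r) * y))) / Gamma (real k + a + 1)))
    sums (kernel_factor a t x y * gamma_weight a y)"
    and "0 \<le> kernel_factor a t x y"
proof -
  let ?g = "\<lambda>k. exp (- (r / (1 - r) * x)) * (r / (1 - r) * x) ^ k / fact k *
      ((1 / (1 - r)) powr (real k + a + 1) * (y powr (real k + a) * exp (- (1 / (1 - r) * y))) / Gamma (real k + a + 1))"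
  have r: "0 < r" "r < 1" using t by (simp_all add: r_def)
  have q: "0 < r * x * y" using r x y by simp
  define s where "s = sqrt (r * x * y)"
  have s: "0 < s" "s\<^sup>2 = r * x * y" using q by (simp_all add: s_def)
  have Gpos: "0 < Gamma (real k + a + 1)" "0 < Gamma (a + 1)" for k
    using a by (auto intro!: Gamma_real_pos simp: add_nonneg_pos)
  define z where "z = 2 * s / (1 - r)"
  have z: "0 < z" "z / 2 = s / (1 - r)" using s r by (simp_all add: z_def field_simps)
  define C where "C = Gamma (a + 1) / (1 - r) * exp (- (r / (1 - r)) * (x + y)) * s powr (- a)"
  have C: "0 \<le> C" using Gpos r by (simp add: C_def)
  have kf: "kernel_factor a t x y = C * bessel_I a z"
    by (simp add: kernel_factor_def C_def z_def s_def r_def)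
  have "0 \<le> bessel_I a z"
    unfolding bessel_I_def using Gpos
    by (intro suminf_nonneg summable_bessel_I a z divide_nonneg_pos) auto
  then show "0 \<le> kernel_factor a t x y"
    using C by (simp add: kf)
  have "(\<lambda>k. (z / 2) powr (2 * real k + a) / (fact k * Gamma (real k + a + 1))) sums bessel_I a z"
    unfolding bessel_I_def by (rule summable_sums[OF summable_bessel_I[OF a z(1)]])
  from sums_mult2[OF sums_mult[OF this, of C], of "gamma_weight a y"]
  have S: "(\<lambda>k. C * ((z / 2) powr (2 * real k + a) / (fact k * Gamma (real k + a + 1))) * gamma_weight a y)
      sums (kernel_factor a t x y * gamma_weight a y)"
    by (simp add: kf)
  have "C * ((z / 2) powr (2 * real k + a) / (fact k * Gamma (real k + a + 1))) * gamma_weight a y =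
      ?g k" for k
  proof -
    \<comment> \<open>The Laguerre weight exp(-y) raises the rate r / (1 - r) to 1 / (1 - r), the
      rate of the Gamma densities.\<close>
    have e1: "exp (- (r / (1 - r)) * (x + y)) * exp (- y) = exp (- (r / (1 - r) * x)) * exp (- (1 / (1 - r) * y))"
    proof -
      have "1 / (1 - r) = r / (1 - r) + 1" using r by (simp add: field_simps)
      then show ?thesis by (simp only: exp_add[symmetric]) (simp add: algebra_simps add_divide_distrib)
    qed
    \<comment> \<open>The factor s^(-a) of the kernel cancels the order of the Bessel function and
      leaves the integer power (r x y)^k.\<close>
    have "s powr (- a) * (s / (1 - r)) powr (2 * real k + a) = (s powr (- a) * s powr (2 * real k + a)) * (1 / (1 - r)) powr (2 * real k + a)"
      using s r powr_mult[of s "1 / (1 - r)" "2 * real k + a"] by simp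
    also have "s powr (- a) * s powr (2 * real k + a) = s powr (real (2 * k))"
      by (simp add: powr_add[symmetric])
    also have "\<dots> = (r * x * y) ^ k"
      using s by (simp only: powr_realpow power_mult)
    finally have e2: "s powr (- a) * (s / (1 - r)) powr (2 * real k + a) = (r * x * y) ^ k * (1 / (1 - r)) powr (2 * real k + a)" .
    have "p powr (2 * real k + a) * p = p ^ k * p powr (real k + a + 1)" if "0 < p" for p
    proof -
      have "p powr (2 * real k + a) * p powr 1 = p powr (real k) * p powr (real k + a + 1)"
        by (simp only: powr_add[symmetric]) (simp add: algebra_simps)
      then show ?thesis using that by (simp add: powr_realpow)
    qed
    from this[of "1 / (1 - r)"]
    have e3: "(1 / (1 - r)) powr (2 * real k + a) * (1 / (1 - r)) = (1 / (1 - r)) ^ k * (1 / (1 - r)) powr (real k + a + 1)"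
      using r by simp
    have e4: "y ^ k * y powr a = y powr (real k + a)"
      using y by (simp add: powr_add powr_realpow)
    have e5: "(r * x * y) ^ k * (1 / (1 - r)) ^ k = (r / (1 - r) * x) ^ k * y ^ k"
      unfolding power_mult_distrib[symmetric] by (rule arg_cong[where f="\<lambda>z. z ^ k"]) simp
    have "C * ((z / 2) powr (2 * real k + a) / (fact k * Gamma (real k + a + 1))) * gamma_weight a y =
      (exp (- (r / (1 - r)) * (x + y)) * exp (- y)) * (s powr (- a) * (s / (1 - r)) powr (2 * real k + a)) * (1 / (1 - r))
        * y powr a / (fact k * Gamma (real k + a + 1))"
      using Gpos(2) by (simp add: C_def z(2) gamma_weight_def)
    also have "\<dots> = exp (- (r / (1 - r) * x)) * exp (- (1 / (1 - r) * y)) * ((r * x * y) ^ k * ((1 / (1 - r)) powr (2 * real k + a) * (1 / (1 - r))))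
        * y powr a / (fact k * Gamma (real k + a + 1))"
      unfolding e1 e2 by (simp only: mult_ac)
    also have "\<dots> = exp (- (r / (1 - r) * x)) * exp (- (1 / (1 - r) * y)) * (((r * x * y) ^ k * (1 / (1 - r)) ^ k) * (1 / (1 - r)) powr (real k + a + 1))
        * y powr a / (fact k * Gamma (real k + a + 1))"
      unfolding e3 by (simp only: mult_ac)
    also have "\<dots> = exp (- (r / (1 - r) * x)) * exp (- (1 / (1 - r) * y)) * ((r / (1 - r) * x) ^ k * (1 / (1 - r)) powr (real k + a + 1))
        * (y ^ k * y powr a) / (fact k * Gamma (real k + a + 1))"
      unfolding e5 by (simp only: mult_ac)
    also have "\<dots> = ?g k"
      unfolding e4 by (simp only: times_divide_eq_left times_divide_eq_right divide_divide_eq_left mult_ac)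
    finally show ?thesis .
  qed
  with S show "?g
    sums (kernel_factor a t x y * gamma_weight a y)"
    by (simp only:)
qed

lemma borel_measurable_bessel_I [measurable]: "bessel_I \<nu> \<in> borel_measurable borel"
  unfolding bessel_I_def by measurable

text \<open>A Gamma density of shape k + a + 1 and rate c has transform (1 / w)^(k + a + 1) with w =
  (c + l) / c. Summed against Poisson weights of mean m, the powers w^(-k) form an exponential
  series, so the Bessel function disappears.\<close>

lemma laplace_kernel_factor:
  fixes a t x l :: real
  defines "r \<equiv> exp (- t)"
  assumes a: "- 1 < a" and t: "0 < t" and x: "0 < x" and l: "0 \<le> l"
  shows "(\<integral>\<^sup>+y. ennreal (indicator {0<..} y * (kernel_factor a t x y * gamma_weight a y * exp (- (l * y)))) \<partial>lborel)
    = ennreal ((1 + l * (1 - r)) powr (- (a + 1)) * exp (- (l * r * x / (1 + l * (1 - r)))))"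
proof -
  have r: "0 < r" "r < 1" using t by (simp_all add: r_def)
  define c m w where "c = 1 / (1 - r)" and "m = r / (1 - r) * x" and "w = 1 + l * (1 - r)"
  have c: "0 < c" "0 < m" "1 \<le> w" using r x l by (simp_all add: c_def m_def w_def)
  have cw: "c + l = c * w" using r by (simp add: c_def w_def field_simps)
  have Gpos: "0 < Gamma (real k + a + 1)" for k
    using a by (auto intro!: Gamma_real_pos simp: add_nonneg_pos)
  define g where "g k y = exp (- m) * m ^ k / fact k *
      (c powr (real k + a + 1) * (y powr (real k + a) * exp (- (c * y))) / Gamma (real k + a + 1))" for k y
  have g: "(\<lambda>k. g k y) sums (kernel_factor a t x y * gamma_weight a y)" if "0 < y" for y
    using kernel_factor_sums(1)[OF a t x that] unfolding g_def m_def c_def r_def .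
  have g_nonneg: "0 \<le> g k y" for k y
    using c Gpos[of k] unfolding g_def by simp
  define b where "b k = exp (- m) * m ^ k / fact k * (1 / w) powr (real k + a + 1)" for k
  have b: "(\<integral>\<^sup>+y. ennreal (indicator {0<..} y * (g k y * exp (- (l * y)))) \<partial>lborel) = ennreal (b k)" for k
  proof -
    let ?p = "real k + a + 1" and ?D = "exp (- m) * m ^ k / fact k * (c powr (real k + a + 1) / Gamma (real k + a + 1))"
    have D: "0 \<le> ?D" using c Gpos[of k] by simp
    have p: "0 < ?p" using a by (simp add: add_nonneg_pos)
    have "indicator {0<..} y * (g k y * exp (- (l * y))) = ?D * (indicator {0<..} y * (y powr (?p - 1) * exp (- ((c + l) * y))))" for y :: real
      by (simp add: g_def ring_distribs exp_add exp_diff exp_minus divide_simps)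
    then have "(\<integral>\<^sup>+y. ennreal (indicator {0<..} y * (g k y * exp (- (l * y)))) \<partial>lborel) =
       (\<integral>\<^sup>+y. ennreal ?D * ennreal (indicator {0<..} y * (y powr (?p - 1) * exp (- ((c + l) * y)))) \<partial>lborel)"
      using D by (simp only: ennreal_mult' )
    also have "\<dots> = ennreal ?D * (\<integral>\<^sup>+y. ennreal (indicator {0<..} y * (y powr (?p - 1) * exp (- ((c + l) * y)))) \<partial>lborel)"
      by (rule nn_integral_cmult) measurable
    also have "(\<integral>\<^sup>+y. ennreal (indicator {0<..} y * (y powr (?p - 1) * exp (- ((c + l) * y)))) \<partial>lborel) =
        ennreal (Gamma ?p / (c + l) powr ?p)"
      using c l by (intro nn_integral_gamma_kernel p) simp
    also have "ennreal ?D * ennreal (Gamma ?p / (c + l) powr ?p) = ennreal (?D * (Gamma ?p / (c * w) powr ?p))"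
      unfolding cw by (rule ennreal_mult'[OF D, symmetric])
    also have "?D * (Gamma ?p / (c * w) powr ?p) = b k"
      using c Gpos[of k] by (simp add: b_def powr_mult powr_divide)
    finally show ?thesis .
  qed
  have "(\<integral>\<^sup>+y. ennreal (indicator {0<..} y * (kernel_factor a t x y * gamma_weight a y * exp (- (l * y)))) \<partial>lborel) =
      (\<integral>\<^sup>+y. (\<Sum>k. ennreal (indicator {0<..} y * (g k y * exp (- (l * y))))) \<partial>lborel)"
  proof (rule nn_integral_cong)
    fix y :: real
    show "ennreal (indicator {0<..} y * (kernel_factor a t x y * gamma_weight a y * exp (- (l * y)))) =
      (\<Sum>k. ennreal (indicator {0<..} y * (g k y * exp (- (l * y)))))"
    proof (cases "0 < y")
      case True
      then have "(\<lambda>k. indicator {0<..} y * (g k y * exp (- (l * y)))) sums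
          (indicator {0<..} y * (kernel_factor a t x y * gamma_weight a y * exp (- (l * y))))"
        by (intro sums_mult sums_mult2 g)
      then show ?thesis
        using g_nonneg by (intro suminf_ennreal_eq[symmetric]) auto
    qed simp
  qed
  also have "\<dots> = (\<Sum>k. ennreal (b k))"
    unfolding b[symmetric] by (rule nn_integral_suminf) (simp add: g_def)
  also have "\<dots> = ennreal (w powr (- (a + 1)) * exp (- (l * r * x / w)))"
  proof (rule suminf_ennreal_eq)
    show "0 \<le> b k" for k using c by (simp add: b_def)
    have "(\<lambda>k. (m / w) ^ k /\<^sub>R fact k) sums exp (m / w)"
      by (rule exp_converges)
    from sums_mult[OF this, of "exp (- m) * w powr (- (a + 1))"]
    have "(\<lambda>k. exp (- m) * w powr (- (a + 1)) * ((m / w) ^ k /\<^sub>R fact k)) sums (exp (- m) * w powr (- (a + 1)) * exp (m / w))" .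
    also have "(\<lambda>k. exp (- m) * w powr (- (a + 1)) * ((m / w) ^ k /\<^sub>R fact k)) = b"
    proof
      fix k
      have "(1 / w) powr (real k + a + 1) = (1 / w) powr (real k) * (1 / w) powr (a + 1)"
        by (simp add: powr_add[symmetric] add.assoc)
      also have "(1 / w) powr real k = 1 / w ^ k"
        using c by (simp add: powr_realpow power_one_over)
      also have "(1 / w) powr (a + 1) = w powr (- (a + 1))"
        unfolding powr_minus_divide using c by (simp add: powr_divide)
      finally have eq: "(1 / w) powr (real k + a + 1) = 1 / w ^ k * w powr (- (a + 1))" .
      show "exp (- m) * w powr (- (a + 1)) * ((m / w) ^ k /\<^sub>R fact k) = b k"
        unfolding b_def eq by (simp add: divide_inverse power_mult_distrib power_inverse mult_ac)
    qed
    also have "exp (- m) * w powr (- (a + 1)) * exp (m / w) = w powr (- (a + 1)) * exp (- (l * r * x / w))"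
    proof -
      \<comment> \<open>The exponent left over by the Poisson series; it equals -l r x / w.\<close>
      have "- m + m / w = - (m * (w - 1) / w)" using c by (simp add: field_simps)
      also have "m * (w - 1) = l * r * x" using r by (simp add: m_def w_def)
      finally show ?thesis by (simp add: exp_add[symmetric] mult_ac)
    qed
    finally show "b sums (w powr (- (a + 1)) * exp (- (l * r * x / w)))" .
  qed
  finally show ?thesis unfolding w_def .
qed

section \<open>Product structure of the Laguerre measure\<close>

lemma pos_orthant_sets [measurable]: "(pos_orthant :: (real ^ 'd) set) \<in> sets borel"
proof -
  have "pos_orthant = (\<Inter>i. {x :: real ^ 'd. 0 < x $ i})"
    by (auto simp: pos_orthant_def)
  moreover have "open (\<Inter>i. {x :: real ^ 'd. 0 < x $ i})"
    by (intro open_INT ballI finite open_Collect_less continuous_intros)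
  ultimately show ?thesis by simp
qed

lemma borel_measurable_vec_nth [measurable]: "(\<lambda>x :: real ^ 'd. x $ i) \<in> borel_measurable borel"
  by (intro borel_measurable_continuous_onI continuous_intros)

lemma sets_laguerre_measure [measurable_cong]: "sets (laguerre_measure \<alpha>) = sets (restrict_space borel pos_orthant)"
  by (simp add: laguerre_measure_def sets_restrict_space)

lemma space_laguerre_measure [simp]: "space (laguerre_measure \<alpha>) = pos_orthant"
  by (simp add: laguerre_measure_def space_restrict_space)

lemma borel_measurable_laguerre_measure:
  "f \<in> borel_measurable borel \<Longrightarrow> f \<in> borel_measurable (laguerre_measure \<alpha>)"
  unfolding measurable_cong_sets[OF sets_laguerre_measure refl] by (rule measurable_restrict_space1)

lemma prod_Basis_vec:
  fixes f :: "real ^ 'd \<Rightarrow> 'b::comm_monoid_mult"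
  shows "(\<Prod>b\<in>Basis. f b) = (\<Prod>i\<in>UNIV. f (axis i 1))"
proof -
  have "(Basis :: (real ^ 'd) set) = (\<lambda>i. axis i 1) ` UNIV"
    by (auto simp: Basis_vec_def)
  moreover have "inj (\<lambda>i :: 'd. axis i (1::real))"
    by (auto simp: inj_def axis_eq_axis)
  ultimately show ?thesis
    using prod.reindex[of "\<lambda>i :: 'd. axis i (1::real)" UNIV f] by (simp only: comp_def)
qed

lemma nn_integral_lborel_vec_prod:
  fixes h :: "'d::finite \<Rightarrow> real \<Rightarrow> ennreal"
  assumes [measurable]: "\<And>i. h i \<in> borel_measurable borel"
  shows "(\<integral>\<^sup>+y. (\<Prod>i\<in>UNIV. h i (y $ i)) \<partial>(lborel :: (real ^ 'd) measure)) = (\<Prod>i\<in>UNIV. \<integral>\<^sup>+z. h i z \<partial>lborel)"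
proof -
  \<comment> \<open>The product rule for \<open>lborel\<close> runs over basis vectors;
    \<open>idx\<close> reads the coordinate back from \<open>axis i 1\<close>.\<close>
  define idx where "idx b = (SOME i. b = axis i (1::real))" for b :: "real ^ 'd"
  have idx [simp]: "idx (axis i 1) = i" for i
    unfolding idx_def by (rule some_equality) (auto simp: axis_eq_axis)
  have "(\<integral>\<^sup>+y. (\<Prod>b\<in>Basis. h (idx b) (y \<bullet> b)) \<partial>(lborel :: (real ^ 'd) measure)) = (\<Prod>b\<in>(Basis :: (real ^ 'd) set). \<integral>\<^sup>+z. h (idx b) z \<partial>lborel)"
    by (rule nn_integral_lborel_prod) auto
  then show ?thesis
    by (simp add: prod_Basis_vec inner_axis)
qed

text \<open>The indicator of the orthant is a product of indicators of half-lines, so integrals of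
  products split. Nonnegativity is asked on z > 0 only, which is where it is known for the kernel
  factors.\<close>

lemma nn_integral_laguerre_measure_prod:
  fixes h :: "'d::finite \<Rightarrow> real \<Rightarrow> real" and \<alpha> :: "real ^ 'd"
  assumes \<alpha>: "\<And>i. - 1 < \<alpha> $ i"
    and h [measurable]: "\<And>i. h i \<in> borel_measurable borel" and nonneg: "\<And>i z. 0 < z \<Longrightarrow> 0 \<le> h i z"
  shows "(\<integral>\<^sup>+y. ennreal (\<Prod>i\<in>UNIV. h i (y $ i)) \<partial>laguerre_measure \<alpha>) =
    (\<Prod>i\<in>UNIV. \<integral>\<^sup>+z. ennreal (indicator {0<..} z * (h i z * gamma_weight (\<alpha> $ i) z)) \<partial>lborel)"
proof -
  have gw: "0 \<le> gamma_weight (\<alpha> $ i) z" for i z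
    using \<alpha>[of i] by (simp add: gamma_weight_def Gamma_real_nonneg)
  have [measurable]: "gamma_weight a \<in> borel_measurable borel" for a
    unfolding gamma_weight_def by measurable
  have "(\<integral>\<^sup>+y. ennreal (\<Prod>i\<in>UNIV. h i (y $ i)) \<partial>laguerre_measure \<alpha>) =
      (\<integral>\<^sup>+y. ennreal (\<Prod>i\<in>UNIV. gamma_weight (\<alpha> $ i) (y $ i)) * ennreal (\<Prod>i\<in>UNIV. h i (y $ i)) \<partial>restrict_space lborel pos_orthant)"
    unfolding laguerre_measure_def gamma_weight_def
    by (subst nn_integral_density) (auto intro!: measurable_restrict_space1)
  also have "\<dots> = (\<integral>\<^sup>+y. ennreal (\<Prod>i\<in>UNIV. gamma_weight (\<alpha> $ i) (y $ i)) * ennreal (\<Prod>i\<in>UNIV. h i (y $ i)) * indicator pos_orthant y \<partial>lborel)"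
    by (rule nn_integral_restrict_space) simp
  also have "\<dots> = (\<integral>\<^sup>+y. (\<Prod>i\<in>UNIV. ennreal (indicator {0<..} (y $ i) * (h i (y $ i) * gamma_weight (\<alpha> $ i) (y $ i)))) \<partial>lborel)"
  proof (rule nn_integral_cong)
    fix y :: "real ^ 'd"
    show "ennreal (\<Prod>i\<in>UNIV. gamma_weight (\<alpha> $ i) (y $ i)) * ennreal (\<Prod>i\<in>UNIV. h i (y $ i)) * indicator pos_orthant y =
      (\<Prod>i\<in>UNIV. ennreal (indicator {0<..} (y $ i) * (h i (y $ i) * gamma_weight (\<alpha> $ i) (y $ i))))"
    proof (cases "y \<in> pos_orthant")
      case True
      then have "0 < y $ i" for i by (simp add: pos_orthant_def)
      then show ?thesis
        using True nonneg gw
        by (simp add: prod_ennreal prod_nonneg ennreal_mult''[symmetric] prod.distrib[symmetric] mult.commute)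
    next
      case False
      then obtain i where "\<not> 0 < y $ i" by (auto simp: pos_orthant_def)
      then have "(\<Prod>i\<in>UNIV. ennreal (indicator {0<..} (y $ i) * (h i (y $ i) * gamma_weight (\<alpha> $ i) (y $ i)))) = 0"
        by (intro prod_zero bexI[of _ i]) auto
      then show ?thesis using False by simp
    qed
  qed
  also have "\<dots> = (\<Prod>i\<in>UNIV. \<integral>\<^sup>+z. ennreal (indicator {0<..} z * (h i z * gamma_weight (\<alpha> $ i) z)) \<partial>lborel)"
    by (rule nn_integral_lborel_vec_prod) measurable
  finally show ?thesis .
qed

lemma borel_measurable_kernel_factor [measurable (raw)]:
  assumes [measurable]: "t \<in> borel_measurable M" "x \<in> borel_measurable M" "y \<in> borel_measurable M"
  shows "(\<lambda>w. kernel_factor a (t w) (x w) (y w)) \<in> borel_measurable M"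
  unfolding kernel_factor_def by measurable

lemma prob_space_laguerre_measure:
  assumes \<alpha>: "\<And>i. - 1 < \<alpha> $ i"
  shows "prob_space (laguerre_measure (\<alpha> :: real ^ 'd))"
proof (rule prob_spaceI)
  have "(\<integral>\<^sup>+z. ennreal (indicator {0<..} z * (1 * gamma_weight a z)) \<partial>lborel) = 1" if "- 1 < a" for a
  proof -
    have "0 < Gamma (a + 1)" using that by simp
    have "(\<integral>\<^sup>+z. ennreal (indicator {0<..} z * (1 * gamma_weight a z)) \<partial>lborel) =
        (\<integral>\<^sup>+z. ennreal (1 / Gamma (a + 1)) * ennreal (indicator {0<..} z * (z powr ((a + 1) - 1) * exp (- (1 * z)))) \<partial>lborel)"
      using \<open>0 < Gamma (a + 1)\<close>
      by (intro nn_integral_cong) (simp add: ennreal_mult'[symmetric] gamma_weight_def)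
    also have "\<dots> = ennreal (1 / Gamma (a + 1)) * (\<integral>\<^sup>+z. ennreal (indicator {0<..} z * (z powr ((a + 1) - 1) * exp (- (1 * z)))) \<partial>lborel)"
      by (rule nn_integral_cmult) measurable
    also have "(\<integral>\<^sup>+z. ennreal (indicator {0<..} z * (z powr ((a + 1) - 1) * exp (- (1 * z)))) \<partial>lborel) = ennreal (Gamma (a + 1) / 1 powr (a + 1))"
      using that by (intro nn_integral_gamma_kernel) auto
    finally show ?thesis
      using \<open>0 < Gamma (a + 1)\<close> by (simp add: ennreal_mult'[symmetric])
  qed
  then have "(\<integral>\<^sup>+y. ennreal (\<Prod>i\<in>(UNIV :: 'd set). (1::real)) \<partial>laguerre_measure \<alpha>) = 1"
    using \<alpha> by (subst nn_integral_laguerre_measure_prod[where h="\<lambda>_ _. 1"]) auto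
  then show "emeasure (laguerre_measure \<alpha>) (space (laguerre_measure \<alpha>)) = 1"
    by simp
qed

text \<open>The solution at time t of l' = -l - l^2 with initial value l, as for a branching
  diffusion with immigration. The composition law of the kernels rests on the flow property of this
  map.\<close>

definition laguerre_laplace_rate :: "real \<Rightarrow> real \<Rightarrow> real" where
  "laguerre_laplace_rate t l = l * exp (- t) / (1 + l * (1 - exp (- t)))"

definition laguerre_laplace :: "real ^ 'd \<Rightarrow> real \<Rightarrow> real ^ 'd \<Rightarrow> real ^ 'd \<Rightarrow> real" where
  "laguerre_laplace \<alpha> t l x =
     (\<Prod>i\<in>UNIV. (1 + l $ i * (1 - exp (- t))) powr (- (\<alpha> $ i + 1)) * exp (- (laguerre_laplace_rate t (l $ i) * x $ i)))"

lemma laplace_laguerre_kernel: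
  fixes \<alpha> :: "real ^ 'd"
  assumes \<alpha>: "\<And>i. - 1 < \<alpha> $ i" and t: "0 < t" and x: "x \<in> pos_orthant" and l: "\<And>i. 0 \<le> l $ i"
  shows "(\<integral>\<^sup>+y. ennreal (laguerre_kernel \<alpha> t x y * exp (- (l \<bullet> y))) \<partial>laguerre_measure \<alpha>) = ennreal (laguerre_laplace \<alpha> t l x)"
proof -
  have x: "0 < x $ i" for i using x by (simp add: pos_orthant_def)
  have "laguerre_kernel \<alpha> t x y * exp (- (l \<bullet> y)) =
      (\<Prod>i\<in>UNIV. kernel_factor (\<alpha> $ i) t (x $ i) (y $ i) * exp (- (l $ i * y $ i)))" for y
    by (simp add: laguerre_kernel_eq prod.distrib inner_vec_def sum_negf[symmetric] exp_sum)
  then have "(\<integral>\<^sup>+y. ennreal (laguerre_kernel \<alpha> t x y * exp (- (l \<bullet> y))) \<partial>laguerre_measure \<alpha>) =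
      (\<integral>\<^sup>+y. ennreal (\<Prod>i\<in>UNIV. kernel_factor (\<alpha> $ i) t (x $ i) (y $ i) * exp (- (l $ i * y $ i))) \<partial>laguerre_measure \<alpha>)"
    by simp
  also have "\<dots> = (\<Prod>i\<in>UNIV. \<integral>\<^sup>+z. ennreal (indicator {0<..} z * (kernel_factor (\<alpha> $ i) t (x $ i) z * exp (- (l $ i * z)) * gamma_weight (\<alpha> $ i) z)) \<partial>lborel)"
    by (rule nn_integral_laguerre_measure_prod[OF \<alpha>, where h="\<lambda>i z. kernel_factor (\<alpha> $ i) t (x $ i) z * exp (- (l $ i * z))"])
       (auto simp: kernel_factor_sums(2)[OF \<alpha> t x])
  also have "\<dots> = (\<Prod>i\<in>UNIV. ennreal ((1 + l $ i * (1 - exp (- t))) powr (- (\<alpha> $ i + 1)) * exp (- (laguerre_laplace_rate t (l $ i) * x $ i))))"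
    using laplace_kernel_factor[OF \<alpha> t x l]
    by (intro prod.cong refl) (simp add: laguerre_laplace_rate_def mult_ac)
  also have "\<dots> = ennreal (laguerre_laplace \<alpha> t l x)"
    unfolding laguerre_laplace_def by (rule prod_ennreal) simp
  finally show ?thesis .
qed

lemma laguerre_laplace_rate_nonneg: "0 \<le> t \<Longrightarrow> 0 \<le> l \<Longrightarrow> 0 \<le> laguerre_laplace_rate t l"
  by (simp add: laguerre_laplace_rate_def)

text \<open>The bases of the prefactors at the two successive times multiply to the base at time s +
  t. This single identity settles the powers and, as a common denominator, also the flow property of
  the rate.\<close>

lemma laguerre_laplace_semigroup:
  assumes s: "0 < s" and t: "0 < t" and l: "\<And>i. 0 \<le> l $ i"
  shows "(\<Prod>i\<in>UNIV. (1 + l $ i * (1 - exp (- s))) powr (- (\<alpha> $ i + 1))) *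
      laguerre_laplace \<alpha> t (\<chi> i. laguerre_laplace_rate s (l $ i)) x = laguerre_laplace \<alpha> (s + t) l x"
  unfolding laguerre_laplace_def prod.distrib[symmetric] vec_lambda_beta
proof (rule prod.cong[OF refl])
  fix i
  define k q r w where "k = l $ i" and "q = exp (- s)" and "r = exp (- t)" and "w = 1 + k * (1 - q)"
  have k: "0 \<le> k" and q: "0 < q" "q < 1" and r: "0 < r" "r < 1"
    using l s t by (simp_all add: k_def q_def r_def)
  have w: "0 < w" using k q by (simp add: w_def add_pos_nonneg)
  have e: "exp (- (s + t)) = q * r" by (simp add: q_def r_def exp_add[symmetric])
  have w': "0 < 1 + k * q / w * (1 - r)"
    using k q r w by (intro add_pos_nonneg) auto
  have prod: "w * (1 + k * q / w * (1 - r)) = 1 + k * (1 - q * r)"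
    using w by (simp add: field_simps) (simp add: w_def algebra_simps)
  have rate: "laguerre_laplace_rate t (laguerre_laplace_rate s k) = laguerre_laplace_rate (s + t) k"
  proof -
    have "laguerre_laplace_rate t (laguerre_laplace_rate s k) = (k * q / w) * r / (1 + k * q / w * (1 - r))"
      by (simp add: laguerre_laplace_rate_def q_def r_def w_def)
    also have "\<dots> = k * q * r / (w * (1 + k * q / w * (1 - r)))"
      using w by simp
    also have "\<dots> = laguerre_laplace_rate (s + t) k"
      unfolding prod laguerre_laplace_rate_def e by (simp only: mult.assoc)
    finally show ?thesis .
  qed
  have "w powr (- (\<alpha> $ i + 1)) * (1 + k * q / w * (1 - r)) powr (- (\<alpha> $ i + 1)) = (1 + k * (1 - q * r)) powr (- (\<alpha> $ i + 1))"
    unfolding prod[symmetric] using w w' by (simp add: powr_mult)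
  moreover have "laguerre_laplace_rate s k = k * q / w"
    by (simp add: laguerre_laplace_rate_def q_def w_def)
  ultimately show "(1 + l $ i * (1 - exp (- s))) powr (- (\<alpha> $ i + 1)) *
      ((1 + laguerre_laplace_rate s (l $ i) * (1 - exp (- t))) powr (- (\<alpha> $ i + 1)) *
       exp (- (laguerre_laplace_rate t (laguerre_laplace_rate s (l $ i)) * x $ i))) =
      (1 + l $ i * (1 - exp (- (s + t)))) powr (- (\<alpha> $ i + 1)) * exp (- (laguerre_laplace_rate (s + t) (l $ i) * x $ i))"
    unfolding e k_def[symmetric] rate q_def[symmetric] r_def[symmetric] w_def[symmetric]
    by (simp only: mult.assoc[symmetric])
qed

section \<open>The Poisson-Laguerre semigroup\<close>

text \<open>The rule for integrals over a join wants a bound at every point, while f is bounded only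
  almost everywhere. Truncation at |B| changes f on null sets only, both for the mixture and for
  almost all K x.\<close>

lemma integral_bind_prob:
  fixes f :: "'b \<Rightarrow> real"
  assumes N: "prob_space N" and K: "K \<in> N \<rightarrow>\<^sub>M prob_algebra L"
    and f [measurable]: "f \<in> borel_measurable L" and B: "AE x in N. AE y in K x. \<bar>f y\<bar> \<le> B"
  shows "(\<integral>y. f y \<partial>(N \<bind> K)) = (\<integral>x. (\<integral>y. f y \<partial>K x) \<partial>N)"
proof -
  interpret prob_space N by fact
  have K' [measurable]: "K \<in> N \<rightarrow>\<^sub>M subprob_algebra L"
    by (rule measurable_prob_algebraD[OF K])
  have sets_bind: "sets (N \<bind> K) = sets L"
    by (rule sets_bind_measurable[OF K' not_empty])
  have sets_K: "sets (K x) = sets L" "prob_space (K x)" if "x \<in> space N" for x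
    using measurable_space[OF K that] by (auto simp: space_prob_algebra)
  define f' where "f' y = max (- \<bar>B\<bar>) (min \<bar>B\<bar> (f y))" for y
  have [measurable]: "f' \<in> borel_measurable L"
    unfolding f'_def by measurable
  have eq: "f' y = f y" if "\<bar>f y\<bar> \<le> B" for y
    using that by (auto simp: f'_def)
  have "AE y in N \<bind> K. \<bar>f y\<bar> \<le> B"
    using B by (subst AE_bind[OF K']) auto
  then have "(\<integral>y. f y \<partial>(N \<bind> K)) = (\<integral>y. f' y \<partial>(N \<bind> K))"
    using sets_bind by (intro integral_cong_AE) (auto simp: eq cong: measurable_cong_sets)
  also have "\<dots> = (\<integral>M'. integral\<^sup>L M' f' \<partial>distr N (subprob_algebra L) K)"
    unfolding bind_nonempty''[OF K' not_empty]
    by (rule integral_join[where B="\<bar>B\<bar>" and B'=1 and N=L])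
       (auto simp: f'_def AE_distr_iff prob_space.emeasure_space_1[OF sets_K(2)] intro!: finite_measure_distr AE_I2)
  also have "\<dots> = (\<integral>x. (\<integral>y. f' y \<partial>K x) \<partial>N)"
    by (subst integral_distr) auto
  also have "\<dots> = (\<integral>x. (\<integral>y. f y \<partial>K x) \<partial>N)"
  proof (rule integral_cong_AE)
    show "AE x in N. (\<integral>y. f' y \<partial>K x) = (\<integral>y. f y \<partial>K x)"
      using B AE_space
    proof eventually_elim
      case (elim x)
      then show ?case
        using sets_K(1)[OF elim(2)] by (intro integral_cong_AE) (auto simp: eq cong: measurable_cong_sets)
    qed
  qed measurable
  finally show ?thesis .
qed

lemma measurable_density_prob_algebra:
  assumes K: "sigma_finite_measure K"
    and g: "(\<lambda>(x, y). g x y) \<in> borel_measurable (N \<Otimes>\<^sub>M K)"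
    and prob: "\<And>x. x \<in> space N \<Longrightarrow> prob_space (density K (g x))"
  shows "(\<lambda>x. density K (g x)) \<in> N \<rightarrow>\<^sub>M prob_algebra K"
proof (intro measurable_prob_algebraI measurable_subprob_algebra prob)
  interpret sigma_finite_measure K by fact
  fix A assume [measurable]: "A \<in> sets K"
  note g[measurable]
  have "(\<lambda>x. \<integral>\<^sup>+y. g x y * indicator A y \<partial>K) \<in> borel_measurable N"
    by measurable
  moreover have "g x \<in> borel_measurable K" if "x \<in> space N" for x
    using that by measurable
  ultimately show "(\<lambda>x. emeasure (density K (g x)) A) \<in> borel_measurable N"
    by (subst measurable_cong) (auto simp: emeasure_density)
qed (auto intro: prob prob_space_imp_subprob_space)

lemma measurable_stable_half: "stable_half \<in> time_space \<rightarrow>\<^sub>M prob_algebra time_space"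
proof -
  have "stable_half \<in> time_space \<rightarrow>\<^sub>M prob_algebra lborel_pos"
    unfolding stable_half_def[abs_def]
  proof (rule measurable_density_prob_algebra[OF sigma_finite_lborel_pos])
    have [measurable]: "fst \<in> borel_measurable (time_space \<Otimes>\<^sub>M lborel_pos :: (real \<times> real) measure)"
      "snd \<in> borel_measurable (time_space \<Otimes>\<^sub>M lborel_pos :: (real \<times> real) measure)"
      by (auto intro!: measurable_compose[OF measurable_fst] measurable_compose[OF measurable_snd] measurable_restrict_space1)
    show "(\<lambda>(t, s). ennreal (stable_density t s)) \<in> borel_measurable (time_space \<Otimes>\<^sub>M lborel_pos)"
      unfolding stable_density_def split_beta' by measurable
    show "prob_space (density lborel_pos (\<lambda>s. ennreal (stable_density t s)))" if "t \<in> space time_space" for t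
      using prob_space_stable_half[of t] that by (simp add: stable_half_def space_restrict_space)
  qed
  \<comment> \<open>\<open>prob_algebra\<close> depends only on the measurable sets, so densities
    over \<open>lborel_pos\<close> give kernels into \<open>time_space\<close>.\<close>
  also have "prob_algebra lborel_pos = prob_algebra time_space"
    by (simp add: prob_algebra_def subprob_algebra_cong[OF sets_lborel_pos])
  finally show ?thesis .
qed

section \<open>Transition measures of the two semigroups\<close>

definition laguerre_transition :: "real ^ 'd \<Rightarrow> real \<Rightarrow> real ^ 'd \<Rightarrow> (real ^ 'd) measure" where
  "laguerre_transition \<alpha> t x = density (laguerre_measure \<alpha>) (\<lambda>y. ennreal (laguerre_kernel \<alpha> t x y))"

text \<open>Subordination as a mixture: the Laguerre process observed at an independent random time
  with law \<open>stable_half t\<close>. Written as a bind, it inherits measurability and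
  composition from the calculus of kernels.\<close>

definition poisson_transition :: "real ^ 'd \<Rightarrow> real \<Rightarrow> real ^ 'd \<Rightarrow> (real ^ 'd) measure" where
  "poisson_transition \<alpha> t x = stable_half t \<bind> (\<lambda>u. laguerre_transition \<alpha> u x)"

lemma laguerre_kernel_commute: "laguerre_kernel \<alpha> t x y = laguerre_kernel \<alpha> t y x"
  unfolding laguerre_kernel_def by (intro prod.cong refl) (simp add: ac_simps)

lemma borel_measurable_time_space: "(\<lambda>t. t) \<in> borel_measurable time_space"
  by (rule measurable_restrict_space1) simp

context
  fixes \<alpha> :: "real ^ 'd"
  assumes \<alpha>: "\<And>i. - 1 < \<alpha> $ i"
begin

abbreviation (input) \<mu> :: "(real ^ 'd) measure" where
  "\<mu> \<equiv> laguerre_measure \<alpha>"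

interpretation mu: prob_space "\<mu>"
  by (rule prob_space_laguerre_measure[OF \<alpha>])

lemma laguerre_kernel_nonneg: "0 < t \<Longrightarrow> x \<in> pos_orthant \<Longrightarrow> y \<in> pos_orthant \<Longrightarrow> 0 \<le> laguerre_kernel \<alpha> t x y"
  unfolding laguerre_kernel_eq
  by (intro prod_nonneg ballI kernel_factor_sums(2) \<alpha>) (auto simp: pos_orthant_def)

lemma borel_measurable_laguerre_kernel:
  assumes [measurable]: "t \<in> borel_measurable N" "x \<in> borel_measurable N" "y \<in> borel_measurable N"
  shows "(\<lambda>w. laguerre_kernel \<alpha> (t w) (x w) (y w)) \<in> borel_measurable N"
proof -
  have [measurable]: "(\<lambda>w. x w $ i) \<in> borel_measurable N" "(\<lambda>w. y w $ i) \<in> borel_measurable N" for i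
    by (rule measurable_compose[OF _ borel_measurable_vec_nth], fact)+
  show ?thesis unfolding laguerre_kernel_eq by measurable
qed

lemma id_laguerre_measure: "(\<lambda>x. x) \<in> borel_measurable \<mu>"
  by (rule borel_measurable_laguerre_measure) simp

lemma laguerre_transition_laplace:
  assumes t: "0 < t" and x: "x \<in> pos_orthant" and l: "\<And>i. 0 \<le> l $ i"
  shows "(\<integral>\<^sup>+y. ennreal (exp (- (l \<bullet> y))) \<partial>laguerre_transition \<alpha> t x) = ennreal (laguerre_laplace \<alpha> t l x)"
proof -
  have "(\<lambda>y. laguerre_kernel \<alpha> t x y) \<in> borel_measurable \<mu>"
    by (intro borel_measurable_laguerre_kernel id_laguerre_measure measurable_const) auto
  then have "(\<integral>\<^sup>+y. ennreal (exp (- (l \<bullet> y))) \<partial>laguerre_transition \<alpha> t x) =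
      (\<integral>\<^sup>+y. ennreal (laguerre_kernel \<alpha> t x y) * ennreal (exp (- (l \<bullet> y))) \<partial>\<mu>)"
    unfolding laguerre_transition_def
    by (intro nn_integral_density) (auto intro!: borel_measurable_laguerre_measure)
  also have "\<dots> = (\<integral>\<^sup>+y. ennreal (laguerre_kernel \<alpha> t x y * exp (- (l \<bullet> y))) \<partial>\<mu>)"
    by (intro nn_integral_cong) (simp add: ennreal_mult'')
  also have "\<dots> = ennreal (laguerre_laplace \<alpha> t l x)"
    by (rule laplace_laguerre_kernel[OF \<alpha> t x l])
  finally show ?thesis .
qed

lemma prob_space_laguerre_transition:
  assumes "0 < t" "x \<in> pos_orthant"
  shows "prob_space (laguerre_transition \<alpha> t x)"
  using laguerre_transition_laplace[OF assms, of 0]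
  by (intro prob_spaceI) (simp add: laguerre_laplace_def laguerre_laplace_rate_def)

lemma sets_laguerre_transition: "sets (laguerre_transition \<alpha> t x) = sets \<mu>"
  by (simp add: laguerre_transition_def)

lemma measurable_laguerre_transition:
  "(\<lambda>p. laguerre_transition \<alpha> (fst p) (snd p)) \<in> time_space \<Otimes>\<^sub>M \<mu> \<rightarrow>\<^sub>M prob_algebra \<mu>"
  unfolding laguerre_transition_def
proof (rule measurable_density_prob_algebra[OF mu.sigma_finite_measure_axioms])
  let ?N = "(time_space \<Otimes>\<^sub>M \<mu>) \<Otimes>\<^sub>M \<mu>"
  have "(\<lambda>w. laguerre_kernel \<alpha> (fst (fst w)) (snd (fst w)) (snd w)) \<in> borel_measurable ?N"
    by (intro borel_measurable_laguerre_kernel measurable_compose[OF _ borel_measurable_time_space]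
        measurable_compose[OF _ id_laguerre_measure]) measurable
  then show "(\<lambda>(p, y). ennreal (laguerre_kernel \<alpha> (fst p) (snd p) y)) \<in> borel_measurable ?N"
    by (simp add: split_beta')
  show "prob_space (density \<mu> (\<lambda>y. ennreal (laguerre_kernel \<alpha> (fst p) (snd p) y)))"
    if "p \<in> space (time_space \<Otimes>\<^sub>M \<mu>)" for p
    using that prob_space_laguerre_transition[of "fst p" "snd p"]
    by (auto simp: laguerre_transition_def space_pair_measure space_restrict_space)
qed

lemma measurable_laguerre_transition':
  assumes "t \<in> N \<rightarrow>\<^sub>M time_space" "x \<in> N \<rightarrow>\<^sub>M \<mu>"
  shows "(\<lambda>w. laguerre_transition \<alpha> (t w) (x w)) \<in> N \<rightarrow>\<^sub>M prob_algebra \<mu>"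
  using measurable_compose[OF measurable_Pair[OF assms] measurable_laguerre_transition] by simp

lemma laguerre_transition_time:
  "x \<in> pos_orthant \<Longrightarrow> (\<lambda>u. laguerre_transition \<alpha> u x) \<in> time_space \<rightarrow>\<^sub>M prob_algebra \<mu>"
  by (rule measurable_laguerre_transition') auto

lemma laguerre_transition_space:
  "0 < t \<Longrightarrow> laguerre_transition \<alpha> t \<in> \<mu> \<rightarrow>\<^sub>M prob_algebra \<mu>"
  using measurable_laguerre_transition'[of "\<lambda>_. t" "\<mu>" "\<lambda>x. x"] by (simp add: space_restrict_space)

lemma laguerre_transition_in_prob_algebra:
  "0 < t \<Longrightarrow> x \<in> pos_orthant \<Longrightarrow> laguerre_transition \<alpha> t x \<in> space (prob_algebra \<mu>)"
  by (simp add: space_prob_algebra sets_laguerre_transition prob_space_laguerre_transition)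

lemma laguerre_laplace_split:
  "laguerre_laplace \<alpha> t l y = (\<Prod>i\<in>UNIV. (1 + l $ i * (1 - exp (- t))) powr (- (\<alpha> $ i + 1))) *
     exp (- ((\<chi> i. laguerre_laplace_rate t (l $ i)) \<bullet> y))"
  by (simp add: laguerre_laplace_def prod.distrib inner_vec_def sum_negf[symmetric] exp_sum)

text \<open>As a function of its starting point y, the transform of the second step is a constant
  times exp(-(l' . y)), with l' the flowed parameter. Integrating it against the first step is thus
  again a Laplace transform, and uniqueness applies.\<close>

lemma laguerre_transition_semigroup:
  assumes s: "0 < s" and t: "0 < t" and x: "x \<in> pos_orthant"
  shows "laguerre_transition \<alpha> s x \<bind> laguerre_transition \<alpha> t = laguerre_transition \<alpha> (s + t) x"
proof (rule laplace_transform_unique[where S=pos_orthant])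
  note A = laguerre_transition_in_prob_algebra[OF s x] and B = laguerre_transition_space[OF t]
  show "0 \<le> x \<bullet> b" if "x \<in> pos_orthant" "b \<in> Basis" for x b :: "real ^ 'd"
    using that by (auto simp: Basis_vec_def pos_orthant_def inner_axis less_imp_le)
  show "sets (laguerre_transition \<alpha> s x \<bind> laguerre_transition \<alpha> t) = sets (restrict_space borel pos_orthant)"
    using sets_bind'[OF A B] by (simp add: sets_laguerre_measure)
  show "sets (laguerre_transition \<alpha> (s + t) x) = sets (restrict_space borel pos_orthant)"
    by (simp add: sets_laguerre_transition sets_laguerre_measure)
  interpret bind: prob_space "laguerre_transition \<alpha> s x \<bind> laguerre_transition \<alpha> t"
    by (rule prob_space_bind'[OF A B])
  interpret st: prob_space "laguerre_transition \<alpha> (s + t) x"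
    using s t x by (intro prob_space_laguerre_transition) auto
  show "finite_measure (laguerre_transition \<alpha> s x \<bind> laguerre_transition \<alpha> t)" "finite_measure (laguerre_transition \<alpha> (s + t) x)"
    by unfold_locales
  fix l :: "real ^ 'd" assume "\<And>b. b \<in> Basis \<Longrightarrow> 0 \<le> l \<bullet> b"
  from this[of "axis _ 1"] have l: "0 \<le> l $ i" for i by (simp add: inner_axis)
  let ?c = "\<Prod>i\<in>UNIV. (1 + l $ i * (1 - exp (- t))) powr (- (\<alpha> $ i + 1))"
  let ?l = "\<chi> i. laguerre_laplace_rate t (l $ i)"
  have c: "0 \<le> ?c" by (intro prod_nonneg) simp
  have "(\<integral>\<^sup>+z. ennreal (exp (- (l \<bullet> z))) \<partial>(laguerre_transition \<alpha> s x \<bind> laguerre_transition \<alpha> t)) =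
      (\<integral>\<^sup>+y. \<integral>\<^sup>+z. ennreal (exp (- (l \<bullet> z))) \<partial>laguerre_transition \<alpha> t y \<partial>laguerre_transition \<alpha> s x)"
    using measurable_prob_algebraD[OF B]
    by (intro nn_integral_bind[where B="\<mu>"])
       (auto intro!: borel_measurable_laguerre_measure simp: measurable_cong_sets[OF sets_laguerre_transition refl])
  also have "\<dots> = (\<integral>\<^sup>+y. ennreal ?c * ennreal (exp (- (?l \<bullet> y))) \<partial>laguerre_transition \<alpha> s x)"
  proof (rule nn_integral_cong)
    fix y assume "y \<in> space (laguerre_transition \<alpha> s x)"
    then have "y \<in> pos_orthant" by (simp add: laguerre_transition_def)
    then show "(\<integral>\<^sup>+z. ennreal (exp (- (l \<bullet> z))) \<partial>laguerre_transition \<alpha> t y) = ennreal ?c * ennreal (exp (- (?l \<bullet> y)))"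
      using laguerre_transition_laplace[OF t _ l] by (simp add: laguerre_laplace_split ennreal_mult'')
  qed
  also have "\<dots> = ennreal ?c * (\<integral>\<^sup>+y. ennreal (exp (- (?l \<bullet> y))) \<partial>laguerre_transition \<alpha> s x)"
    by (intro nn_integral_cmult)
       (auto intro!: borel_measurable_laguerre_measure simp: measurable_cong_sets[OF sets_laguerre_transition refl])
  also have "(\<integral>\<^sup>+y. ennreal (exp (- (?l \<bullet> y))) \<partial>laguerre_transition \<alpha> s x) = ennreal (laguerre_laplace \<alpha> s ?l x)"
    using t l by (intro laguerre_transition_laplace s x) (simp add: laguerre_laplace_rate_nonneg)
  also have "ennreal ?c * ennreal (laguerre_laplace \<alpha> s ?l x) = ennreal (laguerre_laplace \<alpha> (t + s) l x)"
    using laguerre_laplace_semigroup[OF t s l, where \<alpha>=\<alpha> and x=x] c by (simp add: ennreal_mult'[symmetric])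
  also have "\<dots> = (\<integral>\<^sup>+z. ennreal (exp (- (l \<bullet> z))) \<partial>laguerre_transition \<alpha> (s + t) x)"
    using laguerre_transition_laplace[OF add_pos_pos[OF s t] x l] by (simp add: add.commute)
  finally show "(\<integral>\<^sup>+z. ennreal (exp (- (l \<bullet> z))) \<partial>(laguerre_transition \<alpha> s x \<bind> laguerre_transition \<alpha> t)) =
      (\<integral>\<^sup>+z. ennreal (exp (- (l \<bullet> z))) \<partial>laguerre_transition \<alpha> (s + t) x)" .
qed simp

lemma absolutely_continuous_laguerre_transition: "absolutely_continuous \<mu> (laguerre_transition \<alpha> t x)"
  unfolding laguerre_transition_def
  by (intro absolutely_continuousI_density measurable_compose[OF borel_measurable_laguerre_kernel measurable_ennreal] id_laguerre_measure measurable_const) auto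

lemma AE_laguerre_transition:
  "AE y in \<mu>. R y \<Longrightarrow> AE y in laguerre_transition \<alpha> t x. R y"
  by (rule absolutely_continuous_AE[OF sets_laguerre_transition absolutely_continuous_laguerre_transition])

lemma stable_half_in_prob_algebra: "0 < t \<Longrightarrow> stable_half t \<in> space (prob_algebra time_space)"
  by (simp add: space_prob_algebra prob_space_stable_half)

lemma poisson_transition_in_prob_algebra:
  assumes "0 < t" "x \<in> pos_orthant"
  shows "prob_space (poisson_transition \<alpha> t x)" "sets (poisson_transition \<alpha> t x) = sets \<mu>"
  unfolding poisson_transition_def
  using prob_space_bind'[OF stable_half_in_prob_algebra[OF assms(1)] laguerre_transition_time[OF assms(2)]]
    sets_bind'[OF stable_half_in_prob_algebra[OF assms(1)] laguerre_transition_time[OF assms(2)]]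
  by simp_all

lemma measurable_poisson_transition:
  "(\<lambda>p. poisson_transition \<alpha> (fst p) (snd p)) \<in> time_space \<Otimes>\<^sub>M \<mu> \<rightarrow>\<^sub>M prob_algebra \<mu>"
  unfolding poisson_transition_def
proof (rule measurable_bind_prob_space2)
  show "(\<lambda>p. stable_half (fst p)) \<in> time_space \<Otimes>\<^sub>M \<mu> \<rightarrow>\<^sub>M prob_algebra time_space"
    by (rule measurable_compose[OF measurable_fst measurable_stable_half])
  show "(\<lambda>(p, u). laguerre_transition \<alpha> u (snd p)) \<in> (time_space \<Otimes>\<^sub>M \<mu>) \<Otimes>\<^sub>M time_space \<rightarrow>\<^sub>M prob_algebra \<mu>"
    unfolding split_beta' by (intro measurable_laguerre_transition') measurable
qed

lemma poisson_transition_space: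
  assumes "0 < t"
  shows "poisson_transition \<alpha> t \<in> \<mu> \<rightarrow>\<^sub>M prob_algebra \<mu>"
  using measurable_compose[OF measurable_Pair[OF measurable_const measurable_ident] measurable_poisson_transition, of t] assms
  by (simp add: space_restrict_space id_def)

lemma integral_poisson_transition:
  fixes f :: "real ^ 'd \<Rightarrow> real"
  assumes f: "f \<in> borel_measurable \<mu>" "AE y in \<mu>. \<bar>f y\<bar> \<le> B"
    and t: "0 < t" and x: "x \<in> pos_orthant"
  shows "(\<integral>y. f y \<partial>poisson_transition \<alpha> t x) = (\<integral>u. (\<integral>y. f y \<partial>laguerre_transition \<alpha> u x) \<partial>stable_half t)"
  unfolding poisson_transition_def
  using AE_laguerre_transition[OF f(2)] laguerre_transition_time[OF x]
  by (intro integral_bind_prob[OF prob_space_stable_half[OF t] _ f(1)])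
     (auto simp: measurable_cong_sets[OF sets_stable_half refl])

lemma laguerre_transition_integral_bound:
  fixes f :: "real ^ 'd \<Rightarrow> real"
  assumes f: "f \<in> borel_measurable \<mu>" "AE y in \<mu>. \<bar>f y\<bar> \<le> B"
    and t: "0 < t" and x: "x \<in> pos_orthant"
  shows "integrable (laguerre_transition \<alpha> t x) f" "\<bar>\<integral>y. f y \<partial>laguerre_transition \<alpha> t x\<bar> \<le> B"
proof -
  interpret prob_space "laguerre_transition \<alpha> t x"
    by (rule prob_space_laguerre_transition[OF t x])
  show int: "integrable (laguerre_transition \<alpha> t x) f"
    using AE_laguerre_transition[OF f(2)] f(1)
    by (intro integrable_const_bound[of _ B]) (auto simp: measurable_cong_sets[OF sets_laguerre_transition refl])
  have "\<bar>\<integral>y. f y \<partial>laguerre_transition \<alpha> t x\<bar> \<le> (\<integral>y. \<bar>f y\<bar> \<partial>laguerre_transition \<alpha> t x)"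
    by (rule integral_abs_bound)
  also have "\<dots> \<le> (\<integral>y. B \<partial>laguerre_transition \<alpha> t x)"
    using AE_laguerre_transition[OF f(2)] int by (intro integral_mono_AE integrable_abs) auto
  finally show "\<bar>\<integral>y. f y \<partial>laguerre_transition \<alpha> t x\<bar> \<le> B" by (simp add: prob_space)
qed

lemma laguerre_transition_integral_measurable:
  fixes f :: "real ^ 'd \<Rightarrow> real"
  assumes "f \<in> borel_measurable \<mu>"
  shows "(\<lambda>p. \<integral>y. f y \<partial>laguerre_transition \<alpha> (fst p) (snd p)) \<in> borel_measurable (time_space \<Otimes>\<^sub>M \<mu>)"
  by (rule measurable_compose[OF measurable_prob_algebraD[OF measurable_laguerre_transition] integral_measurable_subprob_algebra[OF assms]])

lemma laguerre_transition_integral_measurable_time: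
  fixes f :: "real ^ 'd \<Rightarrow> real"
  assumes "f \<in> borel_measurable \<mu>" "x \<in> pos_orthant"
  shows "(\<lambda>u. \<integral>y. f y \<partial>laguerre_transition \<alpha> u x) \<in> borel_measurable time_space"
  by (rule measurable_compose[OF measurable_prob_algebraD[OF laguerre_transition_time[OF assms(2)]] integral_measurable_subprob_algebra[OF assms(1)]])

text \<open>Two runs for random times u and v: the time v is independent of the position reached, so
  the two mixtures may be exchanged. The Laguerre law then merges the runs into one of length u + v,
  whose distribution is the stable convolution.\<close>

lemma poisson_transition_semigroup:
  assumes s: "0 < s" and t: "0 < t" and x: "x \<in> pos_orthant"
  shows "poisson_transition \<alpha> t x \<bind> poisson_transition \<alpha> s = poisson_transition \<alpha> (t + s) x"
proof -
  let ?L = "stable_half t \<bind> (\<lambda>u. stable_half s \<bind> (\<lambda>v. laguerre_transition \<alpha> (u + v) x))"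
  interpret S: prob_space "stable_half s" by (rule prob_space_stable_half[OF s])
  interpret T: prob_space "stable_half t" by (rule prob_space_stable_half[OF t])
  interpret TS: pair_prob_space "stable_half t" "stable_half s" ..
  have T_time: "(\<lambda>u. laguerre_transition \<alpha> u x) \<in> stable_half v \<rightarrow>\<^sub>M subprob_algebra \<mu>" for v
    using measurable_prob_algebraD[OF laguerre_transition_time[OF x]] by (simp add: measurable_cong_sets[OF sets_stable_half refl])
  have add: "(\<lambda>(a, b). a + b) \<in> stable_half t \<Otimes>\<^sub>M stable_half s \<rightarrow>\<^sub>M time_space"
  proof (rule measurable_restrict_space2)
    have [measurable]: "(\<lambda>s. s) \<in> stable_half v \<rightarrow>\<^sub>M borel" for v
      by (intro borel_measurable_stable_half) simp
    show "(\<lambda>(a, b). a + b) \<in> borel_measurable (stable_half t \<Otimes>\<^sub>M stable_half s)" by measurable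
  qed (auto simp: space_pair_measure)
  have "poisson_transition \<alpha> t x \<bind> poisson_transition \<alpha> s =
      stable_half t \<bind> (\<lambda>u. laguerre_transition \<alpha> u x \<bind> poisson_transition \<alpha> s)"
    unfolding poisson_transition_def[of _ t]
    by (rule bind_assoc[OF T_time measurable_prob_algebraD[OF poisson_transition_space[OF s]]])
  also have "\<dots> = ?L"
  proof (rule bind_cong[OF refl])
    fix u assume "u \<in> space (stable_half t)"
    then have u: "0 < u" by simp
    interpret U: prob_space "laguerre_transition \<alpha> u x" by (rule prob_space_laguerre_transition[OF u x])
    interpret US: pair_prob_space "laguerre_transition \<alpha> u x" "stable_half s" ..
    have "(\<lambda>(y, v). laguerre_transition \<alpha> v y) \<in> laguerre_transition \<alpha> u x \<Otimes>\<^sub>M stable_half s \<rightarrow>\<^sub>M subprob_algebra \<mu>"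
      unfolding split_beta' measurable_cong_sets[OF sets_pair_measure_cong[OF sets_laguerre_transition sets_stable_half] refl]
      by (rule measurable_prob_algebraD, rule measurable_laguerre_transition') measurable
    then have "laguerre_transition \<alpha> u x \<bind> poisson_transition \<alpha> s =
        stable_half s \<bind> (\<lambda>v. laguerre_transition \<alpha> u x \<bind> (\<lambda>y. laguerre_transition \<alpha> v y))"
      unfolding poisson_transition_def by (rule US.bind_rotate)
    also have "\<dots> = stable_half s \<bind> (\<lambda>v. laguerre_transition \<alpha> (u + v) x)"
      using laguerre_transition_semigroup[OF u _ x] by (intro bind_cong refl) simp
    finally show "laguerre_transition \<alpha> u x \<bind> poisson_transition \<alpha> s = stable_half s \<bind> (\<lambda>v. laguerre_transition \<alpha> (u + v) x)" .
  qed
  also have "\<dots> = poisson_transition \<alpha> (t + s) x"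
  proof (rule measure_eqI)
    have inner: "(\<lambda>v. laguerre_transition \<alpha> (u + v) x) \<in> stable_half s \<rightarrow>\<^sub>M subprob_algebra \<mu>" if "0 < u" for u
    proof -
      have "(\<lambda>v. u + v) \<in> time_space \<rightarrow>\<^sub>M time_space"
        using that by (intro measurable_restrict_space2) (auto simp: space_restrict_space intro!: measurable_restrict_space1)
      from measurable_compose[OF this measurable_prob_algebraD[OF laguerre_transition_time[OF x]]]
      show ?thesis by (simp add: measurable_cong_sets[OF sets_stable_half refl])
    qed
    have pair: "(\<lambda>p. laguerre_transition \<alpha> (fst p + snd p) x) \<in> stable_half t \<Otimes>\<^sub>M stable_half s \<rightarrow>\<^sub>M subprob_algebra \<mu>"
      using measurable_compose[OF add measurable_prob_algebraD[OF laguerre_transition_time[OF x]]] by (simp add: split_beta')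
    have outer: "(\<lambda>u. stable_half s \<bind> (\<lambda>v. laguerre_transition \<alpha> (u + v) x)) \<in> stable_half t \<rightarrow>\<^sub>M subprob_algebra \<mu>"
      by (rule measurable_bind[OF _ pair]) (simp add: space_subprob_algebra S.subprob_space_axioms)
    show sets: "sets ?L = sets (poisson_transition \<alpha> (t + s) x)"
      using sets_bind_measurable[OF outer T.not_empty] poisson_transition_in_prob_algebra(2)[of "t + s" x] s t x by simp
    fix A assume "A \<in> sets ?L"
    then have A: "A \<in> sets \<mu>"
      using sets_bind_measurable[OF outer T.not_empty] by simp
    have em [measurable]: "(\<lambda>w. emeasure (laguerre_transition \<alpha> w x) A) \<in> borel_measurable time_space"
      by (rule measurable_compose[OF measurable_prob_algebraD[OF laguerre_transition_time[OF x]] measurable_emeasure_subprob_algebra[OF A]])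
    note add[measurable]
    have "emeasure ?L A =
        (\<integral>\<^sup>+u. emeasure (stable_half s \<bind> (\<lambda>v. laguerre_transition \<alpha> (u + v) x)) A \<partial>stable_half t)"
      by (rule emeasure_bind[OF T.not_empty outer A])
    also have "\<dots> = (\<integral>\<^sup>+u. \<integral>\<^sup>+v. emeasure (laguerre_transition \<alpha> (u + v) x) A \<partial>stable_half s \<partial>stable_half t)"
      by (intro nn_integral_cong emeasure_bind[OF S.not_empty inner A]) simp
    also have "\<dots> = (\<integral>\<^sup>+p. emeasure (laguerre_transition \<alpha> (case p of (a, b) \<Rightarrow> a + b) x) A \<partial>(stable_half t \<Otimes>\<^sub>M stable_half s))"
      by (subst S.nn_integral_fst[symmetric]) simp_all
    also have "\<dots> = (\<integral>\<^sup>+w. emeasure (laguerre_transition \<alpha> w x) A \<partial>distr (stable_half t \<Otimes>\<^sub>M stable_half s) time_space (\<lambda>(a, b). a + b))"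
      by (rule nn_integral_distr[symmetric]) measurable
    also have "\<dots> = emeasure (poisson_transition \<alpha> (t + s) x) A"
      unfolding stable_half_convolution[OF t s] poisson_transition_def
      by (rule emeasure_bind[symmetric, OF _ T_time A]) simp
    finally show "emeasure ?L A =
        emeasure (poisson_transition \<alpha> (t + s) x) A" .
  qed
  finally show ?thesis .
qed

lemma absolutely_continuous_poisson_transition:
  assumes t: "0 < t" and x: "x \<in> pos_orthant"
  shows "absolutely_continuous \<mu> (poisson_transition \<alpha> t x)"
  unfolding absolutely_continuous_def
proof
  fix A assume A: "A \<in> null_sets \<mu>"
  have "emeasure (poisson_transition \<alpha> t x) A = (\<integral>\<^sup>+u. emeasure (laguerre_transition \<alpha> u x) A \<partial>stable_half t)"
    unfolding poisson_transition_def using A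
    by (intro emeasure_bind_prob_algebra[OF stable_half_in_prob_algebra[OF t] laguerre_transition_time[OF x]]) auto
  also have "\<dots> = (\<integral>\<^sup>+u. 0 \<partial>stable_half t)"
    using A absolutely_continuous_laguerre_transition
    by (intro nn_integral_cong) (auto simp: absolutely_continuous_def null_sets_def)
  finally show "A \<in> null_sets (poisson_transition \<alpha> t x)"
    using A poisson_transition_in_prob_algebra(2)[OF t x] by (auto simp: null_sets_def)
qed

section \<open>Symmetry and the behaviour at time zero\<close>

lemma integral_laguerre_transition:
  fixes f :: "real ^ 'd \<Rightarrow> real"
  assumes f: "f \<in> borel_measurable \<mu>" and t: "0 < t" and x: "x \<in> pos_orthant"
  shows "(\<integral>y. f y \<partial>laguerre_transition \<alpha> t x) = (\<integral>y. laguerre_kernel \<alpha> t x y * f y \<partial>\<mu>)"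
    and "integrable (laguerre_transition \<alpha> t x) f \<longleftrightarrow> integrable \<mu> (\<lambda>y. laguerre_kernel \<alpha> t x y * f y)"
proof -
  have "(\<lambda>y. laguerre_kernel \<alpha> t x y) \<in> borel_measurable \<mu>"
    by (intro borel_measurable_laguerre_kernel id_laguerre_measure measurable_const) auto
  moreover have "AE y in \<mu>. 0 \<le> laguerre_kernel \<alpha> t x y"
    using laguerre_kernel_nonneg[OF t x] by (intro AE_I2) simp
  ultimately show "(\<integral>y. f y \<partial>laguerre_transition \<alpha> t x) = (\<integral>y. laguerre_kernel \<alpha> t x y * f y \<partial>\<mu>)"
    "integrable (laguerre_transition \<alpha> t x) f \<longleftrightarrow> integrable \<mu> (\<lambda>y. laguerre_kernel \<alpha> t x y * f y)"
    unfolding laguerre_transition_def using f by (simp_all add: integral_density integrable_density)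
qed

text \<open>Reversibility, from the symmetry of the kernel. Fubini applies since the kernel
  integrates |f| to at most B at each x, while |e| <= 1 and the total mass is 1.\<close>

lemma laguerre_transition_symmetric:
  fixes e f :: "real ^ 'd \<Rightarrow> real"
  assumes f: "f \<in> borel_measurable \<mu>" "AE y in \<mu>. \<bar>f y\<bar> \<le> B"
    and e: "e \<in> borel_measurable \<mu>" "\<And>y. y \<in> pos_orthant \<Longrightarrow> \<bar>e y\<bar> \<le> 1"
    and t: "0 < t"
  shows "(\<integral>x. e x * (\<integral>y. f y \<partial>laguerre_transition \<alpha> t x) \<partial>\<mu>) =
    (\<integral>y. f y * (\<integral>x. e x \<partial>laguerre_transition \<alpha> t y) \<partial>\<mu>)"
proof -
  interpret pair_sigma_finite \<mu> \<mu> ..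
  let ?h = "\<lambda>x y. e x * (laguerre_kernel \<alpha> t x y * f y)"
  note f(1)[measurable] e(1)[measurable]
  have [measurable]: "(\<lambda>p. laguerre_kernel \<alpha> t (fst p) (snd p)) \<in> borel_measurable (\<mu> \<Otimes>\<^sub>M \<mu>)"
    by (intro borel_measurable_laguerre_kernel measurable_compose[OF _ id_laguerre_measure]) measurable
  have meas: "(\<lambda>(x, y). ?h x y) \<in> borel_measurable (\<mu> \<Otimes>\<^sub>M \<mu>)"
    unfolding split_beta' by measurable
  have abs_f: "(\<lambda>y. \<bar>f y\<bar>) \<in> borel_measurable \<mu>" "AE y in \<mu>. \<bar>\<bar>f y\<bar>\<bar> \<le> B"
    using f by auto
  have int_x: "integrable \<mu> (\<lambda>y. laguerre_kernel \<alpha> t x y * f y)"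
    "integrable \<mu> (\<lambda>y. laguerre_kernel \<alpha> t x y * \<bar>f y\<bar>)"
    "\<bar>\<integral>y. laguerre_kernel \<alpha> t x y * \<bar>f y\<bar> \<partial>\<mu>\<bar> \<le> B" if "x \<in> pos_orthant" for x
    using laguerre_transition_integral_bound[OF f t that] laguerre_transition_integral_bound[OF abs_f t that]
    unfolding integral_laguerre_transition[OF f(1) t that] integral_laguerre_transition[OF abs_f(1) t that]
    by blast+
  have "integrable (\<mu> \<Otimes>\<^sub>M \<mu>) (\<lambda>(x, y). ?h x y)"
  proof (rule Fubini_integrable[OF meas])
    show "integrable \<mu> (\<lambda>x. \<integral>y. norm (case (x, y) of (x, y) \<Rightarrow> ?h x y) \<partial>\<mu>)"
    proof (rule mu.integrable_const_bound[of _ B])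
      show "(\<lambda>x. \<integral>y. norm (case (x, y) of (x, y) \<Rightarrow> ?h x y) \<partial>\<mu>) \<in> borel_measurable \<mu>"
        using measurable_compose[OF meas borel_measurable_norm]
        by (intro mu.borel_measurable_lebesgue_integral) (simp add: split_beta')
      show "AE x in \<mu>. norm (\<integral>y. norm (case (x, y) of (x, y) \<Rightarrow> ?h x y) \<partial>\<mu>) \<le> B"
      proof (rule AE_I2)
        fix x assume "x \<in> space \<mu>"
        then have x: "x \<in> pos_orthant" by simp
        have h: "(\<integral>y. norm (case (x, y) of (x, y) \<Rightarrow> ?h x y) \<partial>\<mu>) = (\<integral>y. \<bar>e x\<bar> * (laguerre_kernel \<alpha> t x y * \<bar>f y\<bar>) \<partial>\<mu>)"
          using laguerre_kernel_nonneg[OF t x] by (intro Bochner_Integration.integral_cong) (auto simp: abs_mult)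
        have "norm (\<integral>y. norm (case (x, y) of (x, y) \<Rightarrow> ?h x y) \<partial>\<mu>) = \<bar>e x\<bar> * \<bar>\<integral>y. laguerre_kernel \<alpha> t x y * \<bar>f y\<bar> \<partial>\<mu>\<bar>"
          unfolding h by (simp add: abs_mult)
        also have "\<dots> \<le> 1 * B"
          using e(2)[OF x] int_x(3)[OF x] by (intro mult_mono) auto
        finally show "norm (\<integral>y. norm (case (x, y) of (x, y) \<Rightarrow> ?h x y) \<partial>\<mu>) \<le> B" by simp
      qed
    qed
    show "AE x in \<mu>. integrable \<mu> (\<lambda>y. case (x, y) of (x, y) \<Rightarrow> ?h x y)"
      using int_x(1) by (intro AE_I2) simp
  qed
  from Fubini_integral[OF this]
  have Fubini: "(\<integral>y. (\<integral>x. ?h x y \<partial>\<mu>) \<partial>\<mu>) = (\<integral>x. (\<integral>y. ?h x y \<partial>\<mu>) \<partial>\<mu>)" .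
  have inner_y: "(\<integral>y. ?h x y \<partial>\<mu>) = e x * (\<integral>y. f y \<partial>laguerre_transition \<alpha> t x)" if "x \<in> pos_orthant" for x
    by (simp add: integral_laguerre_transition(1) f(1) t that)
  have inner_x: "(\<integral>x. ?h x y \<partial>\<mu>) = f y * (\<integral>x. e x \<partial>laguerre_transition \<alpha> t y)" if "y \<in> pos_orthant" for y
  proof -
    have "(\<integral>x. ?h x y \<partial>\<mu>) = (\<integral>x. f y * (laguerre_kernel \<alpha> t y x * e x) \<partial>\<mu>)"
      by (intro Bochner_Integration.integral_cong refl) (simp add: laguerre_kernel_commute[of \<alpha> t y] mult_ac)
    then show ?thesis
      by (simp add: integral_laguerre_transition(1) e(1) t that)
  qed
  have "(\<integral>x. e x * (\<integral>y. f y \<partial>laguerre_transition \<alpha> t x) \<partial>\<mu>) = (\<integral>x. (\<integral>y. ?h x y \<partial>\<mu>) \<partial>\<mu>)"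
    by (rule Bochner_Integration.integral_cong[OF refl inner_y[symmetric]]) simp
  also have "\<dots> = (\<integral>y. (\<integral>x. ?h x y \<partial>\<mu>) \<partial>\<mu>)"
    by (rule Fubini[symmetric])
  also have "\<dots> = (\<integral>y. f y * (\<integral>x. e x \<partial>laguerre_transition \<alpha> t y) \<partial>\<mu>)"
    by (rule Bochner_Integration.integral_cong[OF refl inner_x]) simp
  finally show ?thesis .
qed

text \<open>Each power has a base of at least 1 and a negative exponent, as \<alpha> + 1 >
  0.\<close>

lemma laguerre_laplace_bounds: "0 < t \<Longrightarrow> x \<in> pos_orthant \<Longrightarrow> (\<And>i. 0 \<le> l $ i) \<Longrightarrow> \<bar>laguerre_laplace \<alpha> t l x\<bar> \<le> 1"
proof -
  assume t: "0 < t" and x: "x \<in> pos_orthant" and l: "\<And>i. 0 \<le> l $ i"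
  have "(1 + l $ i * (1 - exp (- t))) powr (- (\<alpha> $ i + 1)) * exp (- (laguerre_laplace_rate t (l $ i) * x $ i)) \<le> 1 * 1" for i
  proof (rule mult_mono)
    show "(1 + l $ i * (1 - exp (- t))) powr (- (\<alpha> $ i + 1)) \<le> 1"
      using powr_mono2'[of "- (\<alpha> $ i + 1)" 1 "1 + l $ i * (1 - exp (- t))"] \<alpha>[of i] l[of i] t by simp
    show "exp (- (laguerre_laplace_rate t (l $ i) * x $ i)) \<le> 1"
      using laguerre_laplace_rate_nonneg[of t "l $ i"] x l[of i] t by (simp add: pos_orthant_def less_imp_le)
  qed simp_all
  then have "laguerre_laplace \<alpha> t l x \<le> (\<Prod>i\<in>(UNIV :: 'd set). 1)"
    unfolding laguerre_laplace_def by (intro prod_mono) auto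
  moreover have "0 \<le> laguerre_laplace \<alpha> t l x"
    unfolding laguerre_laplace_def by (intro prod_nonneg) auto
  ultimately show ?thesis by simp
qed

lemma integral_exp_laguerre_transition:
  assumes t: "0 < t" and x: "x \<in> pos_orthant" and l: "\<And>i. 0 \<le> l $ i"
  shows "(\<integral>y. exp (- (l \<bullet> y)) \<partial>laguerre_transition \<alpha> t x) = laguerre_laplace \<alpha> t l x"
proof -
  have "0 \<le> laguerre_laplace \<alpha> t l x"
    unfolding laguerre_laplace_def by (intro prod_nonneg) auto
  then show ?thesis
    by (subst integral_eq_nn_integral)
       (auto simp: laguerre_transition_laplace[OF t x l] measurable_cong_sets[OF sets_laguerre_transition refl]
         intro!: borel_measurable_laguerre_measure)
qed

lemma laguerre_laplace_tendsto:
  assumes "X \<longlonglongrightarrow> 0"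
  shows "(\<lambda>n. laguerre_laplace \<alpha> (X n) l x) \<longlonglongrightarrow> exp (- (l \<bullet> x))"
proof -
  have "(\<lambda>n. laguerre_laplace \<alpha> (X n) l x) \<longlonglongrightarrow>
      (\<Prod>i\<in>UNIV. (1 + l $ i * (1 - exp (- 0))) powr (- (\<alpha> $ i + 1)) * exp (- (l $ i * exp (- 0) / (1 + l $ i * (1 - exp (- 0))) * x $ i)))"
    unfolding laguerre_laplace_def laguerre_laplace_rate_def
    by (intro tendsto_intros assms) auto
  then show ?thesis
    by (simp add: inner_vec_def sum_negf[symmetric] exp_sum)
qed

text \<open>Symmetry moves each Laguerre step from f onto the exponential, where it is
  \<open>laguerre_laplace\<close>. The limit u to 0 can then be taken in an explicit factor.\<close>

lemma integral_exp_poisson_transition: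
  fixes f :: "real ^ 'd \<Rightarrow> real"
  assumes f: "f \<in> borel_measurable \<mu>" "AE y in \<mu>. \<bar>f y\<bar> \<le> B"
    and t: "0 < t" and l: "\<And>i. 0 \<le> l $ i"
  shows "(\<integral>x. exp (- (l \<bullet> x)) * (\<integral>y. f y \<partial>poisson_transition \<alpha> t x) \<partial>\<mu>) =
    (\<integral>u. (\<integral>y. f y * laguerre_laplace \<alpha> u l y \<partial>\<mu>) \<partial>stable_half t)"
proof -
  let ?e = "\<lambda>x. exp (- (l \<bullet> x))"
  interpret S: prob_space "stable_half t" by (rule prob_space_stable_half[OF t])
  interpret MS: pair_prob_space \<mu> "stable_half t" ..
  have e: "?e \<in> borel_measurable \<mu>" "\<bar>?e y\<bar> \<le> 1" if "y \<in> pos_orthant" for y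
    using l that by (auto intro!: borel_measurable_laguerre_measure sum_nonneg simp: inner_vec_def pos_orthant_def less_imp_le)
  have e_meas [measurable]: "?e \<in> borel_measurable \<mu>"
    by (intro borel_measurable_laguerre_measure) simp
  have "(\<lambda>p. \<integral>y. f y \<partial>laguerre_transition \<alpha> (snd p) (fst p)) \<in> borel_measurable (\<mu> \<Otimes>\<^sub>M time_space)"
    using measurable_compose[OF measurable_pair_swap' laguerre_transition_integral_measurable[OF f(1)]] by (simp add: split_beta')
  then have [measurable]: "(\<lambda>p. \<integral>y. f y \<partial>laguerre_transition \<alpha> (snd p) (fst p)) \<in> borel_measurable (\<mu> \<Otimes>\<^sub>M stable_half t)"
    by (subst measurable_cong_sets[OF sets_pair_measure_cong[OF refl sets_stable_half] refl])
  have int: "integrable (\<mu> \<Otimes>\<^sub>M stable_half t) (\<lambda>(x, u). ?e x * (\<integral>y. f y \<partial>laguerre_transition \<alpha> u x))"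
  proof (rule MS.P.integrable_const_bound[of _ B])
    show "AE p in \<mu> \<Otimes>\<^sub>M stable_half t. norm (case p of (x, u) \<Rightarrow> ?e x * (\<integral>y. f y \<partial>laguerre_transition \<alpha> u x)) \<le> B"
    proof (rule AE_I2)
      fix p assume p: "p \<in> space (\<mu> \<Otimes>\<^sub>M stable_half t)"
      then have xu: "fst p \<in> pos_orthant" "0 < snd p" by (auto simp: space_pair_measure)
      have "\<bar>?e (fst p)\<bar> * \<bar>\<integral>y. f y \<partial>laguerre_transition \<alpha> (snd p) (fst p)\<bar> \<le> 1 * B"
        by (intro mult_mono e(2) xu laguerre_transition_integral_bound(2)[OF f]) auto
      then show "norm (case p of (x, u) \<Rightarrow> ?e x * (\<integral>y. f y \<partial>laguerre_transition \<alpha> u x)) \<le> B"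
        by (simp add: split_beta abs_mult)
    qed
    show "(\<lambda>(x, u). ?e x * (\<integral>y. f y \<partial>laguerre_transition \<alpha> u x)) \<in> borel_measurable (\<mu> \<Otimes>\<^sub>M stable_half t)"
      unfolding split_beta' by measurable
  qed
  have "(\<integral>x. ?e x * (\<integral>y. f y \<partial>poisson_transition \<alpha> t x) \<partial>\<mu>) =
      (\<integral>x. (\<integral>u. ?e x * (\<integral>y. f y \<partial>laguerre_transition \<alpha> u x) \<partial>stable_half t) \<partial>\<mu>)"
    by (intro Bochner_Integration.integral_cong refl) (simp add: integral_poisson_transition[OF f t])
  also have "\<dots> = (\<integral>u. (\<integral>x. ?e x * (\<integral>y. f y \<partial>laguerre_transition \<alpha> u x) \<partial>\<mu>) \<partial>stable_half t)"
    by (rule MS.Fubini_integral[OF int, symmetric])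
  also have "\<dots> = (\<integral>u. (\<integral>y. f y * laguerre_laplace \<alpha> u l y \<partial>\<mu>) \<partial>stable_half t)"
  proof (rule Bochner_Integration.integral_cong[OF refl])
    fix u assume "u \<in> space (stable_half t)"
    then have u: "0 < u" by simp
    have "(\<integral>x. ?e x * (\<integral>y. f y \<partial>laguerre_transition \<alpha> u x) \<partial>\<mu>) = (\<integral>y. f y * (\<integral>x. ?e x \<partial>laguerre_transition \<alpha> u y) \<partial>\<mu>)"
      by (rule laguerre_transition_symmetric[OF f e_meas e(2) u])
    also have "\<dots> = (\<integral>y. f y * laguerre_laplace \<alpha> u l y \<partial>\<mu>)"
      by (intro Bochner_Integration.integral_cong refl) (simp add: integral_exp_laguerre_transition[OF u _ l])
    finally show "(\<integral>x. ?e x * (\<integral>y. f y \<partial>laguerre_transition \<alpha> u x) \<partial>\<mu>) = (\<integral>y. f y * laguerre_laplace \<alpha> u l y \<partial>\<mu>)" .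
  qed
  finally show ?thesis .
qed

text \<open>Weak convergence of P_t f to f. By scaling, the random time is (\<tau> n)^2 v with v of
  law \<open>stable_half 1\<close>; one dominated convergence in y for fixed v and one in v remain,
  both with bound B.\<close>

lemma poisson_transition_exp_limit:
  fixes f :: "real ^ 'd \<Rightarrow> real"
  assumes f: "f \<in> borel_measurable \<mu>" "AE y in \<mu>. \<bar>f y\<bar> \<le> B"
    and l: "\<And>i. 0 \<le> l $ i" and \<tau>: "\<tau> \<longlonglongrightarrow> 0" "\<And>n. 0 < \<tau> n"
  shows "(\<lambda>n. \<integral>x. exp (- (l \<bullet> x)) * (\<integral>y. f y \<partial>poisson_transition \<alpha> (\<tau> n) x) \<partial>\<mu>)
    \<longlonglongrightarrow> (\<integral>x. exp (- (l \<bullet> x)) * f x \<partial>\<mu>)"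
proof -
  interpret S: prob_space "stable_half 1" by (rule prob_space_stable_half) simp
  define k where "k u = (\<integral>y. f y * laguerre_laplace \<alpha> u l y \<partial>\<mu>)" for u
  note f(1)[measurable]
  have lap_meas: "(\<lambda>p. laguerre_laplace \<alpha> (fst p) l (snd p)) \<in> borel_measurable (time_space \<Otimes>\<^sub>M \<mu>)"
  proof -
    have [measurable]: "(\<lambda>p. snd p $ i) \<in> borel_measurable (time_space \<Otimes>\<^sub>M \<mu>)" for i
      by (rule measurable_compose[OF measurable_compose[OF measurable_snd id_laguerre_measure] borel_measurable_vec_nth])
    have [measurable]: "fst \<in> borel_measurable (time_space \<Otimes>\<^sub>M \<mu>)"
      by (rule measurable_compose[OF measurable_fst borel_measurable_time_space])
    show ?thesis unfolding laguerre_laplace_def laguerre_laplace_rate_def by measurable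
  qed
  have lap_meas_x: "laguerre_laplace \<alpha> u l \<in> borel_measurable \<mu>" if "0 < u" for u
    using measurable_compose[OF measurable_Pair1' lap_meas, of u] that by (simp add: space_restrict_space)
  have f_lap_bound: "AE y in \<mu>. \<bar>f y * laguerre_laplace \<alpha> u l y\<bar> \<le> B" if "0 < u" for u
    using f(2) AE_space
  proof eventually_elim
    case (elim y)
    have "\<bar>f y\<bar> * \<bar>laguerre_laplace \<alpha> u l y\<bar> \<le> B * 1"
      using elim l that by (intro mult_mono laguerre_laplace_bounds) auto
    then show ?case by (simp add: abs_mult)
  qed
  have k_bound: "\<bar>k u\<bar> \<le> B" if "0 < u" for u
  proof -
    have int: "integrable \<mu> (\<lambda>y. f y * laguerre_laplace \<alpha> u l y)"
      using f_lap_bound[OF that] lap_meas_x[OF that] by (intro mu.integrable_const_bound[of _ B]) auto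
    have "\<bar>k u\<bar> \<le> (\<integral>y. \<bar>f y * laguerre_laplace \<alpha> u l y\<bar> \<partial>\<mu>)"
      unfolding k_def by (rule integral_abs_bound)
    also have "\<dots> \<le> (\<integral>y. B \<partial>\<mu>)"
      using f_lap_bound[OF that] int by (intro integral_mono_AE integrable_abs) auto
    finally show ?thesis using mu.prob_space by simp
  qed
  have k_lim: "(\<lambda>n. k (X n)) \<longlonglongrightarrow> (\<integral>y. f y * exp (- (l \<bullet> y)) \<partial>\<mu>)"
    if X: "X \<longlonglongrightarrow> 0" "\<And>n. 0 < X n" for X
    unfolding k_def
  proof (rule integral_dominated_convergence[where w="\<lambda>_. B"])
    show "(\<lambda>y. f y * exp (- (l \<bullet> y))) \<in> borel_measurable \<mu>"
      by (intro borel_measurable_times f(1) borel_measurable_laguerre_measure) simp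
    show "(\<lambda>y. f y * laguerre_laplace \<alpha> (X n) l y) \<in> borel_measurable \<mu>" for n
      by (intro borel_measurable_times f(1) lap_meas_x X)
    show "AE y in \<mu>. (\<lambda>n. f y * laguerre_laplace \<alpha> (X n) l y) \<longlonglongrightarrow> f y * exp (- (l \<bullet> y))"
      by (intro AE_I2 tendsto_intros laguerre_laplace_tendsto X)
    show "AE y in \<mu>. norm (f y * laguerre_laplace \<alpha> (X n) l y) \<le> B" for n
      using f_lap_bound[OF X(2)] by simp
  qed simp
  have k_meas: "k \<in> borel_measurable time_space"
    unfolding k_def[abs_def]
    by (rule mu.borel_measurable_lebesgue_integral)
       (use lap_meas f(1) in \<open>auto simp: split_beta' intro!: borel_measurable_times measurable_compose[OF measurable_snd f(1)]\<close>)
  have scale [measurable]: "(\<lambda>v. t\<^sup>2 * v) \<in> stable_half 1 \<rightarrow>\<^sub>M time_space" if "0 < t" for t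
    using that by (intro measurable_restrict_space2 borel_measurable_stable_half) auto
  have eq: "(\<integral>x. exp (- (l \<bullet> x)) * (\<integral>y. f y \<partial>poisson_transition \<alpha> (\<tau> n) x) \<partial>\<mu>) = (\<integral>v. k ((\<tau> n)\<^sup>2 * v) \<partial>stable_half 1)" for n
  proof -
    have "(\<integral>x. exp (- (l \<bullet> x)) * (\<integral>y. f y \<partial>poisson_transition \<alpha> (\<tau> n) x) \<partial>\<mu>) = (\<integral>u. k u \<partial>stable_half (\<tau> n))"
      unfolding k_def by (rule integral_exp_poisson_transition[OF f \<tau>(2) l])
    also have "\<dots> = (\<integral>u. k u \<partial>distr (stable_half 1) time_space (\<lambda>v. (\<tau> n)\<^sup>2 * v))"
      by (simp add: stable_half_scale[OF \<tau>(2)])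
    also have "\<dots> = (\<integral>v. k ((\<tau> n)\<^sup>2 * v) \<partial>stable_half 1)"
      by (rule integral_distr[OF scale[OF \<tau>(2)] k_meas])
    finally show ?thesis .
  qed
  have "(\<lambda>n. \<integral>v. k ((\<tau> n)\<^sup>2 * v) \<partial>stable_half 1) \<longlonglongrightarrow> (\<integral>v. (\<integral>y. f y * exp (- (l \<bullet> y)) \<partial>\<mu>) \<partial>stable_half 1)"
  proof (rule integral_dominated_convergence[where w="\<lambda>_. B"])
    show "(\<lambda>v. k ((\<tau> n)\<^sup>2 * v)) \<in> borel_measurable (stable_half 1)" for n
      by (rule measurable_compose[OF scale[OF \<tau>(2)] k_meas])
    show "AE v in stable_half 1. (\<lambda>n. k ((\<tau> n)\<^sup>2 * v)) \<longlonglongrightarrow> (\<integral>y. f y * exp (- (l \<bullet> y)) \<partial>\<mu>)"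
    proof (rule AE_I2)
      fix v assume "v \<in> space (stable_half 1)"
      then have v: "0 < v" by simp
      have "(\<lambda>n. (\<tau> n)\<^sup>2 * v) \<longlonglongrightarrow> 0\<^sup>2 * v"
        by (intro tendsto_intros \<tau>)
      then show "(\<lambda>n. k ((\<tau> n)\<^sup>2 * v)) \<longlonglongrightarrow> (\<integral>y. f y * exp (- (l \<bullet> y)) \<partial>\<mu>)"
        using \<tau>(2) v by (intro k_lim mult_pos_pos zero_less_power) auto
    qed
    show "AE v in stable_half 1. norm (k ((\<tau> n)\<^sup>2 * v)) \<le> B" for n
      using k_bound[OF mult_pos_pos[OF zero_less_power[OF \<tau>(2)]]] by (intro AE_I2) auto
  qed simp_all
  then show ?thesis
    unfolding eq using S.prob_space by (simp add: mult.commute)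
qed

text \<open>Adding B makes both functions nonnegative almost everywhere, hence densities of finite
  measures with equal Laplace transforms; these measures coincide, and so do their
  densities.\<close>

lemma AE_eq_of_laplace_eq:
  fixes f g :: "real ^ 'd \<Rightarrow> real"
  assumes f: "f \<in> borel_measurable \<mu>" "AE y in \<mu>. \<bar>f y\<bar> \<le> B"
    and g: "g \<in> borel_measurable \<mu>" "AE y in \<mu>. \<bar>g y\<bar> \<le> B"
    and eq: "\<And>l. (\<And>i. 0 \<le> l $ i) \<Longrightarrow> (\<integral>x. exp (- (l \<bullet> x)) * f x \<partial>\<mu>) = (\<integral>x. exp (- (l \<bullet> x)) * g x \<partial>\<mu>)"
  shows "AE x in \<mu>. f x = g x"
proof -
  let ?D = "\<lambda>h. density \<mu> (\<lambda>x. ennreal (h x + B))"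
  have e: "(\<lambda>x. exp (- (l \<bullet> x))) \<in> borel_measurable \<mu>" for l
    by (intro borel_measurable_laguerre_measure) simp
  have e_bound: "\<bar>exp (- (l \<bullet> x))\<bar> \<le> 1" if "\<And>i. 0 \<le> l $ i" "x \<in> pos_orthant" for l x :: "real ^ 'd"
    using that by (auto intro!: sum_nonneg simp: inner_vec_def pos_orthant_def less_imp_le)
  have nn: "(\<integral>\<^sup>+x. ennreal (exp (- (l \<bullet> x))) \<partial>?D h) =
      ennreal ((\<integral>x. exp (- (l \<bullet> x)) * h x \<partial>\<mu>) + B * (\<integral>x. exp (- (l \<bullet> x)) \<partial>\<mu>))"
    if h: "h \<in> borel_measurable \<mu>" "AE y in \<mu>. \<bar>h y\<bar> \<le> B" and l: "\<And>i. 0 \<le> l $ i" for h l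
  proof -
    note e[measurable] h(1)[measurable]
    have i1: "integrable \<mu> (\<lambda>x. exp (- (l \<bullet> x)))"
      using e_bound[OF l] by (intro mu.integrable_const_bound[of _ 1] AE_I2) auto
    have i2: "integrable \<mu> (\<lambda>x. exp (- (l \<bullet> x)) * h x)"
    proof (rule mu.integrable_const_bound[of _ B])
      show "AE x in \<mu>. norm (exp (- (l \<bullet> x)) * h x) \<le> B"
        using h(2) AE_space
      proof eventually_elim
        case (elim x)
        have "\<bar>exp (- (l \<bullet> x))\<bar> * \<bar>h x\<bar> \<le> 1 * B"
          using elim l by (intro mult_mono e_bound) auto
        then show ?case by (simp add: abs_mult)
      qed
    qed measurable
    have i3: "integrable \<mu> (\<lambda>x. exp (- (l \<bullet> x)) * (h x + B))"
      using i1 i2 by (simp add: distrib_left)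
    have nonneg: "AE x in \<mu>. 0 \<le> h x + B"
      using h(2) by eventually_elim linarith
    have "(\<integral>\<^sup>+x. ennreal (exp (- (l \<bullet> x))) \<partial>?D h) =
        (\<integral>\<^sup>+x. ennreal (h x + B) * ennreal (exp (- (l \<bullet> x))) \<partial>\<mu>)"
      by (intro nn_integral_density) auto
    also have "\<dots> = (\<integral>\<^sup>+x. ennreal (exp (- (l \<bullet> x)) * (h x + B)) \<partial>\<mu>)"
      by (intro nn_integral_cong) (simp add: ennreal_mult'' mult.commute)
    also have "\<dots> = ennreal (\<integral>x. exp (- (l \<bullet> x)) * (h x + B) \<partial>\<mu>)"
      using nonneg by (intro nn_integral_eq_integral i3) auto
    also have "(\<integral>x. exp (- (l \<bullet> x)) * (h x + B) \<partial>\<mu>) = (\<integral>x. exp (- (l \<bullet> x)) * h x \<partial>\<mu>) + B * (\<integral>x. exp (- (l \<bullet> x)) \<partial>\<mu>)"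
      using i1 i2 by (simp add: distrib_left distrib_right mult.commute)
    finally show ?thesis .
  qed
  \<comment> \<open>At l = 0 the transform is the total mass.\<close>
  have fin: "finite_measure (?D h)"
    if h: "h \<in> borel_measurable \<mu>" "AE y in \<mu>. \<bar>h y\<bar> \<le> B" for h
    using nn[OF h, of 0] by (intro finite_measureI) simp
  have "?D f = ?D g"
  proof (rule laplace_transform_unique[where S=pos_orthant])
    show "0 \<le> x \<bullet> b" if "x \<in> pos_orthant" "b \<in> Basis" for x b :: "real ^ 'd"
      using that by (auto simp: Basis_vec_def pos_orthant_def inner_axis less_imp_le)
    fix l :: "real ^ 'd" assume "\<And>b. b \<in> Basis \<Longrightarrow> 0 \<le> l \<bullet> b"
    from this[of "axis _ 1"] have l: "0 \<le> l $ i" for i by (simp add: inner_axis)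
    show "(\<integral>\<^sup>+x. ennreal (exp (- (l \<bullet> x))) \<partial>?D f) =
      (\<integral>\<^sup>+x. ennreal (exp (- (l \<bullet> x))) \<partial>?D g)"
      using nn[OF f l] nn[OF g l] eq[OF l] by simp
  qed (simp_all add: sets_laguerre_measure fin f g)
  then have "AE x in \<mu>. ennreal (f x + B) = ennreal (g x + B)"
    using f(1) g(1) by (intro mu.density_unique) auto
  \<comment> \<open>\<open>ennreal\<close> is injective on nonnegative reals only, hence the appeal
    to the bounds on f and g.\<close>
  then show ?thesis
    using f(2) g(2) by eventually_elim (subst (asm) ennreal_inj; linarith)
qed

text \<open>Tested against an exponential, P_t f tends to the transform of f by weak convergence and
  to that of g by dominated convergence from the assumed limit. Equal transforms then give f =
  g.\<close>

lemma poisson_transition_initial_value: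
  fixes f g :: "real ^ 'd \<Rightarrow> real"
  assumes f: "f \<in> borel_measurable \<mu>" "AE y in \<mu>. \<bar>f y\<bar> \<le> B"
    and g: "g \<in> borel_measurable \<mu>" "AE y in \<mu>. \<bar>g y\<bar> \<le> B"
    and lim: "AE x in \<mu>. ((\<lambda>t. \<integral>y. f y \<partial>poisson_transition \<alpha> t x) \<longlongrightarrow> g x) (at_right 0)"
  shows "AE x in \<mu>. f x = g x"
proof (rule AE_eq_of_laplace_eq[OF f g])
  fix l :: "real ^ 'd" assume l: "\<And>i. 0 \<le> l $ i"
  define \<tau> where "\<tau> n = inverse (real (Suc n))" for n
  have \<tau>: "\<tau> \<longlonglongrightarrow> 0" "0 < \<tau> n" for n
    unfolding \<tau>_def by (rule LIMSEQ_inverse_real_of_nat) simp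
  have \<tau>_right: "filterlim \<tau> (at_right 0) sequentially"
    using \<tau> by (intro filterlim_at_withinI) auto
  have e: "(\<lambda>x. exp (- (l \<bullet> x))) \<in> borel_measurable \<mu>"
    by (intro borel_measurable_laguerre_measure) simp
  have bound: "\<bar>\<integral>y. f y \<partial>poisson_transition \<alpha> t x\<bar> \<le> B" if "0 < t" "x \<in> pos_orthant" for t x
  proof -
    interpret S: prob_space "stable_half t" by (rule prob_space_stable_half[OF that(1)])
    let ?h = "\<lambda>u. \<integral>y. f y \<partial>laguerre_transition \<alpha> u x"
    have b: "\<bar>?h u\<bar> \<le> B" if "0 < u" for u
      by (rule laguerre_transition_integral_bound(2)[OF f that \<open>x \<in> pos_orthant\<close>])
    have "?h \<in> borel_measurable (stable_half t)"
      using laguerre_transition_integral_measurable_time[OF f(1) that(2)]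
      by (simp add: measurable_cong_sets[OF sets_stable_half refl])
    then have int: "integrable (stable_half t) ?h"
      using b by (intro S.integrable_const_bound[of _ B] AE_I2) auto
    have "\<bar>\<integral>u. ?h u \<partial>stable_half t\<bar> \<le> (\<integral>u. \<bar>?h u\<bar> \<partial>stable_half t)"
      by (rule integral_abs_bound)
    also have "\<dots> \<le> (\<integral>u. B \<partial>stable_half t)"
      using b int by (intro integral_mono integrable_abs) auto
    finally show ?thesis
      using S.prob_space by (simp add: integral_poisson_transition[OF f that])
  qed
  have "(\<lambda>n. \<integral>x. exp (- (l \<bullet> x)) * (\<integral>y. f y \<partial>poisson_transition \<alpha> (\<tau> n) x) \<partial>\<mu>)
      \<longlonglongrightarrow> (\<integral>x. exp (- (l \<bullet> x)) * g x \<partial>\<mu>)"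
  proof (rule integral_dominated_convergence[where w="\<lambda>_. B"])
    show "(\<lambda>x. exp (- (l \<bullet> x)) * g x) \<in> borel_measurable \<mu>"
      by (intro borel_measurable_times e g(1))
    show "(\<lambda>x. exp (- (l \<bullet> x)) * (\<integral>y. f y \<partial>poisson_transition \<alpha> (\<tau> n) x)) \<in> borel_measurable \<mu>" for n
      by (intro borel_measurable_times e
          measurable_compose[OF measurable_prob_algebraD[OF poisson_transition_space[OF \<tau>(2)]] integral_measurable_subprob_algebra[OF f(1)]])
    show "AE x in \<mu>. (\<lambda>n. exp (- (l \<bullet> x)) * (\<integral>y. f y \<partial>poisson_transition \<alpha> (\<tau> n) x)) \<longlonglongrightarrow> exp (- (l \<bullet> x)) * g x"
      using lim by eventually_elim (intro tendsto_intros filterlim_compose[OF _ \<tau>_right])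
    show "AE x in \<mu>. norm (exp (- (l \<bullet> x)) * (\<integral>y. f y \<partial>poisson_transition \<alpha> (\<tau> n) x)) \<le> B" for n
    proof (rule AE_I2)
      fix x assume "x \<in> space \<mu>"
      then have x: "x \<in> pos_orthant" by simp
      have "0 \<le> l \<bullet> x"
        using l x by (auto intro!: sum_nonneg simp: inner_vec_def pos_orthant_def less_imp_le)
      then have "\<bar>exp (- (l \<bullet> x))\<bar> * \<bar>\<integral>y. f y \<partial>poisson_transition \<alpha> (\<tau> n) x\<bar> \<le> 1 * B"
        by (intro mult_mono bound[OF \<tau>(2) x]) auto
      then show "norm (exp (- (l \<bullet> x)) * (\<integral>y. f y \<partial>poisson_transition \<alpha> (\<tau> n) x)) \<le> B"
        by (simp add: abs_mult)
    qed
  qed simp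
  with poisson_transition_exp_limit[OF f l \<tau>]
  show "(\<integral>x. exp (- (l \<bullet> x)) * f x \<partial>\<mu>) = (\<integral>x. exp (- (l \<bullet> x)) * g x \<partial>\<mu>)"
    by (rule LIMSEQ_unique)
qed

section \<open>The concrete semigroup, its definition by integrals, and essential suprema\<close>

lemma markov_operator_semigroup_poisson:
  "markov_operator_semigroup \<mu> (poisson_transition \<alpha>)"
proof (rule markov_operator_semigroup.intro)
  fix t :: real and x :: "real ^ 'd" assume t: "0 < t" and "x \<in> space \<mu>"
  then have x: "x \<in> pos_orthant" by simp
  show "prob_space (poisson_transition \<alpha> t x)"
    by (rule poisson_transition_in_prob_algebra(1)[OF t x])
  show "sets (poisson_transition \<alpha> t x) = sets \<mu>"
    by (rule poisson_transition_in_prob_algebra(2)[OF t x])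
  show "absolutely_continuous \<mu> (poisson_transition \<alpha> t x)"
    by (rule absolutely_continuous_poisson_transition[OF t x])
next
  fix f :: "real ^ 'd \<Rightarrow> real" assume "f \<in> borel_measurable \<mu>"
  from measurable_compose[OF measurable_prob_algebraD[OF measurable_poisson_transition] integral_measurable_subprob_algebra[OF this]]
  show "(\<lambda>(t, x). \<integral>y. f y \<partial>poisson_transition \<alpha> t x) \<in> borel_measurable (time_space \<Otimes>\<^sub>M \<mu>)"
    by (simp add: split_beta')
next
  fix f :: "real ^ 'd \<Rightarrow> real" and B t x
  assume f: "f \<in> borel_measurable \<mu>" "AE y in \<mu>. \<bar>f y\<bar> \<le> B"
    and t: "0 < (t :: real)" and "x \<in> space \<mu>"
  then have x: "x \<in> pos_orthant" by simp
  have tr_AE: "AE z in poisson_transition \<alpha> s y. \<bar>f z\<bar> \<le> B" if "0 < s" "y \<in> pos_orthant" for s y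
    by (rule absolutely_continuous_AE[OF poisson_transition_in_prob_algebra(2)[OF that] absolutely_continuous_poisson_transition[OF that] f(2)])
  show "(\<integral>y. (\<integral>z. f z \<partial>poisson_transition \<alpha> s y) \<partial>poisson_transition \<alpha> t x) = (\<integral>z. f z \<partial>poisson_transition \<alpha> (s + t) x)"
    if s: "0 < s" for s
  proof -
    note sets_t = poisson_transition_in_prob_algebra(2)[OF t x]
    have "(\<integral>z. f z \<partial>poisson_transition \<alpha> (t + s) x) = (\<integral>z. f z \<partial>(poisson_transition \<alpha> t x \<bind> poisson_transition \<alpha> s))"
      by (simp add: poisson_transition_semigroup[OF s t x])
    also have "\<dots> = (\<integral>y. (\<integral>z. f z \<partial>poisson_transition \<alpha> s y) \<partial>poisson_transition \<alpha> t x)"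
    proof (rule integral_bind_prob[OF poisson_transition_in_prob_algebra(1)[OF t x] _ f(1)])
      show "poisson_transition \<alpha> s \<in> poisson_transition \<alpha> t x \<rightarrow>\<^sub>M prob_algebra \<mu>"
        using poisson_transition_space[OF s] by (simp add: measurable_cong_sets[OF sets_t refl])
      show "AE y in poisson_transition \<alpha> t x. AE z in poisson_transition \<alpha> s y. \<bar>f z\<bar> \<le> B"
        by (rule AE_I2, rule tr_AE[OF s]) (simp add: sets_eq_imp_space_eq[OF sets_t])
    qed
    finally show ?thesis by (simp add: add.commute)
  qed
  show "\<exists>D. ((\<lambda>t. \<integral>y. f y \<partial>poisson_transition \<alpha> t x) has_real_derivative D) (at t) \<and> \<bar>D\<bar> \<le> 8 * B / t"
  proof -
    have "\<exists>D. ((\<lambda>t. \<integral>u. (\<integral>y. f y \<partial>laguerre_transition \<alpha> u x) \<partial>stable_half t) has_real_derivative D) (at t) \<and> \<bar>D\<bar> \<le> 8 * B / t"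
      using laguerre_transition_integral_bound(2)[OF f _ x]
      by (intro integral_stable_half_differentiable laguerre_transition_integral_measurable_time[OF f(1) x] t) auto
    then obtain D where D: "((\<lambda>t. \<integral>u. (\<integral>y. f y \<partial>laguerre_transition \<alpha> u x) \<partial>stable_half t) has_real_derivative D) (at t)" "\<bar>D\<bar> \<le> 8 * B / t"
      by blast
    have "((\<lambda>t. \<integral>y. f y \<partial>poisson_transition \<alpha> t x) has_real_derivative D) (at t)"
      by (rule has_field_derivative_transform_within_open[where S="{0<..}", OF D(1)])
         (use t integral_poisson_transition[OF f _ x] in auto)
    with D(2) show ?thesis by blast
  qed
next
  fix f g :: "real ^ 'd \<Rightarrow> real" and B :: real
  assume "f \<in> borel_measurable \<mu>" "g \<in> borel_measurable \<mu>"
    "AE x in \<mu>. \<bar>f x\<bar> \<le> B" "AE x in \<mu>. \<bar>g x\<bar> \<le> B"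
    "AE x in \<mu>. ((\<lambda>t. \<integral>y. f y \<partial>poisson_transition \<alpha> t x) \<longlongrightarrow> g x) (at_right 0)"
  then show "AE x in \<mu>. f x = g x"
    by (intro poisson_transition_initial_value)
qed

text \<open>Turns the defining iterated integral into an integral against one probability measure,
  which opens it to the abstract estimates; the bound on f permits unfolding the mixture.\<close>

lemma poisson_laguerre_eq:
  fixes f :: "real ^ 'd \<Rightarrow> real"
  assumes f: "f \<in> borel_measurable \<mu>" "AE y in \<mu>. \<bar>f y\<bar> \<le> B"
    and t: "0 < t" and x: "x \<in> pos_orthant"
  shows "poisson_laguerre \<alpha> t f x = (\<integral>y. f y \<partial>poisson_transition \<alpha> t x)"
proof -
  have "poisson_laguerre \<alpha> t f x = (\<integral>s. laguerre_semigroup \<alpha> s f x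
        * (t / (2 * sqrt pi)) * (exp (- t\<^sup>2 / (4 * s)) / s powr (3 / 2)) \<partial>lborel_pos)"
    unfolding poisson_laguerre_def set_lebesgue_integral_def by (subst integral_restrict_space) auto
  also have "\<dots> = (\<integral>s. stable_density t s * (\<integral>y. f y \<partial>laguerre_transition \<alpha> s x) \<partial>lborel_pos)"
    by (intro Bochner_Integration.integral_cong refl)
       (simp add: stable_density_def laguerre_semigroup_def integral_laguerre_transition(1)[OF f(1) _ x] space_restrict_space)
  also have "\<dots> = (\<integral>s. (\<integral>y. f y \<partial>laguerre_transition \<alpha> s x) \<partial>stable_half t)"
    using t by (intro integral_stable_half(1)[symmetric] laguerre_transition_integral_measurable_time[OF f(1) x]) simp
  also have "\<dots> = (\<integral>y. f y \<partial>poisson_transition \<alpha> t x)"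
    by (rule integral_poisson_transition[OF f t x, symmetric])
  finally show ?thesis .
qed

interpretation P: markov_operator_semigroup "\<mu>" "poisson_transition \<alpha>"
  by (rule markov_operator_semigroup_poisson)

text \<open>Also a statement about the measure: over a zero measure the essential supremum of a
  measurable function is minus infinity, so the total mass 1 enters.\<close>

lemma Linf_norm_nonneg:
  fixes h :: "real ^ 'd \<Rightarrow> real"
  shows "0 \<le> Linf_norm \<mu> h"
proof -
  have "esssup \<mu> (\<lambda>_. 0 :: ereal) = 0"
    using mu.emeasure_space_1 by (intro esssup_const) simp
  moreover have "esssup \<mu> (\<lambda>_. 0) \<le> esssup \<mu> (\<lambda>x. ereal \<bar>h x\<bar>)"
    by (rule esssup_mono) auto
  ultimately show ?thesis by (simp add: Linf_norm_def)
qed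

lemma Linf_norm_AE:
  fixes h :: "real ^ 'd \<Rightarrow> real"
  assumes "Linf_norm \<mu> h \<le> ereal c"
  shows "AE x in \<mu>. \<bar>h x\<bar> \<le> c"
proof -
  have "AE x in \<mu>. ereal \<bar>h x\<bar> \<le> Linf_norm \<mu> h"
    unfolding Linf_norm_def by (rule esssup_AE)
  then show ?thesis
  proof eventually_elim
    case (elim x)
    then have "ereal \<bar>h x\<bar> \<le> ereal c" using assms by (rule order_trans)
    then show ?case by simp
  qed
qed

text \<open>Measurability is essential: \<open>esssup\<close> of a function that is not measurable
  is the top element. This is what \<open>V_measurable\<close> and \<open>frac_op_measurable\<close>
  are needed for.\<close>

lemma Linf_norm_le:
  fixes h :: "real ^ 'd \<Rightarrow> real"
  assumes "h \<in> borel_measurable \<mu>" "AE x in \<mu>. \<bar>h x\<bar> \<le> c"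
  shows "Linf_norm \<mu> h \<le> ereal c"
  unfolding Linf_norm_def using assms by (intro esssup_I) auto

text \<open>At t = 1 the power of t is 1, so A dominates a nonnegative essential supremum. This
  bounds the admissible constants below, as the infimum in \<open>laguerre_lip_const\<close>
  requires.\<close>

lemma laguerre_lip_bound_nonneg:
  fixes f :: "real ^ 'd \<Rightarrow> real"
  assumes "laguerre_lip_bound \<alpha> \<beta> f A"
  shows "0 \<le> A"
proof -
  have "0 \<le> Linf_norm \<mu> (\<lambda>x. (deriv ^^ lip_order \<beta>) (\<lambda>s. poisson_laguerre \<alpha> s f x) 1)"
    by (rule Linf_norm_nonneg)
  also have "\<dots> \<le> ereal A"
    using assms[unfolded laguerre_lip_bound_def, rule_format, of 1] by simp
  finally show ?thesis by simp
qed

lemma deriv_poisson_laguerre: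
  fixes f :: "real ^ 'd \<Rightarrow> real"
  assumes f: "f \<in> borel_measurable \<mu>" "AE y in \<mu>. \<bar>f y\<bar> \<le> B"
    and t: "0 < t" and x: "x \<in> pos_orthant"
  shows "deriv (\<lambda>s. poisson_laguerre \<alpha> s f x) t = P.V t f x"
  unfolding P.V_def
proof (rule deriv_cong_ev[OF _ refl])
  have "eventually (\<lambda>s. s \<in> {0<..}) (nhds t)"
    using t by (intro eventually_nhds_in_open) auto
  then show "eventually (\<lambda>s. poisson_laguerre \<alpha> s f x = P.Q s f x) (nhds t)"
    by eventually_elim (simp add: poisson_laguerre_eq[OF f _ x] P.Q_def)
qed

end

section \<open>Boundedness of the Laguerre fractional derivative\<close>

lemma lip_order_eq_1: "0 \<le> \<gamma> \<Longrightarrow> \<gamma> < 1 \<Longrightarrow> lip_order \<gamma> = 1"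
  unfolding lip_order_def by (rule Least_equality) (auto simp: Suc_le_eq intro: Nat.gr0I)

text \<open>The clause on integrability guarantees that the integral in
  \<open>laguerre_frac_deriv\<close> takes its default value on a null set only.\<close>

theorem theorem4p2:
  fixes \<alpha> :: "real ^ 'd" and \<kappa> \<beta> :: real
  assumes "\<And>i. - 1 / 2 < \<alpha> $ i"
    and "0 < \<kappa>" and "\<kappa> < \<beta>" and "\<beta> < 1"
  shows "\<exists>C. \<forall>f \<in> laguerre_Lip \<alpha> \<beta>.
           (AE x in laguerre_measure \<alpha>.
              set_integrable lborel {0<..} (laguerre_frac_integrand \<alpha> \<kappa> f x)) \<and>
           laguerre_frac_deriv \<alpha> \<kappa> f \<in> laguerre_Lip \<alpha> (\<beta> - \<kappa>) \<and>
           laguerre_lip_norm \<alpha> (\<beta> - \<kappa>) (laguerre_frac_deriv \<alpha> \<kappa> f)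
             \<le> C * laguerre_lip_norm \<alpha> \<beta> f"
proof -
  have \<alpha>: "- 1 < \<alpha> $ i" for i
    using assms(1)[of i] by simp
  let ?M = "laguerre_measure \<alpha>"
  interpret P: markov_operator_semigroup ?M "poisson_transition \<alpha>"
    by (rule markov_operator_semigroup_poisson[OF \<alpha>])
  have order: "lip_order \<beta> = 1" "lip_order (\<beta> - \<kappa>) = 1"
    using assms by (simp_all add: lip_order_eq_1)
  define c where "c = 1 / frac_const \<kappa>"
  define L where "L = frac_lip_factor \<beta> \<kappa>"
  have L: "0 \<le> L"
    using assms unfolding L_def frac_lip_factor_def by simp
  \<comment> \<open>The bracket collects the coefficients of A and B in the bounds for both parts of
    the norm; the extra 1 keeps C positive whatever c is, since C becomes a divisor at the
    end.\<close>
  define C where "C = \<bar>c\<bar> * (2 / \<beta> / (\<beta> - \<kappa>) + 2 / \<kappa> + L) + 1"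
  have C: "0 < C"
    using assms L by (simp add: C_def add_nonneg_pos)
  show ?thesis
  proof (intro exI[of _ C] ballI)
    fix f assume "f \<in> laguerre_Lip \<alpha> \<beta>"
    then have f_meas: "f \<in> borel_measurable ?M" and f_fin: "Linf_norm ?M f < \<infinity>" and f_lip: "\<exists>A. laguerre_lip_bound \<alpha> \<beta> f A"
      by (auto simp: laguerre_Lip_def)
    define B where "B = real_of_ereal (Linf_norm ?M f)"
    have B: "0 \<le> B" "Linf_norm ?M f = ereal B"
      using f_fin Linf_norm_nonneg[OF \<alpha>, of f] by (auto simp: B_def real_of_ereal_pos ereal_real)
    have f: "f \<in> borel_measurable ?M" "AE x in ?M. \<bar>f x\<bar> \<le> B"
      using f_meas Linf_norm_AE[OF \<alpha>, of f B] B(2) by auto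
    let ?F = "laguerre_frac_deriv \<alpha> \<kappa> f"
    \<comment> \<open>Stated for an arbitrary admissible A; the infimum over A is taken only
      afterwards.\<close>
    have main: "(AE x in ?M. set_integrable lborel {0<..} (laguerre_frac_integrand \<alpha> \<kappa> f x)) \<and>
        ?F \<in> laguerre_Lip \<alpha> (\<beta> - \<kappa>) \<and> laguerre_lip_norm \<alpha> (\<beta> - \<kappa>) ?F \<le> C * (B + A)"
      if A: "laguerre_lip_bound \<alpha> \<beta> f A" for A
    proof -
      have lip: "AE x in ?M. \<bar>P.V t f x\<bar> \<le> A * t powr (\<beta> - 1)" if t: "0 < t" for t
      proof -
        have "Linf_norm ?M (\<lambda>x. deriv (\<lambda>s. poisson_laguerre \<alpha> s f x) t) \<le> ereal (A * t powr (\<beta> - 1))"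
          using A t unfolding laguerre_lip_bound_def order by simp
        from Linf_norm_AE[OF \<alpha> this] show ?thesis
          using AE_space by eventually_elim (simp add: deriv_poisson_laguerre[OF \<alpha> f t])
      qed
      have A0: "0 \<le> A"
        by (rule laguerre_lip_bound_nonneg[OF \<alpha> A])
      from lip have "\<forall>t>0. AE x in ?M. \<bar>P.V t f x\<bar> \<le> A * t powr (\<beta> - 1)"
        by blast
      note frac = f this A0 B(1) assms(2-4)
      let ?G = "P.frac_op f \<kappa> c"
      \<comment> \<open>The two forms of the operator are compared on the orthant only; transition
        measures started there never see the rest.\<close>
      have F_eq: "?F x = ?G x" if x: "x \<in> pos_orthant" for x
      proof -
        have "(LBINT s:{0<..}. laguerre_frac_integrand \<alpha> \<kappa> f x s) = (\<integral>s. laguerre_frac_integrand \<alpha> \<kappa> f x s \<partial>lborel_pos)"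
          unfolding set_lebesgue_integral_def by (subst integral_restrict_space) auto
        also have "\<dots> = (\<integral>s. s powr (- \<kappa> - 1) * (P.Q s f x - f x) \<partial>lborel_pos)"
          by (intro Bochner_Integration.integral_cong refl)
             (simp add: laguerre_frac_integrand_def poisson_laguerre_eq[OF \<alpha> f _ x] P.Q_def space_restrict_space)
        finally show ?thesis
          by (simp add: laguerre_frac_deriv_def P.frac_op_def c_def)
      qed
      have integrable: "AE x in ?M. set_integrable lborel {0<..} (laguerre_frac_integrand \<alpha> \<kappa> f x)"
        using P.frac_op_integrand_AE[OF frac] AE_space
      proof eventually_elim
        case (elim x)
        then have "integrable lborel_pos (laguerre_frac_integrand \<alpha> \<kappa> f x) \<longleftrightarrow>
            integrable lborel_pos (\<lambda>s. s powr (- \<kappa> - 1) * (P.Q s f x - f x))"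
          by (intro Bochner_Integration.integrable_cong refl)
             (simp add: laguerre_frac_integrand_def poisson_laguerre_eq[OF \<alpha> f] P.Q_def space_restrict_space)
        then show ?case
          using elim unfolding set_integrable_def by (simp add: integrable_restrict_space)
      qed
      let ?K = "\<bar>c\<bar> * frac_bound A B \<beta> \<kappa>"
      have F_meas: "?F \<in> borel_measurable ?M"
        using P.frac_op_measurable[OF frac, of c] F_eq by (subst measurable_cong[of _ _ ?G]) auto
      have F_bound: "AE x in ?M. \<bar>?F x\<bar> \<le> ?K"
        using P.frac_op_AE_bound[OF frac, of c] AE_space by eventually_elim (simp add: F_eq)
      have F_Linf: "Linf_norm ?M ?F \<le> ereal ?K"
        by (rule Linf_norm_le[OF \<alpha> F_meas F_bound])
      have Q_eq: "P.Q t ?F x = P.Q t ?G x" if "0 < t" "x \<in> pos_orthant" for t x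
        unfolding P.Q_def
        by (rule Bochner_Integration.integral_cong[OF refl F_eq]) (use P.space_P[of t x] that in auto)
      have V_eq: "P.V t ?F x = P.V t ?G x" if "0 < t" "x \<in> pos_orthant" for t x
        unfolding P.V_def
      proof (rule deriv_cong_ev[OF _ refl])
        have "eventually (\<lambda>s. s \<in> {0<..}) (nhds t)"
          using that by (intro eventually_nhds_in_open) auto
        then show "eventually (\<lambda>s. P.Q s ?F x = P.Q s ?G x) (nhds t)"
          by eventually_elim (simp add: Q_eq that)
      qed
      have F_lip: "laguerre_lip_bound \<alpha> (\<beta> - \<kappa>) ?F (\<bar>c\<bar> * L * A)"
        unfolding laguerre_lip_bound_def order
      proof (intro allI impI)
        fix t :: real assume t: "0 < t"
        have "Linf_norm ?M (\<lambda>x. deriv (\<lambda>s. poisson_laguerre \<alpha> s ?F x) t) \<le> ereal (\<bar>c\<bar> * L * A * t powr (\<beta> - \<kappa> - 1))"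
        proof (rule Linf_norm_le[OF \<alpha>])
          show "(\<lambda>x. deriv (\<lambda>s. poisson_laguerre \<alpha> s ?F x) t) \<in> borel_measurable ?M"
            using P.V_measurable[OF F_meas F_bound t]
            by (subst measurable_cong[where g="P.V t ?F"]) (auto simp: deriv_poisson_laguerre[OF \<alpha> F_meas F_bound t])
          show "AE x in ?M. \<bar>deriv (\<lambda>s. poisson_laguerre \<alpha> s ?F x) t\<bar> \<le> \<bar>c\<bar> * L * A * t powr (\<beta> - \<kappa> - 1)"
            using P.V_frac_op_bound[OF frac t, of _ c]
            by (intro AE_I2) (simp add: deriv_poisson_laguerre[OF \<alpha> F_meas F_bound t] V_eq[OF t] L_def)
        qed
        also have "\<beta> - \<kappa> - 1 = - real 1 + (\<beta> - \<kappa>)" by simp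
        finally show "Linf_norm ?M (\<lambda>x. (deriv ^^ 1) (\<lambda>s. poisson_laguerre \<alpha> s ?F x) t) \<le> ereal (\<bar>c\<bar> * L * A * t powr (- real 1 + (\<beta> - \<kappa>)))"
          by simp
      qed
      have const: "laguerre_lip_const \<alpha> (\<beta> - \<kappa>) ?F \<le> \<bar>c\<bar> * L * A"
        unfolding laguerre_lip_const_def
      proof (rule cInf_lower)
        show "bdd_below {A. laguerre_lip_bound \<alpha> (\<beta> - \<kappa>) ?F A}"
          using laguerre_lip_bound_nonneg[OF \<alpha>] by (intro bdd_belowI[of _ 0]) auto
      qed (use F_lip in simp)
      have "real_of_ereal (Linf_norm ?M ?F) \<le> ?K"
        using F_Linf Linf_norm_nonneg[OF \<alpha>, of ?F] by (cases "Linf_norm ?M ?F") auto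
      with const have "laguerre_lip_norm \<alpha> (\<beta> - \<kappa>) ?F \<le> ?K + \<bar>c\<bar> * L * A"
        by (simp add: laguerre_lip_norm_def)
      also have "\<dots> \<le> C * (B + A)"
      proof -
        define p q where "p = 2 / \<beta> / (\<beta> - \<kappa>)" and "q = 2 / \<kappa>"
        have pq: "0 \<le> p" "0 \<le> q" using assms by (simp_all add: p_def q_def)
        have "frac_bound A B \<beta> \<kappa> + L * A = p * A + q * B + L * A"
          by (simp add: frac_bound_def p_def q_def)
        \<comment> \<open>The added cross terms are nonnegative and complete the product (p + q + L)
          (B + A).\<close>
        also have "\<dots> \<le> p * A + q * B + L * A + (p * B + q * A + L * B)"
          using pq L A0 B(1) by simp
        also have "\<dots> = (p + q + L) * (B + A)"
          by (simp add: algebra_simps)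
        finally have "\<bar>c\<bar> * (frac_bound A B \<beta> \<kappa> + L * A) \<le> \<bar>c\<bar> * ((p + q + L) * (B + A))"
          by (rule mult_left_mono) simp
        then have "?K + \<bar>c\<bar> * L * A \<le> \<bar>c\<bar> * (p + q + L) * (B + A)"
          by (simp add: algebra_simps)
        also have "\<dots> \<le> C * (B + A)"
          using A0 B(1) by (intro mult_right_mono) (simp_all add: C_def p_def q_def)
        finally show ?thesis .
      qed
      finally have "laguerre_lip_norm \<alpha> (\<beta> - \<kappa>) ?F \<le> C * (B + A)" .
      moreover have "?F \<in> laguerre_Lip \<alpha> (\<beta> - \<kappa>)"
        using F_meas F_lip F_Linf by (auto simp: laguerre_Lip_def)
      ultimately show ?thesis
        using integrable by blast
    qed
    show "(AE x in ?M. set_integrable lborel {0<..} (laguerre_frac_integrand \<alpha> \<kappa> f x)) \<and>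
        ?F \<in> laguerre_Lip \<alpha> (\<beta> - \<kappa>) \<and>
        laguerre_lip_norm \<alpha> (\<beta> - \<kappa>) ?F \<le> C * laguerre_lip_norm \<alpha> \<beta> f"
    proof -
      \<comment> \<open>After division by C, \<open>main\<close> says that the left-hand side lies
        below every admissible A, hence below their infimum.\<close>
      have "laguerre_lip_norm \<alpha> (\<beta> - \<kappa>) ?F / C - B \<le> laguerre_lip_const \<alpha> \<beta> f"
        unfolding laguerre_lip_const_def
      proof (rule cInf_greatest)
        fix A assume "A \<in> {A. laguerre_lip_bound \<alpha> \<beta> f A}"
        then show "laguerre_lip_norm \<alpha> (\<beta> - \<kappa>) ?F / C - B \<le> A"
          using main[of A] C by (simp add: field_simps)
      qed (use f_lip in auto)
      then have "laguerre_lip_norm \<alpha> (\<beta> - \<kappa>) ?F \<le> C * laguerre_lip_norm \<alpha> \<beta> f"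
        using C by (simp add: laguerre_lip_norm_def B_def field_simps)
      then show ?thesis
        using main f_lip by blast
    qed
  qed
qed

end
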